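(* Let $\Omega\subseteq M$ be a p-symmetric slice domain, $\Omega_0=\Omega\cap\mathbb{R}^{p+1}$, and $f:\Omega\to\mathbb{A}$ a (left) generalized partial-slice monogenic function of type $(p,q)$. Then, for odd $q\in\mathbb{N}$, $$\mathcal{PO}\big[\Delta_{\mathbf{x}}^{\frac{q-1}{2}}f\big]=\frac{\gamma_q}{q}\,HGCK\big[0,\ \Delta_{\mathbf{x}_p}^{\frac{q-1}{2}}D_{\mathbf{x}_p}f(\mathbf{x}_p)\big],\qquad \mathcal{PE}\big[\Delta_{\mathbf{x}}^{\frac{q-1}{2}}f\big]=\gamma_q\,HGCK\big[\Delta_{\mathbf{x}_p}^{\frac{q-1}{2}}f(\mathbf{x}_p),\ 0\big],$$ and consequently $$\overline{D}_{\mathbf{x}}\,\mathcal{PO}\big[\Delta_{\mathbf{x}}^{\frac{q-1}{2}}f\big]=\gamma_q\,GCK\big[\Delta_{\mathbf{x}_p}^{\frac{q-1}{2}}D_{\mathbf{x}_p}f(\mathbf{x}_p)\big],\qquad \overline{D}_{\mathbf{x}}\,\mathcal{PE}\big[\Delta_{\mathbf{x}}^{\frac{q-1}{2}}f\big]=\gamma_q\,GCK\big[\overline{D}_{\mathbf{x}_p}\Delta_{\mathbf{x}_p}^{\frac{q-1}{2}}f(\mathbf{x}_p)\big],$$ where $\gamma_q=(-1)^{\frac{q-1}{2}}\frac{(q-1)!!}{(q-2)!!}$, the functions of $\mathbf{x}_p$ inside the brackets are computed from $f|_{\Omega_0}$, and the identities hold where the right-hand sides are defined.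
   Context: Let $\mathbb{A}$ be a real alternative algebra (the associator $[a,b,c]=(ab)c-a(bc)$ is an alternating trilinear function) with unity $1$, of finite real dimension $d>1$, equipped with an anti-involution $a\mapsto a^c$ (real linear, $a^c=a$ for real $a$, $(a^c)^c=a$, $(ab)^c=b^ca^c$). Let $t(x)=x+x^c$, $n(x)=xx^c$, $\mathbb{S}_{\mathbb{A}}=\{x: t(x)=0,\ n(x)=1\}$ (assumed nonempty) and $Q_{\mathbb{A}}=\mathbb{R}\cup\{x: t(x)\in\mathbb{R},\ n(x)\in\mathbb{R},\ 4n(x)>t(x)^2\}$. Let $M$ be a real subspace with $\mathbb{R}\subsetneq M\subseteq Q_{\mathbb{A}}$ having a basis $(v_0,\dots,v_m)$, $m\ge1$, $v_0=1$, $v_s\in\mathbb{S}_{\mathbb{A}}$, $v_sv_t=-v_tv_s$ for distinct $s,t\ge1$; complete it to a basis of $\mathbb{A}$ with associated Euclidean norm. Identify $x=\sum x_sv_s\in M$ with $(x_0,\dots,x_m)\in\mathbb{R}^{m+1}$; differentiate componentwise. Fix $p\in\{0,\dots,m-1\}$, $q=m-p$; $\mathbf{x}=\mathbf{x}_p+\underline{\mathbf{x}}_q$ with $\mathbf{x}_p=\sum_{s=0}^px_sv_s\in\mathbb{R}^{p+1}$, $\underline{\mathbf{x}}_q=\sum_{s=p+1}^m x_sv_s$; $\mathbb{S}=\{\sum_{s=p+1}^m x_sv_s:\sum x_s^2=1\}$; $\underline{\mathbf{x}}_q=r\underline{\omega}$, $r=|\underline{\mathbf{x}}_q|$. $D_{\mathbf{x}_p}f=\sum_{s=0}^p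 v_s\partial_{x_s}f$, $\overline{D}_{\mathbf{x}_p}f=\partial_{x_0}f-\sum_{s=1}^pv_s\partial_{x_s}f$, $\overline{D}_{\mathbf{x}}f=\partial_{x_0}f-\sum_{s=1}^mv_s\partial_{x_s}f$, $\Delta_{\mathbf{x}_p}=\sum_{s=0}^p\partial_{x_s}^2$, $\Delta_{\mathbf{x}}=\sum_{s=0}^m\partial_{x_s}^2$. $f$ is left generalized partial-slice monogenic of type $(p,q)$ if for every $\underline{\omega}\in\mathbb{S}$ its restriction to $\Omega_{\underline{\omega}}=\Omega\cap(\mathbb{R}^{p+1}\oplus\underline{\omega}\mathbb{R})$ is $C^1$ and $(D_{\mathbf{x}_p}+\underline{\omega}\partial_r)f(\mathbf{x}_p+r\underline{\omega})=0$. A domain is a slice domain if $\Omega\cap\mathbb{R}^{p+1}\ne\emptyset$ and each $\Omega_{\underline{\omega}}$ is a domain in $\mathbb{R}^{p+2}$; p-symmetric if $\mathbf{x}_p+r\underline{\omega}\in\Omega$, $r>0$, implies $\mathbf{x}_p+r\underline{\eta}\in\Omega$ for all $\underline{\eta}\in\mathbb{S}$. With $\mathbf{x}_\diamond=\mathbf{x}_p-\underline{\mathbf{x}}_q$: $\mathcal{PE}[h](\mathbf{x})=\frac12(h(\mathbf{x})+h(\mathbf{x}_\diamond))$, $\mathcal{PO}[h](\mathbf{x})=\frac12(h(\mathbf{x})-h(\mathbf{x}_\diamond))$. For real analytic $g,A_0,A_1$ on $\Omega_0$: $GCK[g](\mathbf{x})=\sum_{k\ge0}\frac{\Gamma(\frac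 q2)(-1)^kr^{2k}}{2^{2k}k!\Gamma(k+\frac q2)}\Delta_{\mathbf{x}_p}^kg(\mathbf{x}_p)+\underline{\mathbf{x}}_q\sum_{k\ge0}\frac{\Gamma(\frac q2)(-1)^kr^{2k}}{2^{2k+1}k!\Gamma(k+\frac q2+1)}\Delta_{\mathbf{x}_p}^k(D_{\mathbf{x}_p}g(\mathbf{x}_p))$ (the unique monogenic function of the form $\sum_k\underline{\mathbf{x}}_q^kA_k(\mathbf{x}_p)$ with $A_0=g$), and $HGCK[A_0,A_1](\mathbf{x})=\sum_{k\ge0}\frac{\Gamma(\frac q2)(-1)^kr^{2k}}{2^{2k}k!\Gamma(k+\frac q2)}\Delta_{\mathbf{x}_p}^kA_0(\mathbf{x}_p)+\underline{\mathbf{x}}_q\sum_{k\ge0}\frac{\Gamma(\frac q2+1)(-1)^kr^{2k}}{2^{2k}k!\Gamma(k+\frac q2+1)}\Delta_{\mathbf{x}_p}^kA_1(\mathbf{x}_p)$ (the unique harmonic function of the form $\sum_k\underline{\mathbf{x}}_q^kA_k(\mathbf{x}_p)$ with given $A_0,A_1$). Double factorials: $0!!=(-1)!!=1$.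
   Formalization: The identities are stated at points x of Ω where the series on the right converge and the segment from x_p to x lies in Ω; without the segment condition they can fail, e.g. for a logarithm on the plane minus two rays, where the series converges at a point beyond a cut. *)

theory Defs
  imports "HOL-Analysis.Analysis"
begin

text \<open>The algebra A is modelled as a finite-dimensional real vector space (a type of class
euclidean_space, whose dimension is DIM) with a bilinear multiplication mul, unity e and
anti-involution cj. Reals inside A are the multiples c *R e.\<close>

definition assoc3 :: "('a::real_vector \<Rightarrow> 'a \<Rightarrow> 'a) \<Rightarrow> 'a \<Rightarrow> 'a \<Rightarrow> 'a \<Rightarrow> 'a" where
  "assoc3 mul a b c = mul (mul a b) c - mul a (mul b c)"

definition real_alt_algebra :: "('a::euclidean_space \<Rightarrow> 'a \<Rightarrow> 'a) \<Rightarrow> 'a \<Rightarrow> ('a \<Rightarrow> 'a) \<Rightarrow> bool" where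
  "real_alt_algebra mul e cj \<longleftrightarrow>
     bilinear mul \<and>
     (\<forall>a. mul e a = a \<and> mul a e = a) \<and>
     \<comment> \<open>the associator is alternating: it vanishes whenever two arguments coincide\<close>
     (\<forall>a b. assoc3 mul a a b = 0 \<and> assoc3 mul a b a = 0 \<and> assoc3 mul b a a = 0) \<and>
     linear cj \<and>
     (\<forall>c::real. cj (c *\<^sub>R e) = c *\<^sub>R e) \<and>
     (\<forall>a. cj (cj a) = a) \<and>
     (\<forall>a b. cj (mul a b) = mul (cj b) (cj a))"

definition is_realA :: "'a::real_vector \<Rightarrow> 'a \<Rightarrow> bool" where
  "is_realA e a \<longleftrightarrow> (\<exists>c::real. a = c *\<^sub>R e)"

definition trA :: "('a::real_vector \<Rightarrow> 'a) \<Rightarrow> 'a \<Rightarrow> 'a" where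
  "trA cj x = x + cj x"

definition nA :: "('a \<Rightarrow> 'a \<Rightarrow> 'a) \<Rightarrow> ('a \<Rightarrow> 'a) \<Rightarrow> 'a \<Rightarrow> 'a" where
  "nA mul cj x = mul x (cj x)"

definition sphereA :: "('a::real_vector \<Rightarrow> 'a \<Rightarrow> 'a) \<Rightarrow> 'a \<Rightarrow> ('a \<Rightarrow> 'a) \<Rightarrow> 'a set" where
  "sphereA mul e cj = {x. trA cj x = 0 \<and> nA mul cj x = e}"

definition QA :: "('a::real_vector \<Rightarrow> 'a \<Rightarrow> 'a) \<Rightarrow> 'a \<Rightarrow> ('a \<Rightarrow> 'a) \<Rightarrow> 'a set" where
  "QA mul e cj = {a. is_realA e a} \<union>
     {x. \<exists>t n::real. trA cj x = t *\<^sub>R e \<and> nA mul cj x = n *\<^sub>R e \<and> 4 * n > t\<^sup>2}"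

definition adapted_basis ::
  "('a::euclidean_space \<Rightarrow> 'a \<Rightarrow> 'a) \<Rightarrow> 'a \<Rightarrow> ('a \<Rightarrow> 'a) \<Rightarrow> (nat \<Rightarrow> 'a) \<Rightarrow> nat \<Rightarrow> bool" where
  "adapted_basis mul e cj v m \<longleftrightarrow>
     1 \<le> m \<and> v 0 = e \<and>
     inj_on v {0..m} \<and> independent (v ` {0..m}) \<and>
     (\<forall>s\<in>{1..m}. v s \<in> sphereA mul e cj) \<and>
     (\<forall>s\<in>{1..m}. \<forall>t\<in>{1..m}. s \<noteq> t \<longrightarrow> mul (v s) (v t) = - mul (v t) (v s)) \<and>
     span (v ` {0..m}) \<subseteq> QA mul e cj"

definition Msp :: "(nat \<Rightarrow> 'a::real_vector) \<Rightarrow> nat \<Rightarrow> 'a set" where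
  "Msp v m = span (v ` {0..m})"

definition coord :: "(nat \<Rightarrow> 'a::real_vector) \<Rightarrow> nat \<Rightarrow> 'a \<Rightarrow> nat \<Rightarrow> real" where
  "coord v m x s = real_vector.representation (v ` {0..m}) x (v s)"

definition Rp :: "(nat \<Rightarrow> 'a::real_vector) \<Rightarrow> nat \<Rightarrow> 'a set" where
  "Rp v p = span (v ` {0..p})"

definition xp :: "(nat \<Rightarrow> 'a::real_vector) \<Rightarrow> nat \<Rightarrow> nat \<Rightarrow> 'a \<Rightarrow> 'a" where
  "xp v m p x = (\<Sum>s=0..p. coord v m x s *\<^sub>R v s)"

definition xq :: "(nat \<Rightarrow> 'a::real_vector) \<Rightarrow> nat \<Rightarrow> nat \<Rightarrow> 'a \<Rightarrow> 'a" where
  "xq v m p x = (\<Sum>s\<in>{Suc p..m}. coord v m x s *\<^sub>R v s)"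

definition rad :: "(nat \<Rightarrow> 'a::real_vector) \<Rightarrow> nat \<Rightarrow> nat \<Rightarrow> 'a \<Rightarrow> real" where
  "rad v m p x = sqrt (\<Sum>s\<in>{Suc p..m}. (coord v m x s)\<^sup>2)"

definition xdiam :: "(nat \<Rightarrow> 'a::real_vector) \<Rightarrow> nat \<Rightarrow> nat \<Rightarrow> 'a \<Rightarrow> 'a" where
  "xdiam v m p x = xp v m p x - xq v m p x"

definition sphS :: "(nat \<Rightarrow> 'a::real_vector) \<Rightarrow> nat \<Rightarrow> nat \<Rightarrow> 'a set" where
  "sphS v m p = {(\<Sum>s\<in>{Suc p..m}. c s *\<^sub>R v s) | c. (\<Sum>s\<in>{Suc p..m}. (c s)\<^sup>2) = 1}"

definition slice_set :: "'a set \<Rightarrow> (nat \<Rightarrow> 'a::real_vector) \<Rightarrow> nat \<Rightarrow> 'a \<Rightarrow> 'a set" where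
  "slice_set \<Omega> v p \<omega> = \<Omega> \<inter> {y + t *\<^sub>R \<omega> | y t. y \<in> Rp v p}"

definition dderiv :: "('a::real_normed_vector \<Rightarrow> 'b::real_normed_vector) \<Rightarrow> 'a \<Rightarrow> 'a \<Rightarrow> 'b" where
  "dderiv g u y = vector_derivative (\<lambda>t. g (y + t *\<^sub>R u)) (at 0)"

definition pd :: "(nat \<Rightarrow> 'a::real_normed_vector) \<Rightarrow> nat \<Rightarrow> ('a \<Rightarrow> 'b::real_normed_vector) \<Rightarrow> 'a \<Rightarrow> 'b" where
  "pd v s g = dderiv g (v s)"

definition Dxp :: "('a \<Rightarrow> 'a \<Rightarrow> 'a) \<Rightarrow> (nat \<Rightarrow> 'a::real_normed_vector) \<Rightarrow> nat \<Rightarrow> ('a \<Rightarrow> 'a) \<Rightarrow> 'a \<Rightarrow> 'a" where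
  "Dxp mul v p g = (\<lambda>y. \<Sum>s=0..p. mul (v s) (pd v s g y))"

definition Dbar :: "('a \<Rightarrow> 'a \<Rightarrow> 'a) \<Rightarrow> (nat \<Rightarrow> 'a::real_normed_vector) \<Rightarrow> nat \<Rightarrow> ('a \<Rightarrow> 'a) \<Rightarrow> 'a \<Rightarrow> 'a" where
  "Dbar mul v n g = (\<lambda>y. pd v 0 g y - (\<Sum>s=1..n. mul (v s) (pd v s g y)))"

text \<open>Lap v n g = sum over s = 0..n of the second partial derivatives in x_s.
Lap v p is Delta_{x_p}, Lap v m is Delta_x; likewise Dbar mul v p, Dbar mul v m.\<close>
definition Lap :: "(nat \<Rightarrow> 'a::real_normed_vector) \<Rightarrow> nat \<Rightarrow> ('a \<Rightarrow> 'b::real_normed_vector) \<Rightarrow> 'a \<Rightarrow> 'b" where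
  "Lap v n g = (\<lambda>y. \<Sum>s=0..n. pd v s (pd v s g) y)"

definition slice_domain :: "(nat \<Rightarrow> 'a::real_normed_vector) \<Rightarrow> nat \<Rightarrow> nat \<Rightarrow> 'a set \<Rightarrow> bool" where
  "slice_domain v m p \<Omega> \<longleftrightarrow>
     openin (top_of_set (Msp v m)) \<Omega> \<and> connected \<Omega> \<and> \<Omega> \<noteq> {} \<and>
     \<Omega> \<inter> Rp v p \<noteq> {} \<and>
     (\<forall>\<omega>\<in>sphS v m p. connected (slice_set \<Omega> v p \<omega>))"

definition p_symmetric :: "(nat \<Rightarrow> 'a::real_vector) \<Rightarrow> nat \<Rightarrow> nat \<Rightarrow> 'a set \<Rightarrow> bool" where
  "p_symmetric v m p \<Omega> \<longleftrightarrow>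
     (\<forall>y\<in>Rp v p. \<forall>r::real. \<forall>\<omega>\<in>sphS v m p.
        r > 0 \<and> y + r *\<^sub>R \<omega> \<in> \<Omega> \<longrightarrow> (\<forall>\<eta>\<in>sphS v m p. y + r *\<^sub>R \<eta> \<in> \<Omega>))"

text \<open>Left generalized partial-slice monogenic of type (p, m-p): on every slice
Omega_omega (an open subset of the (p+2)-dimensional space R^(p+1) + omega R) the function is
C^1 and satisfies (D_{x_p} + omega d/dr) f (x_p + r omega) = 0.\<close>
definition gpsm :: "('a \<Rightarrow> 'a \<Rightarrow> 'a) \<Rightarrow> (nat \<Rightarrow> 'a::real_normed_vector) \<Rightarrow> nat \<Rightarrow> nat \<Rightarrow> 'a set \<Rightarrow> ('a \<Rightarrow> 'a) \<Rightarrow> bool" where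
  "gpsm mul v m p \<Omega> f \<longleftrightarrow>
     (\<forall>\<omega>\<in>sphS v m p.
        (\<exists>D. (\<forall>y\<in>slice_set \<Omega> v p \<omega>. (f has_derivative D y) (at y within span (insert \<omega> (v ` {0..p})))) \<and>
             (\<forall>u\<in>span (insert \<omega> (v ` {0..p})). continuous_on (slice_set \<Omega> v p \<omega>) (\<lambda>y. D y u))) \<and>
        (\<forall>y\<in>slice_set \<Omega> v p \<omega>. Dxp mul v p f y + mul \<omega> (dderiv f \<omega> y) = 0))"

definition PE :: "(nat \<Rightarrow> 'a::real_vector) \<Rightarrow> nat \<Rightarrow> nat \<Rightarrow> ('a \<Rightarrow> 'a) \<Rightarrow> 'a \<Rightarrow> 'a" where
  "PE v m p h x = (1/2) *\<^sub>R (h x + h (xdiam v m p x))"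

definition PO :: "(nat \<Rightarrow> 'a::real_vector) \<Rightarrow> nat \<Rightarrow> nat \<Rightarrow> ('a \<Rightarrow> 'a) \<Rightarrow> 'a \<Rightarrow> 'a" where
  "PO v m p h x = (1/2) *\<^sub>R (h x - h (xdiam v m p x))"

definition cA :: "nat \<Rightarrow> nat \<Rightarrow> real" where
  "cA q k = Gamma (real q / 2) * (-1)^k / (2^(2*k) * fact k * Gamma (real k + real q / 2))"

definition cB :: "nat \<Rightarrow> nat \<Rightarrow> real" where
  "cB q k = Gamma (real q / 2) * (-1)^k / (2^(2*k+1) * fact k * Gamma (real k + real q / 2 + 1))"

definition cH :: "nat \<Rightarrow> nat \<Rightarrow> real" where
  "cH q k = Gamma (real q / 2 + 1) * (-1)^k / (2^(2*k) * fact k * Gamma (real k + real q / 2 + 1))"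

definition gck_ser1 :: "(nat \<Rightarrow> 'a::real_normed_vector) \<Rightarrow> nat \<Rightarrow> nat \<Rightarrow> ('a \<Rightarrow> 'a) \<Rightarrow> 'a \<Rightarrow> nat \<Rightarrow> 'a" where
  "gck_ser1 v m p g x k = (cA (m - p) k * rad v m p x ^ (2*k)) *\<^sub>R ((Lap v p ^^ k) g) (xp v m p x)"

definition gck_ser2 :: "('a \<Rightarrow> 'a \<Rightarrow> 'a) \<Rightarrow> (nat \<Rightarrow> 'a::real_normed_vector) \<Rightarrow> nat \<Rightarrow> nat \<Rightarrow> ('a \<Rightarrow> 'a) \<Rightarrow> 'a \<Rightarrow> nat \<Rightarrow> 'a" where
  "gck_ser2 mul v m p g x k = (cB (m - p) k * rad v m p x ^ (2*k)) *\<^sub>R ((Lap v p ^^ k) (Dxp mul v p g)) (xp v m p x)"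

definition hgck_ser2 :: "(nat \<Rightarrow> 'a::real_normed_vector) \<Rightarrow> nat \<Rightarrow> nat \<Rightarrow> ('a \<Rightarrow> 'a) \<Rightarrow> 'a \<Rightarrow> nat \<Rightarrow> 'a" where
  "hgck_ser2 v m p A1 x k = (cH (m - p) k * rad v m p x ^ (2*k)) *\<^sub>R ((Lap v p ^^ k) A1) (xp v m p x)"

definition GCK :: "('a \<Rightarrow> 'a \<Rightarrow> 'a) \<Rightarrow> (nat \<Rightarrow> 'a::real_normed_vector) \<Rightarrow> nat \<Rightarrow> nat \<Rightarrow> ('a \<Rightarrow> 'a) \<Rightarrow> 'a \<Rightarrow> 'a" where
  "GCK mul v m p g x = suminf (gck_ser1 v m p g x) + mul (xq v m p x) (suminf (gck_ser2 mul v m p g x))"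

definition GCK_defined :: "('a \<Rightarrow> 'a \<Rightarrow> 'a) \<Rightarrow> (nat \<Rightarrow> 'a::real_normed_vector) \<Rightarrow> nat \<Rightarrow> nat \<Rightarrow> ('a \<Rightarrow> 'a) \<Rightarrow> 'a \<Rightarrow> bool" where
  "GCK_defined mul v m p g x \<longleftrightarrow> summable (gck_ser1 v m p g x) \<and> summable (gck_ser2 mul v m p g x)"

definition HGCK :: "('a \<Rightarrow> 'a \<Rightarrow> 'a) \<Rightarrow> (nat \<Rightarrow> 'a::real_normed_vector) \<Rightarrow> nat \<Rightarrow> nat \<Rightarrow> ('a \<Rightarrow> 'a) \<Rightarrow> ('a \<Rightarrow> 'a) \<Rightarrow> 'a \<Rightarrow> 'a" where
  "HGCK mul v m p A0 A1 x = suminf (gck_ser1 v m p A0 x) + mul (xq v m p x) (suminf (hgck_ser2 v m p A1 x))"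

definition HGCK_defined :: "(nat \<Rightarrow> 'a::real_normed_vector) \<Rightarrow> nat \<Rightarrow> nat \<Rightarrow> ('a \<Rightarrow> 'a) \<Rightarrow> ('a \<Rightarrow> 'a) \<Rightarrow> 'a \<Rightarrow> bool" where
  "HGCK_defined v m p A0 A1 x \<longleftrightarrow> summable (gck_ser1 v m p A0 x) \<and> summable (hgck_ser2 v m p A1 x)"

text \<open>Double factorial on the integers, with 0!! = (-1)!! = 1.\<close>
definition dfact :: "int \<Rightarrow> real" where
  "dfact n = (\<Prod>j\<in>{j\<in>{1..n}. even (n - j)}. real_of_int j)"

definition gamma_q :: "nat \<Rightarrow> real" where
  "gamma_q q = (-1) ^ ((q - 1) div 2) * dfact (int q - 1) / dfact (int q - 2)"

end

theory Submission
  imports Defs "HOL-Complex_Analysis.Complex_Analysis"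
begin

text \<open>On a tube around the segment from \<open>x\<close> to its reflection, the identity theorem gives
\<open>f(x\<^sub>p + r \<eta>) = \<alpha>(x\<^sub>p, r) + \<eta> \<beta>(x\<^sub>p, r)\<close> with \<open>\<alpha>\<close> even and \<open>\<beta>\<close> odd in \<open>r\<close>, both harmonic in the
\<open>p + 2\<close> variables. With \<open>E = (1/r) \<partial>\<^sub>r\<close>, \<open>a\<^sub>k = E\<^sup>k \<alpha>\<close> and \<open>b\<^sub>k = E\<^sup>k (\<beta>/r)\<close>, harmonicity turns into
\<open>\<Delta>\<^sub>x (a\<^sub>k + x\<^sub>q b\<^sub>k) = (q - 1 - 2k) (a\<^sub>k\<^sub>+\<^sub>1 + x\<^sub>q b\<^sub>k\<^sub>+\<^sub>1)\<close>, so that the even and odd parts of the iterated Laplacian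
are multiples of \<open>a\<^sub>l\<close> and \<open>x\<^sub>q b\<^sub>l\<close> with \<open>2l + 1 = q\<close>. As functions of \<open>r\<^sup>2\<close> these are real analytic, and
the same relations at \<open>r = 0\<close> determine their Taylor coefficients, which are those of the GCK and HGCK
series. The series are assumed to converge at \<open>x\<close> only, hence the final appeal to Abel's limit theorem.
Regularity of the merely \<open>C\<^sup>1\<close> function \<open>f\<close> comes from a mean value property with a compactly supported
radial kernel, which yields derivatives of all orders and Cauchy estimates.\<close>

subsection \<open>Mean value property\<close>

text \<open>Products need not associate, so the algebra acts only through the linear maps
  \<open>mul a\<close>. Polarizing the left alternative law turns the anticommutation of the
  \<open>v s\<close> into Clifford relations between these maps, and these relations are what the
  analysis uses. The slices are pulled back to open cylinders in \<open>'a \<times> real\<close>: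
  the p + 1 coordinates of x_p are read along selected vectors of \<open>Basis\<close>, because
  \<open>v\<close> need not be orthonormal and the dimension p + 1 is not a type. The pullbacks are
  constant in the remaining directions. Let q = 2l + 1. The constant gamma_q has three sources. The
  factors q - 1 - 2j with j < l multiply to (q - 1)!!. At r = 0 the l nested averages contribute 1 /
  (q - 2)!!. Trading l pairs of radial derivatives for Laplacians in x_p gives (-1)^l. The series
  are centred at x_p and see f only near that point, so the segment from x_p to x has to lie in
  \<Omega> for the values at x to be determined by them.\<close>

lemma integral_shift_support:
  fixes K :: "'c::euclidean_space \<Rightarrow> 'b::euclidean_space"
  assumes "\<And>y. y \<in> cbox a b \<Longrightarrow> y \<notin> S \<Longrightarrow> K y = 0"
    and "\<And>y. y \<in> cbox (a + h) (b + h) \<Longrightarrow> y \<notin> S \<Longrightarrow> K y = 0"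
    and "S \<subseteq> cbox a b" and "S \<subseteq> cbox (a + h) (b + h)"
  shows "integral (cbox a b) (\<lambda>y. K (y + h)) = integral (cbox a b) K"
proof -
  have *: "integral T K = integral UNIV (\<lambda>y. if y \<in> S then K y else 0)"
    if "S \<subseteq> T" "\<And>y. y \<in> T \<Longrightarrow> y \<notin> S \<Longrightarrow> K y = 0" for T
  proof -
    have "(\<lambda>y. if y \<in> S then K y else 0) = (\<lambda>y. if y \<in> T then K y else 0)"
      using that by fastforce
    then show ?thesis by (simp add: Henstock_Kurzweil_Integration.integral_restrict_UNIV)
  qed
  have "integral (cbox a b) (\<lambda>y. K (y + h)) = integral (cbox (a + h) (b + h)) K"
    using integral_shift_cbox[of "a + h" h "b + h" K] by simp
  then show ?thesis
    using *[of "cbox a b"] *[of "cbox (a + h) (b + h)"] assms by simp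
qed

section \<open>The compactly supported radial kernel\<close>

definition unit_cube :: "'c::euclidean_space set" where
  "unit_cube = cbox (- One) One"

text \<open>Squaring makes the truncation continuously differentiable. The support is the ball of
  radius 1/2, which leaves room in \<open>unit_cube\<close> for translations of norm up to 1/2. The
  symmetry is carried by the kernel, so the domain of integration can be a box.\<close>

definition bump :: "'c::euclidean_space \<Rightarrow> real" where
  "bump y = (max 0 (1/4 - y \<bullet> y))\<^sup>2"

text \<open>This is minus the derivative of \<open>bump\<close> in direction u. It is a radial
  factor times y \<bullet> u, hence (y \<bullet> i) * \<open>dbump j y\<close> is symmetric in i and
  j.\<close>

definition dbump :: "'c::euclidean_space \<Rightarrow> 'c \<Rightarrow> real" where
  "dbump u y = 4 * max 0 (1/4 - y \<bullet> y) * (y \<bullet> u)"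

definition bump_mass :: "'c::euclidean_space itself \<Rightarrow> real" where
  "bump_mass _ = integral unit_cube (bump :: 'c \<Rightarrow> real)"

lemma mem_unit_cube: "y \<in> unit_cube \<longleftrightarrow> (\<forall>b\<in>Basis. \<bar>y \<bullet> b\<bar> \<le> 1)"
  by (auto simp: unit_cube_def mem_box abs_le_iff)

lemma compact_unit_cube: "compact (unit_cube :: 'c::euclidean_space set)"
  by (simp add: unit_cube_def)

lemma norm_unit_cube_le: "y \<in> unit_cube \<Longrightarrow> norm (y::'c::euclidean_space) \<le> DIM('c)"
proof -
  assume "y \<in> unit_cube"
  then have "(\<Sum>b\<in>Basis. \<bar>y \<bullet> b\<bar>) \<le> (\<Sum>b\<in>(Basis::'c set). 1)"
    by (intro sum_mono) (auto simp: mem_unit_cube)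
  then show ?thesis using norm_le_l1[of y] by simp
qed

lemma bump_eq_0: "1/2 \<le> norm y \<Longrightarrow> bump y = 0"
proof -
  assume "1/2 \<le> norm y"
  then have "(1/2)\<^sup>2 \<le> (norm y)\<^sup>2" by (intro power_mono) auto
  then show ?thesis by (simp add: bump_def dot_square_norm power2_eq_square)
qed

lemma dbump_eq_0: "1/2 \<le> norm y \<Longrightarrow> dbump u y = 0"
proof -
  assume "1/2 \<le> norm y"
  then have "(1/2)\<^sup>2 \<le> (norm y)\<^sup>2" by (intro power_mono) auto
  then show ?thesis by (simp add: dbump_def dot_square_norm power2_eq_square)
qed

lemma norm_dbump_le: "\<bar>dbump u y\<bar> \<le> norm u"
proof (cases "1/2 \<le> norm y")
  case False
  have 1: "\<bar>max 0 (1/4 - y \<bullet> y)\<bar> \<le> 1/4" by (simp add: max_def)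
  have "\<bar>dbump u y\<bar> = 4 * \<bar>max 0 (1/4 - y \<bullet> y)\<bar> * \<bar>y \<bullet> u\<bar>"
    by (simp add: dbump_def abs_mult)
  also have "\<dots> \<le> 4 * (1/4) * (norm y * norm u)"
    by (intro mult_mono 1 Cauchy_Schwarz_ineq2) auto
  also have "\<dots> \<le> 1 * norm u"
    using False mult_right_mono[of "norm y" 1 "norm u"] by auto
  finally show ?thesis by simp
qed (simp add: dbump_eq_0)

lemma DERIV_max0_sq: "((\<lambda>s. (max 0 s)\<^sup>2) has_real_derivative 2 * max 0 s) (at (s::real))"
proof -
  consider "s > 0" | "s < 0" | "s = 0" by linarith
  then show ?thesis
  proof cases
    case 1
    have "((\<lambda>s. s\<^sup>2) has_real_derivative 2 * s) (at s)"
      by (auto intro!: derivative_eq_intros)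
    then show ?thesis
      by (rule has_field_derivative_transform_within_open[of _ _ _ "{0<..}", THEN DERIV_cong])
         (use 1 in auto)
  next
    case 2
    have "((\<lambda>s. 0) has_real_derivative 0) (at s)"
      by (auto intro!: derivative_eq_intros)
    then show ?thesis
      by (rule has_field_derivative_transform_within_open[of _ _ _ "{..<0}", THEN DERIV_cong])
         (use 2 in auto)
  next
    case 3
    have "((\<lambda>h. (max 0 (0 + h))\<^sup>2 / h) \<longlongrightarrow> 0) (at (0::real))"
    proof (rule tendsto_norm_zero_cancel, rule tendsto_sandwich[of "\<lambda>_. 0" _ _ norm])
      show "\<forall>\<^sub>F h in at (0::real). norm ((max 0 (0 + h))\<^sup>2 / h) \<le> norm h"
        by (auto intro!: always_eventually simp: max_def power2_eq_square)
    qed (auto intro!: tendsto_eq_intros)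
    then show ?thesis using 3 by (simp add: DERIV_def)
  qed
qed

lemma bump_has_derivative: "(bump has_derivative (\<lambda>k. - dbump k y)) (at y)"
proof -
  have "((\<lambda>y::'a. 1/4 - y \<bullet> y) has_derivative (\<lambda>k. - (2 * (y \<bullet> k)))) (at y)"
    by (auto intro!: derivative_eq_intros simp: inner_commute)
  from has_derivative_compose[OF this DERIV_max0_sq[unfolded has_field_derivative_def]]
  show ?thesis by (simp add: bump_def[abs_def] dbump_def mult_ac)
qed

lemma continuous_on_bump [continuous_intros]:
  "continuous_on S g \<Longrightarrow> continuous_on S (\<lambda>x. bump (g x))"
  unfolding bump_def by (intro continuous_intros)

lemma continuous_on_dbump [continuous_intros]:
  "continuous_on S g \<Longrightarrow> continuous_on S (\<lambda>x. dbump u (g x))"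
  unfolding dbump_def by (intro continuous_intros)

lemma bump_mass_pos: "bump_mass TYPE('c::euclidean_space) > 0"
proof -
  have "integral unit_cube (bump :: 'c \<Rightarrow> real) \<ge> 0"
    by (rule Henstock_Kurzweil_Integration.integral_nonneg)
       (auto simp: unit_cube_def bump_def intro!: integrable_continuous continuous_intros)
  moreover have "integral unit_cube (bump :: 'c \<Rightarrow> real) \<noteq> 0"
  proof
    assume "integral unit_cube (bump :: 'c \<Rightarrow> real) = 0"
    moreover have "box (- One) (One :: 'c) \<noteq> {}" by (auto simp: box_ne_empty)
    moreover have "continuous_on (cbox (- One) (One :: 'c)) bump"
      by (intro continuous_intros)
    ultimately have "\<forall>y\<in>cbox (- One) (One :: 'c). bump y = 0"
      unfolding unit_cube_def by (subst (asm) integral_cbox_eq_0_iff) (auto simp: bump_def)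
    moreover have "0 \<in> cbox (- One) (One :: 'c)" by (simp add: mem_box)
    ultimately show False by (auto simp: bump_def)
  qed
  ultimately show ?thesis unfolding bump_mass_def by linarith
qed

lemma dderiv_eqI: "((\<lambda>t. G (x + t *\<^sub>R u)) has_vector_derivative D) (at 0) \<Longrightarrow> dderiv G u x = D"
  unfolding dderiv_def by (rule vector_derivative_at)

lemma has_derivative_imp_line:
  assumes "(G has_derivative G') (at x)"
  shows "((\<lambda>t. G (x + t *\<^sub>R u)) has_vector_derivative G' u) (at 0)"
proof -
  interpret bounded_linear G' using assms by (rule has_derivative_bounded_linear)
  have "((\<lambda>t. x + t *\<^sub>R u) has_derivative (\<lambda>t. t *\<^sub>R u)) (at 0)"
    by (auto intro!: derivative_eq_intros)
  from has_derivative_compose[OF this, of G G'] assms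
  show ?thesis by (simp add: has_vector_derivative_def scaleR)
qed

lemma dderiv_eq: "(G has_derivative G') (at x) \<Longrightarrow> dderiv G u x = G' u"
  by (intro dderiv_eqI has_derivative_imp_line)

lemma dderiv_line:
  assumes "G differentiable (at (x + t *\<^sub>R u))"
  shows "((\<lambda>t. G (x + t *\<^sub>R u)) has_vector_derivative dderiv G u (x + t *\<^sub>R u)) (at t within S)"
proof -
  obtain G' where G': "(G has_derivative G') (at (x + t *\<^sub>R u))"
    using assms by (auto simp: differentiable_def)
  interpret bounded_linear G' using G' by (rule has_derivative_bounded_linear)
  have "((\<lambda>t. x + t *\<^sub>R u) has_derivative (\<lambda>t. t *\<^sub>R u)) (at t within S)"
    by (auto intro!: derivative_eq_intros)
  from has_derivative_compose[OF this, of G G'] G' dderiv_eq[OF G']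
  show ?thesis by (simp add: has_vector_derivative_def scaleR)
qed

text \<open>All that is needed of harmonicity: it is inherited by derivatives and it yields regularity.\<close>

definition mvp :: "'c::euclidean_space set \<Rightarrow> ('c \<Rightarrow> 'b::euclidean_space) \<Rightarrow> bool" where
  "mvp U G \<longleftrightarrow> continuous_on U G \<and>
     (\<forall>x \<epsilon>. 0 < \<epsilon> \<and> (\<forall>y\<in>unit_cube. x + \<epsilon> *\<^sub>R y \<in> U) \<longrightarrow>
        integral unit_cube (\<lambda>y. bump y *\<^sub>R G (x + \<epsilon> *\<^sub>R y)) = bump_mass TYPE('c) *\<^sub>R G x)"

lemma cube_in_open:
  fixes U :: "'c::euclidean_space set"
  assumes "open U" "x \<in> U"
  obtains \<epsilon> where "\<epsilon> > 0" "\<And>y. y \<in> unit_cube \<Longrightarrow> x + \<epsilon> *\<^sub>R y \<in> U"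
proof -
  obtain d where d: "d > 0" "ball x d \<subseteq> U" using assms open_contains_ball by blast
  show thesis
  proof (rule that[of "d / (2 * DIM('c))"])
    fix y :: 'c assume "y \<in> unit_cube"
    then have "norm ((d / (2 * DIM('c))) *\<^sub>R y) \<le> d / (2 * DIM('c)) * DIM('c)"
      using d norm_unit_cube_le[of y] mult_left_mono[of "norm y" "DIM('c)" "d / (2 * DIM('c))"]
      by simp
    also have "\<dots> < d" using d by simp
    finally show "x + (d / (2 * DIM('c))) *\<^sub>R y \<in> U"
      using d by (auto simp: dist_norm)
  qed (use d in auto)
qed

lemma cube_open_nbhd:
  fixes U :: "'c::euclidean_space set"
  assumes "open U" "\<And>y. y \<in> unit_cube \<Longrightarrow> x + \<epsilon> *\<^sub>R y \<in> U"
  obtains d where "d > 0" "\<And>z y. norm z < d \<Longrightarrow> y \<in> unit_cube \<Longrightarrow> x + z + \<epsilon> *\<^sub>R y \<in> U"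
proof -
  have "compact ((\<lambda>y. x + \<epsilon> *\<^sub>R y) ` unit_cube)"
    by (intro compact_continuous_image compact_unit_cube continuous_intros)
  then obtain d where d: "d > 0" "(\<Union>w\<in>(\<lambda>y. x + \<epsilon> *\<^sub>R y) ` unit_cube. ball w d) \<subseteq> U"
    using compact_subset_open_imp_ball_epsilon_subset[of _ U] assms by blast
  show thesis
  proof (rule that[of d])
    fix z y :: 'c assume "norm z < d" "y \<in> unit_cube"
    then have "x + z + \<epsilon> *\<^sub>R y \<in> ball (x + \<epsilon> *\<^sub>R y) d"
      by (simp add: dist_norm)
    then show "x + z + \<epsilon> *\<^sub>R y \<in> U" using d(2) \<open>y \<in> unit_cube\<close> by blast
  qed (rule d)
qed

section \<open>Regularity from the mean value property\<close>

lemma leibniz_dderiv: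
  fixes G :: "'c::euclidean_space \<Rightarrow> 'b::euclidean_space"
  assumes U: "open U" and dG: "\<And>x. x \<in> U \<Longrightarrow> G differentiable (at x)"
    and cont: "continuous_on U (dderiv G u)" and \<kappa>: "continuous_on unit_cube \<kappa>"
    and sub: "\<And>y. y \<in> unit_cube \<Longrightarrow> x + \<epsilon> *\<^sub>R y \<in> U"
  shows "((\<lambda>t. integral unit_cube (\<lambda>y. \<kappa> y *\<^sub>R G (x + t *\<^sub>R u + \<epsilon> *\<^sub>R y))) has_vector_derivative
     integral unit_cube (\<lambda>y. \<kappa> y *\<^sub>R dderiv G u (x + \<epsilon> *\<^sub>R y))) (at 0)"
proof -
  obtain d where d: "d > 0" "\<And>z y. norm z < d \<Longrightarrow> y \<in> unit_cube \<Longrightarrow> x + z + \<epsilon> *\<^sub>R y \<in> U"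
    using cube_open_nbhd[OF U sub] by metis
  \<comment> \<open>Adding 1 keeps the divisor positive when u = 0.\<close>
  define d' where "d' = d / (norm u + 1)"
  have "d' > 0" using d by (simp add: d'_def add_nonneg_pos)
  have in_U: "x + t *\<^sub>R u + \<epsilon> *\<^sub>R y \<in> U" if "t \<in> ball 0 d'" "y \<in> unit_cube" for t y
  proof (rule d(2))
    have "\<bar>t\<bar> * (norm u + 1) < d"
      using that by (simp add: d'_def dist_norm pos_less_divide_eq add_nonneg_pos)
    then show "norm (t *\<^sub>R u) < d" by (simp add: distrib_left)
  qed (use that in auto)
  have contG: "continuous_on U G"
    using dG by (meson differentiable_imp_continuous_on differentiable_at_imp_differentiable_on)
  have "((\<lambda>t. integral unit_cube (\<lambda>y. \<kappa> y *\<^sub>R G (x + t *\<^sub>R u + \<epsilon> *\<^sub>R y))) has_vector_derivative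
     integral unit_cube (\<lambda>y. \<kappa> y *\<^sub>R dderiv G u (x + 0 *\<^sub>R u + \<epsilon> *\<^sub>R y))) (at 0 within ball 0 d')"
    unfolding unit_cube_def
  proof (rule leibniz_rule_vector_derivative, fold unit_cube_def)
    fix t :: real and y :: 'c assume ty: "t \<in> ball 0 d'" "y \<in> unit_cube"
    have "((\<lambda>t. G ((x + \<epsilon> *\<^sub>R y) + t *\<^sub>R u)) has_vector_derivative
        dderiv G u ((x + \<epsilon> *\<^sub>R y) + t *\<^sub>R u)) (at t within ball 0 d')"
      using in_U[OF ty] by (intro dderiv_line dG) (simp add: algebra_simps)
    then have "((\<lambda>t. G (x + t *\<^sub>R u + \<epsilon> *\<^sub>R y)) has_vector_derivative
        dderiv G u (x + t *\<^sub>R u + \<epsilon> *\<^sub>R y)) (at t within ball 0 d')"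
      by (simp add: algebra_simps)
    then show "((\<lambda>t. \<kappa> y *\<^sub>R G (x + t *\<^sub>R u + \<epsilon> *\<^sub>R y)) has_vector_derivative
        \<kappa> y *\<^sub>R dderiv G u (x + t *\<^sub>R u + \<epsilon> *\<^sub>R y)) (at t within ball 0 d')"
      by (rule has_vector_derivative_scaleR[OF DERIV_const, simplified])
  next
    fix t :: real assume "t \<in> ball 0 d'"
    then show "(\<lambda>y. \<kappa> y *\<^sub>R G (x + t *\<^sub>R u + \<epsilon> *\<^sub>R y)) integrable_on unit_cube"
      unfolding unit_cube_def using in_U \<kappa>
      by (intro integrable_continuous continuous_intros continuous_on_compose2[OF contG])
         (auto simp: unit_cube_def)
  next
    have "continuous_on (ball 0 d' \<times> unit_cube) (\<lambda>z. \<kappa> (snd z) *\<^sub>R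
       dderiv G u (x + fst z *\<^sub>R u + \<epsilon> *\<^sub>R snd z))"
      using in_U
      by (intro continuous_intros continuous_on_compose2[OF cont] continuous_on_compose2[OF \<kappa>]) auto
    then show "continuous_on (ball 0 d' \<times> unit_cube) (\<lambda>(t, y). \<kappa> y *\<^sub>R
       dderiv G u (x + t *\<^sub>R u + \<epsilon> *\<^sub>R y))"
      by (simp add: case_prod_beta')
  qed (use \<open>d' > 0\<close> in auto)
  then show ?thesis using \<open>d' > 0\<close> by (simp add: at_within_open[of 0 "ball 0 d'"])
qed

text \<open>The mean value formula at the points x + \<epsilon> h presents G as a convolution.
  Moving the translation from G to the kernel makes the integral differentiable in h although G is
  only continuous; the derivative falls on \<open>bump\<close> and produces \<open>dbump\<close>,
  and the substitution h = (w - x) / \<epsilon> contributes the factor 1 / \<epsilon>.\<close>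

lemma mvp_has_derivative:
  fixes G :: "'c::euclidean_space \<Rightarrow> 'b::euclidean_space"
  assumes U: "open U" and G: "mvp U G" and \<epsilon>: "\<epsilon> > 0"
    and sub: "\<And>y. y \<in> unit_cube \<Longrightarrow> x + \<epsilon> *\<^sub>R y \<in> U"
  shows "(G has_derivative (\<lambda>k. (1 / (\<epsilon> * bump_mass TYPE('c))) *\<^sub>R
           integral unit_cube (\<lambda>y. dbump k y *\<^sub>R G (x + \<epsilon> *\<^sub>R y)))) (at x)"
proof -
  let ?c = "bump_mass TYPE('c)"
  define F where "F h = integral unit_cube (\<lambda>y. bump (y - h) *\<^sub>R G (x + \<epsilon> *\<^sub>R y))" for h
  have c: "?c > 0" by (rule bump_mass_pos)
  have contG: "continuous_on U G" using G by (simp add: mvp_def)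
  obtain d where d: "d > 0" "\<And>z y. norm z < d \<Longrightarrow> y \<in> unit_cube \<Longrightarrow> x + z + \<epsilon> *\<^sub>R y \<in> U"
    using cube_open_nbhd[OF U sub] by metis
  \<comment> \<open>The bound 1/2 keeps the translated support inside the cube, the bound d /
    \<epsilon> keeps the translated cube inside U.\<close>
  define \<delta> where "\<delta> = min (1/2) (d / \<epsilon>)"
  have \<delta>: "\<delta> > 0" using d \<epsilon> by (simp add: \<delta>_def)
  have F_eq: "?c *\<^sub>R G (x + \<epsilon> *\<^sub>R h) = F h" if "norm h < \<delta>" for h
  proof -
    have h: "norm h < 1/2" "norm (\<epsilon> *\<^sub>R h) < d"
      using that \<epsilon> by (auto simp: \<delta>_def pos_less_divide_eq mult.commute)
    have "?c *\<^sub>R G (x + \<epsilon> *\<^sub>R h) = integral unit_cube (\<lambda>y. bump y *\<^sub>R G (x + \<epsilon> *\<^sub>R h + \<epsilon> *\<^sub>R y))"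
      using G d(2)[OF h(2)] \<epsilon> by (simp add: mvp_def)
    also have "\<dots> = integral unit_cube (\<lambda>y. (\<lambda>w. bump (w - h) *\<^sub>R G (x + \<epsilon> *\<^sub>R w)) (y + h))"
      by (simp add: algebra_simps)
    also have "\<dots> = F h"
      unfolding F_def unit_cube_def
    proof (rule integral_shift_support[where S = "cball h (1/2)"])
      show "cball h (1/2) \<subseteq> cbox (- One) One"
      proof
        fix y assume "y \<in> cball h (1/2)"
        then have "norm y \<le> 1"
          using h norm_triangle_ineq[of h "y - h"] by (simp add: dist_norm norm_minus_commute)
        then show "y \<in> cbox (- One) One"
          using Basis_le_norm[of _ y] by (fold unit_cube_def) (force simp: mem_unit_cube)
      qed
      show "cball h (1/2) \<subseteq> cbox (- One + h) (One + h)"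
      proof
        fix y assume "y \<in> cball h (1/2)"
        then have "norm (y - h) \<le> 1"
          by (simp add: dist_norm norm_minus_commute)
        then have "y - h \<in> unit_cube"
          using Basis_le_norm[of _ "y - h"] by (force simp: mem_unit_cube)
        then show "y \<in> cbox (- One + h) (One + h)"
          by (auto simp: mem_unit_cube mem_box inner_simps abs_le_iff algebra_simps)
      qed
    qed (auto simp: dist_norm norm_minus_commute intro!: bump_eq_0)
    finally show ?thesis .
  qed
  \<comment> \<open>The derivative in h as a bounded linear map, the form in which
    \<open>leibniz_rule\<close> takes a vector parameter.\<close>
  define fx where "fx h y = blinfun_scaleR_left (G (x + \<epsilon> *\<^sub>R y)) o\<^sub>L
    blinfun_inner_left ((4 * max 0 (1/4 - (y - h) \<bullet> (y - h))) *\<^sub>R (y - h))" for h y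
  have fx: "blinfun_apply (fx h y) k = dbump k (y - h) *\<^sub>R G (x + \<epsilon> *\<^sub>R y)" for h y k
    by (simp add: fx_def dbump_def inner_commute mult_ac)
  have cont_fx: "continuous_on (S \<times> unit_cube) (\<lambda>(h, y). fx h y)" for S
    unfolding fx_def case_prod_beta' using sub
    by (intro continuous_intros bounded_bilinear.continuous_on[OF bounded_bilinear_blinfun_compose]
          continuous_on_compose2[OF contG]
          bounded_linear.continuous_on[OF bounded_linear_blinfun_scaleR_left]
          bounded_linear.continuous_on[OF bounded_linear_blinfun_inner_left]) auto
  have "(F has_derivative integral unit_cube (fx 0)) (at 0 within ball 0 \<delta>)"
    unfolding F_def[abs_def] unit_cube_def
  proof (rule leibniz_rule, fold unit_cube_def)
    fix h y :: 'c assume "h \<in> ball 0 \<delta>" "y \<in> unit_cube"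
    have "((\<lambda>h. bump (y - h)) has_derivative (\<lambda>k. - dbump (- k) (y - h))) (at h)"
      by (rule has_derivative_compose[OF _ bump_has_derivative]) (auto intro!: derivative_eq_intros)
    then have "((\<lambda>h. bump (y - h) *\<^sub>R G (x + \<epsilon> *\<^sub>R y)) has_derivative
       (\<lambda>k. (- dbump (- k) (y - h)) *\<^sub>R G (x + \<epsilon> *\<^sub>R y))) (at h within ball 0 \<delta>)"
      by (rule has_derivative_scaleR_left[OF has_derivative_at_withinI])
    moreover have "(\<lambda>k. (- dbump (- k) (y - h)) *\<^sub>R G (x + \<epsilon> *\<^sub>R y)) = blinfun_apply (fx h y)"
      by (rule ext) (simp add: fx dbump_def)
    ultimately show "((\<lambda>h. bump (y - h) *\<^sub>R G (x + \<epsilon> *\<^sub>R y)) has_derivative blinfun_apply (fx h y))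
        (at h within ball 0 \<delta>)"
      by (simp only:)
  next
    fix h show "(\<lambda>y. bump (y - h) *\<^sub>R G (x + \<epsilon> *\<^sub>R y)) integrable_on unit_cube"
      unfolding unit_cube_def using sub
      by (intro integrable_continuous continuous_intros continuous_on_compose2[OF contG])
         (auto simp: unit_cube_def)
  qed (use \<delta> cont_fx in auto)
  then have "(F has_derivative integral unit_cube (fx 0)) (at 0)"
    using \<delta> by (simp add: at_within_open[of 0 "ball 0 \<delta>"])
  moreover have "blinfun_apply (integral unit_cube (fx 0)) =
      (\<lambda>k. integral unit_cube (\<lambda>y. dbump k y *\<^sub>R G (x + \<epsilon> *\<^sub>R y)))"
  proof
    fix k
    have "continuous_on unit_cube (\<lambda>y. case (0, y) of (h, y) \<Rightarrow> fx h y)"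
      by (rule continuous_on_compose2[OF cont_fx[of "{0}"]]) (auto intro!: continuous_intros)
    then have "fx 0 integrable_on unit_cube"
      unfolding unit_cube_def by (intro integrable_continuous) simp
    then show "blinfun_apply (integral unit_cube (fx 0)) k =
        integral unit_cube (\<lambda>y. dbump k y *\<^sub>R G (x + \<epsilon> *\<^sub>R y))"
      by (simp add: blinfun_apply_integral fx)
  qed
  ultimately have F': "(F has_derivative (\<lambda>k. integral unit_cube (\<lambda>y. dbump k y *\<^sub>R G (x + \<epsilon> *\<^sub>R y)))) (at 0)"
    by simp
  interpret F': bounded_linear "\<lambda>k. integral unit_cube (\<lambda>y. dbump k y *\<^sub>R G (x + \<epsilon> *\<^sub>R y))"
    using F' by (rule has_derivative_bounded_linear)
  have "((\<lambda>w. (1 / \<epsilon>) *\<^sub>R (w - x)) has_derivative (\<lambda>k. (1 / \<epsilon>) *\<^sub>R k)) (at x)"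
    by (auto intro!: derivative_eq_intros)
  from has_derivative_compose[OF this, of F, unfolded diff_self scaleR_zero_right, OF F']
  have "((\<lambda>w. F ((1 / \<epsilon>) *\<^sub>R (w - x))) has_derivative
     (\<lambda>k. (1 / \<epsilon>) *\<^sub>R integral unit_cube (\<lambda>y. dbump k y *\<^sub>R G (x + \<epsilon> *\<^sub>R y)))) (at x)"
    by (simp only: F'.scaleR)
  then have "((\<lambda>w. (1 / ?c) *\<^sub>R F ((1 / \<epsilon>) *\<^sub>R (w - x))) has_derivative
     (\<lambda>k. (1 / ?c) *\<^sub>R ((1 / \<epsilon>) *\<^sub>R integral unit_cube (\<lambda>y. dbump k y *\<^sub>R G (x + \<epsilon> *\<^sub>R y))))) (at x)"
    by (rule has_derivative_scaleR_right)
  then have *: "((\<lambda>w. (1 / ?c) *\<^sub>R F ((1 / \<epsilon>) *\<^sub>R (w - x))) has_derivative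
     (\<lambda>k. (1 / (\<epsilon> * ?c)) *\<^sub>R integral unit_cube (\<lambda>y. dbump k y *\<^sub>R G (x + \<epsilon> *\<^sub>R y)))) (at x)"
    by (simp add: mult.commute)
  show ?thesis
  proof (rule has_derivative_transform_within_open[OF *, of "ball x (\<delta> * \<epsilon>)"])
    fix w assume "w \<in> ball x (\<delta> * \<epsilon>)"
    then have "norm ((1 / \<epsilon>) *\<^sub>R (w - x)) < \<delta>"
      using \<epsilon> by (simp add: dist_norm norm_minus_commute pos_divide_less_eq)
    from F_eq[OF this] have "F ((1 / \<epsilon>) *\<^sub>R (w - x)) = ?c *\<^sub>R G w"
      using \<epsilon> by simp
    then show "(1 / ?c) *\<^sub>R F ((1 / \<epsilon>) *\<^sub>R (w - x)) = G w"
      using c by simp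
  qed (use \<delta> \<epsilon> in auto)
qed

lemma mvp_imp_continuous_on: "mvp U G \<Longrightarrow> continuous_on U G"
  by (simp add: mvp_def)

lemma mvp_differentiable:
  assumes "open U" "mvp U G" "x \<in> U"
  shows "G differentiable (at x)"
proof -
  obtain \<epsilon> where \<epsilon>: "\<epsilon> > 0" "\<And>y. y \<in> unit_cube \<Longrightarrow> x + \<epsilon> *\<^sub>R y \<in> U"
    using cube_in_open[OF assms(1,3)] by blast
  from mvp_has_derivative[OF assms(1,2) this] show ?thesis by (rule differentiableI)
qed

text \<open>A derivative is an average of values of G. Continuity of derivatives, their bounds and
  their symmetry are all read off from this formula.\<close>

lemma mvp_dderiv:
  fixes G :: "'c::euclidean_space \<Rightarrow> 'b::euclidean_space"
  assumes "open U" "mvp U G" "\<epsilon> > 0" "\<And>y. y \<in> unit_cube \<Longrightarrow> x + \<epsilon> *\<^sub>R y \<in> U"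
  shows "integral unit_cube (\<lambda>y. dbump u y *\<^sub>R G (x + \<epsilon> *\<^sub>R y)) =
           (\<epsilon> * bump_mass TYPE('c)) *\<^sub>R dderiv G u x"
proof -
  have "dderiv G u x = (1 / (\<epsilon> * bump_mass TYPE('c))) *\<^sub>R
      integral unit_cube (\<lambda>y. dbump u y *\<^sub>R G (x + \<epsilon> *\<^sub>R y))"
    by (rule dderiv_eq[OF mvp_has_derivative[OF assms]])
  then show ?thesis using assms(3) bump_mass_pos[where ?'c='c] by simp
qed

lemma continuous_on_dderiv_mvp:
  fixes G :: "'c::euclidean_space \<Rightarrow> 'b::euclidean_space"
  assumes U: "open U" and G: "mvp U G"
  shows "continuous_on U (dderiv G u)"
proof -
  have "continuous (at x) (dderiv G u)" if x: "x \<in> U" for x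
  proof -
    obtain \<epsilon> where \<epsilon>: "\<epsilon> > 0" "\<And>y. y \<in> unit_cube \<Longrightarrow> x + \<epsilon> *\<^sub>R y \<in> U"
      using cube_in_open[OF U x] by metis
    obtain d where d: "d > 0" "\<And>z y. norm z < d \<Longrightarrow> y \<in> unit_cube \<Longrightarrow> x + z + \<epsilon> *\<^sub>R y \<in> U"
      using cube_open_nbhd[OF U \<epsilon>(2)] by metis
    have in_U: "w + \<epsilon> *\<^sub>R y \<in> U" if "w \<in> ball x d" "y \<in> unit_cube" for w y
      using d(2)[of "w - x" y] that by (simp add: dist_norm norm_minus_commute)
    have "continuous_on (ball x d \<times> cbox (- One) One) (\<lambda>z. dbump u (snd z) *\<^sub>R G (fst z + \<epsilon> *\<^sub>R snd z))"
      using in_U by (intro continuous_intros continuous_on_compose2[OF mvp_imp_continuous_on[OF G]])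
        (auto simp: unit_cube_def)
    then have "continuous_on (ball x d) (\<lambda>w. integral unit_cube (\<lambda>y. dbump u y *\<^sub>R G (w + \<epsilon> *\<^sub>R y)))"
      unfolding unit_cube_def by (intro integral_continuous_on_param) (simp add: case_prod_beta')
    then have "continuous_on (ball x d) (\<lambda>w. (1 / (\<epsilon> * bump_mass TYPE('c))) *\<^sub>R
        integral unit_cube (\<lambda>y. dbump u y *\<^sub>R G (w + \<epsilon> *\<^sub>R y)))"
      by (intro continuous_intros)
    then have "continuous_on (ball x d) (dderiv G u)"
      by (rule continuous_on_eq)
         (use mvp_dderiv[OF U G \<epsilon>(1) in_U, of _ u] \<epsilon>(1) bump_mass_pos[where ?'c='c] in simp)
    then show ?thesis using d(1) by (simp add: continuous_on_eq_continuous_at)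
  qed
  then show ?thesis by (simp add: continuous_at_imp_continuous_on)
qed

text \<open>An averaging identity valid at all base points near x may be differentiated in the base
  point. With \<kappa> = \<open>bump\<close> this passes the mean value property to derivatives;
  with \<kappa> = \<open>dbump u\<close> it makes second derivatives commute.\<close>

lemma integral_dderiv_mvp:
  fixes G F :: "'c::euclidean_space \<Rightarrow> 'b::euclidean_space"
  assumes U: "open U" and G: "mvp U G" and F: "F differentiable (at x)"
    and \<kappa>: "continuous_on unit_cube \<kappa>"
    and sub: "\<And>y. y \<in> unit_cube \<Longrightarrow> x + \<epsilon> *\<^sub>R y \<in> U"
    and eq: "\<And>w. (\<And>y. y \<in> unit_cube \<Longrightarrow> w + \<epsilon> *\<^sub>R y \<in> U) \<Longrightarrow>
      integral unit_cube (\<lambda>y. \<kappa> y *\<^sub>R G (w + \<epsilon> *\<^sub>R y)) = c *\<^sub>R F w"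
  shows "integral unit_cube (\<lambda>y. \<kappa> y *\<^sub>R dderiv G u (x + \<epsilon> *\<^sub>R y)) = c *\<^sub>R dderiv F u x"
proof -
  obtain d where d: "d > 0" "\<And>z y. norm z < d \<Longrightarrow> y \<in> unit_cube \<Longrightarrow> x + z + \<epsilon> *\<^sub>R y \<in> U"
    using cube_open_nbhd[OF U sub] by metis
  define d' where "d' = d / (norm u + 1)"
  have "d' > 0" using d by (simp add: d'_def add_nonneg_pos)
  have d': "norm (t *\<^sub>R u) < d" if "t \<in> ball 0 d'" for t
  proof -
    have "\<bar>t\<bar> * (norm u + 1) < d"
      using that by (simp add: d'_def dist_norm pos_less_divide_eq add_nonneg_pos)
    then show "norm (t *\<^sub>R u) < d" by (simp add: distrib_left)
  qed
  have "((\<lambda>t. integral unit_cube (\<lambda>y. \<kappa> y *\<^sub>R G (x + t *\<^sub>R u + \<epsilon> *\<^sub>R y))) has_vector_derivative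
     integral unit_cube (\<lambda>y. \<kappa> y *\<^sub>R dderiv G u (x + \<epsilon> *\<^sub>R y))) (at 0)"
    by (rule leibniz_dderiv[OF U mvp_differentiable[OF U G] continuous_on_dderiv_mvp[OF U G] \<kappa> sub])
  then have "((\<lambda>t. c *\<^sub>R F (x + t *\<^sub>R u)) has_vector_derivative
     integral unit_cube (\<lambda>y. \<kappa> y *\<^sub>R dderiv G u (x + \<epsilon> *\<^sub>R y))) (at 0)"
    by (rule has_vector_derivative_transform_within_open[of _ _ _ "ball 0 d'"])
       (use \<open>d' > 0\<close> d(2)[OF d'] in \<open>auto intro!: eq\<close>)
  moreover have "((\<lambda>t. c *\<^sub>R F (x + t *\<^sub>R u)) has_vector_derivative c *\<^sub>R dderiv F u x) (at 0)"
    using has_vector_derivative_scaleR[OF DERIV_const dderiv_line[of F x 0 u UNIV]] F by simp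
  ultimately show ?thesis by (rule vector_derivative_unique_at)
qed

lemma mvp_dderiv_mvp:
  fixes G :: "'c::euclidean_space \<Rightarrow> 'b::euclidean_space"
  assumes U: "open U" and G: "mvp U G"
  shows "mvp U (dderiv G u)"
  unfolding mvp_def
proof (intro conjI allI impI)
  fix x and \<epsilon> :: real assume *: "0 < \<epsilon> \<and> (\<forall>y\<in>unit_cube. x + \<epsilon> *\<^sub>R y \<in> U)"
  then have "x \<in> U" by (force simp: mem_unit_cube dest!: bspec[of _ _ 0])
  with * show "integral unit_cube (\<lambda>y. bump y *\<^sub>R dderiv G u (x + \<epsilon> *\<^sub>R y)) = bump_mass TYPE('c) *\<^sub>R dderiv G u x"
    using G by (intro integral_dderiv_mvp[OF U G] mvp_differentiable[OF U G] continuous_intros)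
      (auto simp: mvp_def)
qed (rule continuous_on_dderiv_mvp[OF U G])

text \<open>The average of \<open>dderiv G w\<close> against \<open>dbump u\<close> is evaluated
  twice: by differentiating the averages of G in direction w, and by the formula
  \<open>mvp_dderiv\<close> for \<open>dderiv G w\<close> itself.\<close>

lemma mvp_dderiv_commute:
  fixes G :: "'c::euclidean_space \<Rightarrow> 'b::euclidean_space"
  assumes U: "open U" and G: "mvp U G" and x: "x \<in> U"
  shows "dderiv (dderiv G u) w x = dderiv (dderiv G w) u x"
proof -
  obtain \<epsilon> where \<epsilon>: "\<epsilon> > 0" "\<And>y. y \<in> unit_cube \<Longrightarrow> x + \<epsilon> *\<^sub>R y \<in> U"
    using cube_in_open[OF U x] by metis
  have "integral unit_cube (\<lambda>y. dbump u y *\<^sub>R dderiv G w (x + \<epsilon> *\<^sub>R y)) =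
           (\<epsilon> * bump_mass TYPE('c)) *\<^sub>R dderiv (dderiv G u) w x"
    by (intro integral_dderiv_mvp[OF U G] mvp_differentiable[OF U mvp_dderiv_mvp[OF U G]] x \<epsilon>
         mvp_dderiv[OF U G] continuous_intros)
  moreover have "integral unit_cube (\<lambda>y. dbump u y *\<^sub>R dderiv G w (x + \<epsilon> *\<^sub>R y)) =
           (\<epsilon> * bump_mass TYPE('c)) *\<^sub>R dderiv (dderiv G w) u x"
    by (intro mvp_dderiv[OF U mvp_dderiv_mvp[OF U G]] \<epsilon>)
  ultimately show ?thesis using \<epsilon>(1) bump_mass_pos[where ?'c='c] by simp
qed

section \<open>Closure under linear operations\<close>

lemma mvp_add:
  assumes "mvp U F" "mvp U G"
  shows "mvp U (\<lambda>x. F x + G x)"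
  unfolding mvp_def
proof (intro conjI allI impI)
  fix x and \<epsilon> :: real assume *: "0 < \<epsilon> \<and> (\<forall>y\<in>unit_cube. x + \<epsilon> *\<^sub>R y \<in> U)"
  have "(\<lambda>y. bump y *\<^sub>R H (x + \<epsilon> *\<^sub>R y)) integrable_on unit_cube" if "mvp U H" for H :: "'a \<Rightarrow> 'b"
    unfolding unit_cube_def using *
    by (intro integrable_continuous continuous_intros continuous_on_compose2[OF mvp_imp_continuous_on[OF that]])
       (auto simp: unit_cube_def)
  then show "integral unit_cube (\<lambda>y. bump y *\<^sub>R (F (x + \<epsilon> *\<^sub>R y) + G (x + \<epsilon> *\<^sub>R y))) =
      bump_mass TYPE('a) *\<^sub>R (F x + G x)"
    using assms * by (simp add: scaleR_add_right Henstock_Kurzweil_Integration.integral_add mvp_def)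
qed (intro continuous_intros assms mvp_imp_continuous_on)

lemma mvp_linear:
  fixes L :: "'b::euclidean_space \<Rightarrow> 'd::euclidean_space"
  assumes "mvp U F" "linear L"
  shows "mvp U (\<lambda>x. L (F x))"
  unfolding mvp_def
proof (intro conjI allI impI)
  interpret L: bounded_linear L using assms(2) by (rule linear_linear[THEN iffD2])
  fix x and \<epsilon> :: real assume *: "0 < \<epsilon> \<and> (\<forall>y\<in>unit_cube. x + \<epsilon> *\<^sub>R y \<in> U)"
  have "(\<lambda>y. bump y *\<^sub>R F (x + \<epsilon> *\<^sub>R y)) integrable_on unit_cube"
    unfolding unit_cube_def using *
    by (intro integrable_continuous continuous_intros continuous_on_compose2[OF mvp_imp_continuous_on[OF assms(1)]])
       (auto simp: unit_cube_def)
  from integral_linear[OF this L.bounded_linear_axioms]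
  show "integral unit_cube (\<lambda>y. bump y *\<^sub>R L (F (x + \<epsilon> *\<^sub>R y))) =
      bump_mass TYPE('a) *\<^sub>R L (F x)"
    using assms * by (simp add: o_def L.scaleR mvp_def)
next
  interpret L: bounded_linear L using assms(2) by (rule linear_linear[THEN iffD2])
  show "continuous_on U (\<lambda>x. L (F x))"
    by (intro L.continuous_on assms mvp_imp_continuous_on)
qed

lemma mvp_zero: "mvp U (\<lambda>_. 0)"
  by (simp add: mvp_def)

lemma mvp_sum:
  assumes "\<And>i. i \<in> I \<Longrightarrow> mvp U (F i)"
  shows "mvp U (\<lambda>x. \<Sum>i\<in>I. F i x)"
  using assms
proof (induction I rule: infinite_finite_induct)
  case (insert i I)
  have "mvp U (\<lambda>x. F i x + (\<Sum>i\<in>I. F i x))"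
    by (intro mvp_add insert) auto
  then show ?case using insert.hyps by simp
qed (simp_all add: mvp_zero)

lemma mvp_scaleR:
  assumes "mvp U F"
  shows "mvp U (\<lambda>x. c *\<^sub>R F x)"
proof -
  have "linear (\<lambda>x::'b. c *\<^sub>R x)" by (rule linear_scale_self)
  from mvp_linear[OF assms this] show ?thesis .
qed

lemma mvp_minus:
  assumes "mvp U F"
  shows "mvp U (\<lambda>x. - F x)"
  using mvp_scaleR[OF assms, of "-1"] by simp

lemma mvp_diff:
  assumes "mvp U F" "mvp U G"
  shows "mvp U (\<lambda>x. F x - G x)"
  using mvp_add[OF assms(1) mvp_minus[OF assms(2)]] by simp

text \<open>In the constant, 2 ^ DIM is the volume of the cube, and the factor DIM appears because
  points of the cube have norm at most DIM, so that the cube scaled by \<epsilon> = d / DIM fits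
  into the ball of radius d.\<close>

lemma mvp_dderiv_bound:
  fixes G :: "'c::euclidean_space \<Rightarrow> 'b::euclidean_space"
  assumes U: "open U" and G: "mvp U G" and d: "d > 0" and sub: "cball x d \<subseteq> U"
    and M: "\<And>y. y \<in> cball x d \<Longrightarrow> norm (G y) \<le> M"
  shows "norm (dderiv G u x) \<le>
    2 ^ DIM('c) * DIM('c) / bump_mass TYPE('c) * norm u / d * M"
proof -
  define \<epsilon> where "\<epsilon> = d / DIM('c)"
  have \<epsilon>: "\<epsilon> > 0" using d by (simp add: \<epsilon>_def)
  have c: "bump_mass TYPE('c) > 0" by (rule bump_mass_pos)
  have in_ball: "x + \<epsilon> *\<^sub>R y \<in> cball x d" if "y \<in> unit_cube" for y
  proof -
    have "\<epsilon> * norm y \<le> \<epsilon> * DIM('c)"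
      using norm_unit_cube_le[OF that] \<epsilon> by (intro mult_left_mono) auto
    then show ?thesis using \<epsilon> d by (simp add: dist_norm \<epsilon>_def)
  qed
  have "norm (integral (cbox (- One) One) (\<lambda>y. dbump u y *\<^sub>R G (x + \<epsilon> *\<^sub>R y))) \<le>
      (norm u * M) * measure lborel (cbox (- One) (One :: 'c))"
  proof (rule has_integral_bound)
    show "0 \<le> norm u * M" using order_trans[OF norm_ge_zero M[of x]] d by simp
    show "((\<lambda>y. dbump u y *\<^sub>R G (x + \<epsilon> *\<^sub>R y)) has_integral
        integral (cbox (- One) One) (\<lambda>y. dbump u y *\<^sub>R G (x + \<epsilon> *\<^sub>R y))) (cbox (- One) One)"
      using in_ball sub
      by (intro integrable_integral integrable_continuous continuous_intros
           continuous_on_compose2[OF mvp_imp_continuous_on[OF G]]) (auto simp: unit_cube_def)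
    fix y :: 'c assume "y \<in> cbox (- One) One"
    then have "norm (G (x + \<epsilon> *\<^sub>R y)) \<le> M" by (intro M in_ball) (simp add: unit_cube_def)
    then show "norm (dbump u y *\<^sub>R G (x + \<epsilon> *\<^sub>R y)) \<le> norm u * M"
      by (auto intro!: mult_mono norm_dbump_le)
  qed
  moreover have "measure lborel (cbox (- One) (One :: 'c)) = 2 ^ DIM('c)"
    by (subst content_cbox) auto
  moreover have "integral (cbox (- One) One) (\<lambda>y. dbump u y *\<^sub>R G (x + \<epsilon> *\<^sub>R y)) =
      (\<epsilon> * bump_mass TYPE('c)) *\<^sub>R dderiv G u x"
    unfolding unit_cube_def[symmetric] by (rule mvp_dderiv[OF U G \<epsilon>]) (use in_ball sub in blast)
  ultimately have "\<epsilon> * bump_mass TYPE('c) * norm (dderiv G u x) \<le> norm u * M * 2 ^ DIM('c)"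
    using \<epsilon> c by (simp add: abs_mult)
  then have "norm (dderiv G u x) \<le> norm u * M * 2 ^ DIM('c) / (\<epsilon> * bump_mass TYPE('c))"
    using \<epsilon> c by (simp add: field_simps)
  also have "\<dots> = 2 ^ DIM('c) * DIM('c) / bump_mass TYPE('c) * norm u / d * M"
    using d c by (simp add: \<epsilon>_def field_simps)
  finally show ?thesis .
qed

text \<open>For small t the support of the kernel translated by t j stays inside the cube, so the
  integral of the translate of \<open>K\<close> does not depend on t. Its t-derivative is therefore
  0, and the product rule splits it into the two sides. Only first derivatives of G occur, as befits
  a function that is merely C^1.\<close>

lemma integral_by_parts_bump:
  fixes G :: "'c::euclidean_space \<Rightarrow> 'b::euclidean_space"
  assumes U: "open U" and dG: "\<And>x. x \<in> U \<Longrightarrow> G differentiable (at x)"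
    and cont: "continuous_on U (dderiv G j)"
    and sub: "\<And>y. y \<in> unit_cube \<Longrightarrow> x + \<tau> *\<^sub>R y \<in> U"
  shows "\<tau> *\<^sub>R integral unit_cube (\<lambda>y. ((y \<bullet> i) * bump y) *\<^sub>R dderiv G j (x + \<tau> *\<^sub>R y)) =
    integral unit_cube (\<lambda>y. ((y \<bullet> i) * dbump j y - (j \<bullet> i) * bump y) *\<^sub>R G (x + \<tau> *\<^sub>R y))"
proof -
  obtain d where d: "d > 0" "\<And>z y. norm z < d \<Longrightarrow> y \<in> unit_cube \<Longrightarrow> x + z + \<tau> *\<^sub>R y \<in> U"
    using cube_open_nbhd[OF U sub] by metis
  \<comment> \<open>\<open>N\<close> dominates both displacements, t \<tau> j which must stay within
    U and t j which must stay within the cube, so one bound on t serves for both.\<close>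
  define N where "N = norm (\<tau> *\<^sub>R j) + norm j + 1"
  have N: "N > 0" by (simp add: N_def add_nonneg_pos)
  define d' where "d' = min d (1/2) / N"
  have d'_pos: "d' > 0" using d N by (simp add: d'_def)
  have t: "norm (t *\<^sub>R \<tau> *\<^sub>R j) < d" "norm (t *\<^sub>R j) \<le> 1/2" if "t \<in> ball 0 d'" for t
  proof -
    have *: "\<bar>t\<bar> * N < min d (1/2)"
      using that N by (simp add: d'_def dist_norm pos_less_divide_eq)
    have "\<bar>t\<bar> * norm (\<tau> *\<^sub>R j) \<le> \<bar>t\<bar> * N" "\<bar>t\<bar> * norm j \<le> \<bar>t\<bar> * N"
      by (auto simp: N_def intro!: mult_left_mono)
    with * show "norm (t *\<^sub>R \<tau> *\<^sub>R j) < d" "norm (t *\<^sub>R j) \<le> 1/2"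
      unfolding norm_scaleR[of t] by linarith+
  qed
  have in_U: "x + \<tau> *\<^sub>R (y + t *\<^sub>R j) \<in> U" if "t \<in> ball 0 d'" "y \<in> unit_cube" for t y
    using d(2)[OF t(1)[OF that(1)] that(2)] by (simp add: algebra_simps)
  have contG: "continuous_on U G"
    using dG by (meson differentiable_imp_continuous_on differentiable_at_imp_differentiable_on)
  define K where "K y = ((y \<bullet> i) * bump y) *\<^sub>R G (x + \<tau> *\<^sub>R y)" for y
  define K' where "K' y = ((y \<bullet> i) * bump y) *\<^sub>R (\<tau> *\<^sub>R dderiv G j (x + \<tau> *\<^sub>R y)) +
     ((j \<bullet> i) * bump y - (y \<bullet> i) * dbump j y) *\<^sub>R G (x + \<tau> *\<^sub>R y)" for y
  have "((\<lambda>t. integral unit_cube (\<lambda>y. K (y + t *\<^sub>R j))) has_vector_derivative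
     integral unit_cube (\<lambda>y. K' (y + 0 *\<^sub>R j))) (at 0 within ball 0 d')"
    unfolding unit_cube_def
  proof (rule leibniz_rule_vector_derivative, fold unit_cube_def)
    fix t :: real and y :: 'c assume ty: "t \<in> ball 0 d'" "y \<in> unit_cube"
    have 1: "((\<lambda>t. G ((x + \<tau> *\<^sub>R y) + t *\<^sub>R \<tau> *\<^sub>R j)) has_vector_derivative
        dderiv G (\<tau> *\<^sub>R j) ((x + \<tau> *\<^sub>R y) + t *\<^sub>R \<tau> *\<^sub>R j)) (at t within ball 0 d')"
      using in_U[OF ty] by (intro dderiv_line dG) (simp add: algebra_simps)
    obtain G' where G': "(G has_derivative G') (at (x + \<tau> *\<^sub>R (y + t *\<^sub>R j)))"
      using dG[OF in_U[OF ty]] by (auto simp: differentiable_def)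
    interpret G': bounded_linear G' using G' by (rule has_derivative_bounded_linear)
    have "dderiv G (\<tau> *\<^sub>R j) (x + \<tau> *\<^sub>R (y + t *\<^sub>R j)) = \<tau> *\<^sub>R dderiv G j (x + \<tau> *\<^sub>R (y + t *\<^sub>R j))"
      by (simp add: dderiv_eq[OF G'] G'.scaleR)
    with 1 have 1: "((\<lambda>t. G (x + \<tau> *\<^sub>R (y + t *\<^sub>R j))) has_vector_derivative
        \<tau> *\<^sub>R dderiv G j (x + \<tau> *\<^sub>R (y + t *\<^sub>R j))) (at t within ball 0 d')"
      by (simp add: algebra_simps)
    have "((\<lambda>t. y + t *\<^sub>R j) has_derivative (\<lambda>t. t *\<^sub>R j)) (at t within ball 0 d')"
      by (auto intro!: derivative_eq_intros)
    from has_derivative_compose[OF this bump_has_derivative]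
    have "((\<lambda>t. bump (y + t *\<^sub>R j)) has_derivative (\<lambda>s. - dbump (s *\<^sub>R j) (y + t *\<^sub>R j))) (at t within ball 0 d')" .
    moreover have "(\<lambda>s. - dbump (s *\<^sub>R j) (y + t *\<^sub>R j)) = (*) (- dbump j (y + t *\<^sub>R j))"
      by (rule ext) (simp add: dbump_def)
    ultimately have 2: "((\<lambda>t. bump (y + t *\<^sub>R j)) has_field_derivative - dbump j (y + t *\<^sub>R j)) (at t within ball 0 d')"
      by (simp add: has_field_derivative_def)
    have 3: "((\<lambda>t. (y + t *\<^sub>R j) \<bullet> i) has_field_derivative j \<bullet> i) (at t within ball 0 d')"
      by (auto simp: inner_simps intro!: derivative_eq_intros)
    have "((\<lambda>t. K (y + t *\<^sub>R j)) has_vector_derivative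
       ((((y + t *\<^sub>R j) \<bullet> i) * bump (y + t *\<^sub>R j)) *\<^sub>R (\<tau> *\<^sub>R dderiv G j (x + \<tau> *\<^sub>R (y + t *\<^sub>R j))) +
       ((j \<bullet> i) * bump (y + t *\<^sub>R j) + (- dbump j (y + t *\<^sub>R j)) * ((y + t *\<^sub>R j) \<bullet> i)) *\<^sub>R G (x + \<tau> *\<^sub>R (y + t *\<^sub>R j)))) (at t within ball 0 d')"
      unfolding K_def by (rule has_vector_derivative_scaleR[OF DERIV_mult[OF 3 2] 1])
    then show "((\<lambda>t. K (y + t *\<^sub>R j)) has_vector_derivative K' (y + t *\<^sub>R j)) (at t within ball 0 d')"
      by (simp add: K'_def mult.commute)
  next
    fix t :: real assume "t \<in> ball 0 d'"
    then show "(\<lambda>y. K (y + t *\<^sub>R j)) integrable_on unit_cube"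
      unfolding unit_cube_def K_def using in_U
      by (intro integrable_continuous continuous_intros continuous_on_compose2[OF contG])
         (auto simp: unit_cube_def)
  next
    have "continuous_on (ball 0 d' \<times> unit_cube) (\<lambda>z. K' (snd z + fst z *\<^sub>R j))"
      using in_U unfolding K'_def
      by (intro continuous_intros continuous_on_compose2[OF cont] continuous_on_compose2[OF contG]) auto
    then show "continuous_on (ball 0 d' \<times> unit_cube) (\<lambda>(t, y). K' (y + t *\<^sub>R j))"
      by (simp add: case_prod_beta')
  qed (use d'_pos in auto)
  then have "((\<lambda>t. integral unit_cube (\<lambda>y. K (y + t *\<^sub>R j))) has_vector_derivative integral unit_cube K') (at 0)"
    using d'_pos by (simp add: at_within_open[of 0 "ball 0 d'"])
  moreover have "integral unit_cube (\<lambda>y. K (y + t *\<^sub>R j)) = integral unit_cube K" if "t \<in> ball 0 d'" for t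
    unfolding unit_cube_def
  proof (rule integral_shift_support[where S = "cball 0 (1/2)"])
    show "cball 0 (1/2) \<subseteq> cbox (- One) (One :: 'c)"
    proof
      fix y :: 'c assume "y \<in> cball 0 (1/2)"
      then show "y \<in> cbox (- One) One"
        using Basis_le_norm[of _ y] by (fold unit_cube_def) (force simp: mem_unit_cube)
    qed
    show "cball 0 (1/2) \<subseteq> cbox (- One + t *\<^sub>R j) (One + t *\<^sub>R j)"
    proof
      fix y :: 'c assume "y \<in> cball 0 (1/2)"
      then have "norm (y - t *\<^sub>R j) \<le> 1"
        using t(2)[OF that] norm_triangle_ineq4[of y "t *\<^sub>R j"] by (simp add: dist_norm)
      then have "y - t *\<^sub>R j \<in> unit_cube"
        using Basis_le_norm[of _ "y - t *\<^sub>R j"] by (force simp: mem_unit_cube)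
      then show "y \<in> cbox (- One + t *\<^sub>R j) (One + t *\<^sub>R j)"
        by (auto simp: mem_unit_cube mem_box inner_simps abs_le_iff algebra_simps)
    qed
  qed (auto simp: K_def bump_eq_0)
  ultimately have "((\<lambda>t. integral unit_cube K) has_vector_derivative integral unit_cube K') (at 0)"
    using d'_pos by (elim has_vector_derivative_transform_within_open[of _ _ _ "ball 0 d'"]) auto
  moreover have "((\<lambda>t. integral unit_cube K) has_vector_derivative 0) (at 0)"
    by (rule has_vector_derivative_const)
  ultimately have "integral unit_cube K' = 0"
    by (rule vector_derivative_unique_at)
  moreover have "integral unit_cube K' =
     integral unit_cube (\<lambda>y. ((y \<bullet> i) * bump y) *\<^sub>R (\<tau> *\<^sub>R dderiv G j (x + \<tau> *\<^sub>R y))) +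
     integral unit_cube (\<lambda>y. ((j \<bullet> i) * bump y - (y \<bullet> i) * dbump j y) *\<^sub>R G (x + \<tau> *\<^sub>R y))"
    unfolding K'_def unit_cube_def using sub
    by (intro Henstock_Kurzweil_Integration.integral_add integrable_continuous continuous_intros continuous_on_compose2[OF contG]
         continuous_on_compose2[OF cont]) (auto simp: unit_cube_def)
  moreover have "integral unit_cube (\<lambda>y. ((y \<bullet> i) * bump y) *\<^sub>R (\<tau> *\<^sub>R dderiv G j (x + \<tau> *\<^sub>R y))) =
     \<tau> *\<^sub>R integral unit_cube (\<lambda>y. ((y \<bullet> i) * bump y) *\<^sub>R dderiv G j (x + \<tau> *\<^sub>R y))"
    by (subst integral_cmul[symmetric]) (simp add: mult_ac)
  moreover have "integral unit_cube (\<lambda>y. ((j \<bullet> i) * bump y - (y \<bullet> i) * dbump j y) *\<^sub>R G (x + \<tau> *\<^sub>R y)) =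
    - integral unit_cube (\<lambda>y. ((y \<bullet> i) * dbump j y - (j \<bullet> i) * bump y) *\<^sub>R G (x + \<tau> *\<^sub>R y))"
    by (subst integral_neg[symmetric]) (simp flip: scaleR_minus_left)
  ultimately show ?thesis by (simp add: eq_neg_iff_add_eq_0)
qed

text \<open>The weights \<open>w\<close> generate a Clifford system. The derivative in \<open>\<tau>\<close> of
\<open>\<integral> bump y G (x + \<tau> y)\<close> is the trace of the matrix \<open>M i j = \<integral> y\<^sub>i bump y \<partial>\<^sub>j G (x + \<tau> y)\<close>, which is
symmetric because \<open>y\<^sub>i bump y\<close> is a gradient; applying the conjugate weights to the rows of the
first-order system makes all off-diagonal terms cancel.\<close>
theorem mvp_clifford_system:
  fixes G :: "'c::euclidean_space \<Rightarrow> 'b::euclidean_space" and \<iota> :: "nat \<Rightarrow> 'c"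
    and w w' :: "nat \<Rightarrow> 'b \<Rightarrow> 'b"
  assumes U: "open U" and dG: "\<And>x. x \<in> U \<Longrightarrow> G differentiable (at x)"
    and cont: "\<And>i. i \<in> Basis \<Longrightarrow> continuous_on U (dderiv G i)"
    and inj: "inj_on \<iota> {..n}" and \<iota>: "\<iota> ` {..n} \<subseteq> Basis"
    and zero: "\<And>x i. x \<in> U \<Longrightarrow> i \<in> Basis - \<iota> ` {..n} \<Longrightarrow> dderiv G i x = 0"
    and lin: "\<And>s. s \<le> n \<Longrightarrow> linear (w s)" and lin': "\<And>s. s \<le> n \<Longrightarrow> linear (w' s)"
    and sys: "\<And>x. x \<in> U \<Longrightarrow> (\<Sum>s\<le>n. w s (dderiv G (\<iota> s) x)) = 0"
    and cliff: "\<And>s t a. s \<le> n \<Longrightarrow> t \<le> n \<Longrightarrow>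
      w' s (w t a) + w' t (w s a) = (if s = t then 2 else 0) *\<^sub>R a"
  shows "mvp U G"
proof -
  have contG: "continuous_on U G"
    using dG by (meson differentiable_imp_continuous_on differentiable_at_imp_differentiable_on)
  have "integral unit_cube (\<lambda>y. bump y *\<^sub>R G (x + \<epsilon> *\<^sub>R y)) = bump_mass TYPE('c) *\<^sub>R G x"
    if \<epsilon>: "\<epsilon> > 0" and sub: "\<And>y. y \<in> unit_cube \<Longrightarrow> x + \<epsilon> *\<^sub>R y \<in> U" for x \<epsilon>
  proof -
    have in_U: "x + \<tau> *\<^sub>R y \<in> U" if "\<tau> \<in> {0..\<epsilon>}" "y \<in> unit_cube" for \<tau> y
    proof -
      have "(\<tau> / \<epsilon>) * \<bar>y \<bullet> b\<bar> \<le> 1 * 1" if "b \<in> Basis" for b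
        using \<open>\<tau> \<in> {0..\<epsilon>}\<close> \<open>y \<in> unit_cube\<close> \<epsilon> that by (intro mult_mono) (auto simp: mem_unit_cube)
      then have "(\<tau> / \<epsilon>) *\<^sub>R y \<in> unit_cube"
        using \<open>\<tau> \<in> {0..\<epsilon>}\<close> \<epsilon> by (auto simp: mem_unit_cube abs_mult)
      from sub[OF this] show ?thesis using \<epsilon> by simp
    qed
    define M where "M \<tau> i j = integral unit_cube (\<lambda>y. ((y \<bullet> i) * bump y) *\<^sub>R dderiv G j (x + \<tau> *\<^sub>R y))"
      for \<tau> i j
    have int_M: "(\<lambda>y. ((y \<bullet> i) * bump y) *\<^sub>R dderiv G j (x + \<tau> *\<^sub>R y)) integrable_on unit_cube"
      if "\<tau> \<in> {0..\<epsilon>}" "j \<in> Basis" for \<tau> i j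
      using in_U[OF that(1)] unfolding unit_cube_def
      by (intro integrable_continuous continuous_intros continuous_on_compose2[OF cont[OF that(2)]])
        (auto simp: unit_cube_def)
    \<comment> \<open>Integration by parts yields the symmetry only after multiplication by \<tau>,
      hence the restriction to \<tau> > 0.\<close>
    have M_sym: "M \<tau> i j = M \<tau> j i" if "\<tau> \<in> {0<..\<epsilon>}" "i \<in> Basis" "j \<in> Basis" for \<tau> i j
    proof -
      have "(y \<bullet> i) * dbump j y - (j \<bullet> i) * bump y = (y \<bullet> j) * dbump i y - (i \<bullet> j) * bump y" for y
        by (simp add: dbump_def inner_commute)
      then have "\<tau> *\<^sub>R M \<tau> i j = \<tau> *\<^sub>R M \<tau> j i"
        unfolding M_def using that in_U[of \<tau>]
        by (subst (1 2) integral_by_parts_bump[OF U dG cont]) auto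
      then show ?thesis using that by simp
    qed
    have M_trace: "(\<Sum>i\<in>Basis. M \<tau> i i) = 0" if \<tau>: "\<tau> \<in> {0<..\<epsilon>}" for \<tau>
    proof -
      have "(\<Sum>i\<in>Basis. M \<tau> i i) = (\<Sum>i\<in>\<iota> ` {..n}. M \<tau> i i)"
      proof (rule sum.mono_neutral_right[OF finite_Basis \<iota>], intro ballI)
        fix i assume "i \<in> Basis - \<iota> ` {..n}"
        then have "M \<tau> i i = integral unit_cube (\<lambda>y::'c. 0)"
          unfolding M_def using in_U[of \<tau>] \<tau> zero by (intro Henstock_Kurzweil_Integration.integral_cong) auto
        then show "M \<tau> i i = 0" by simp
      qed
      also have "\<dots> = (\<Sum>s\<le>n. M \<tau> (\<iota> s) (\<iota> s))"
        by (simp add: sum.reindex[OF inj])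
      also have "\<dots> = 0"
      proof -
        have row: "(\<Sum>t\<le>n. w t (M \<tau> i (\<iota> t))) = 0" for i
        proof -
          have "w t (M \<tau> i (\<iota> t)) = integral unit_cube (\<lambda>y. ((y \<bullet> i) * bump y) *\<^sub>R w t (dderiv G (\<iota> t) (x + \<tau> *\<^sub>R y)))"
            and "(\<lambda>y. ((y \<bullet> i) * bump y) *\<^sub>R w t (dderiv G (\<iota> t) (x + \<tau> *\<^sub>R y))) integrable_on unit_cube"
            if "t \<le> n" for t
          proof -
            interpret bounded_linear "w t" using lin[OF that] by (simp add: linear_linear)
            have "(\<lambda>y. ((y \<bullet> i) * bump y) *\<^sub>R dderiv G (\<iota> t) (x + \<tau> *\<^sub>R y)) integrable_on unit_cube"
              using \<tau> \<iota> that by (intro int_M) auto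
            from integral_linear[OF this bounded_linear_axioms] integrable_linear[OF this bounded_linear_axioms]
            show "w t (M \<tau> i (\<iota> t)) = integral unit_cube (\<lambda>y. ((y \<bullet> i) * bump y) *\<^sub>R w t (dderiv G (\<iota> t) (x + \<tau> *\<^sub>R y)))"
              and "(\<lambda>y. ((y \<bullet> i) * bump y) *\<^sub>R w t (dderiv G (\<iota> t) (x + \<tau> *\<^sub>R y))) integrable_on unit_cube"
              by (simp_all add: M_def o_def scaleR)
          qed
          then have "(\<Sum>t\<le>n. w t (M \<tau> i (\<iota> t))) =
              integral unit_cube (\<lambda>y. \<Sum>t\<le>n. ((y \<bullet> i) * bump y) *\<^sub>R w t (dderiv G (\<iota> t) (x + \<tau> *\<^sub>R y)))"
            by (subst Henstock_Kurzweil_Integration.integral_sum) simp_all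
          also have "\<dots> = integral unit_cube (\<lambda>y::'c. 0)"
            using \<tau> in_U[of \<tau>] sys
            by (intro Henstock_Kurzweil_Integration.integral_cong) (simp flip: scaleR_sum_right)
          finally show ?thesis by simp
        qed
        \<comment> \<open>Adding the double sum to its transpose pairs each term with its mirror
          image: by \<open>cliff\<close> and the symmetry of \<open>M\<close> the pairs with s
          \<noteq> t cancel and the diagonal gives twice the trace.\<close>
        define m where "m s t = w' s (w t (M \<tau> (\<iota> s) (\<iota> t)))" for s t
        have "0 = (\<Sum>s\<le>n. w' s (\<Sum>t\<le>n. w t (M \<tau> (\<iota> s) (\<iota> t))))"
          using lin' by (simp add: row linear_0)
        also have "\<dots> = (\<Sum>s\<le>n. \<Sum>t\<le>n. m s t)"
          using lin' by (intro sum.cong) (auto simp: linear_sum m_def)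
        finally have 0: "(\<Sum>s\<le>n. \<Sum>t\<le>n. m s t) = 0" by simp
        moreover have "(\<Sum>s\<le>n. \<Sum>t\<le>n. m s t) = (\<Sum>s\<le>n. \<Sum>t\<le>n. m t s)"
          by (rule sum.swap)
        ultimately have "(\<Sum>s\<le>n. \<Sum>t\<le>n. m s t + m t s) = 0"
          by (simp add: sum.distrib)
        moreover have "m s t + m t s = (if s = t then 2 *\<^sub>R M \<tau> (\<iota> s) (\<iota> s) else 0)" if "s \<le> n" "t \<le> n" for s t
          using M_sym[OF \<tau>, of "\<iota> s" "\<iota> t"] cliff[of s t "M \<tau> (\<iota> s) (\<iota> t)"] \<iota> that
          by (auto simp: m_def image_subset_iff)
        then have "(\<Sum>s\<le>n. \<Sum>t\<le>n. m s t + m t s) =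
            (\<Sum>s\<le>n. \<Sum>t\<le>n. if s = t then 2 *\<^sub>R M \<tau> (\<iota> s) (\<iota> s) else 0)"
          by (intro sum.cong) auto
        ultimately have "(\<Sum>s\<le>n. 2 *\<^sub>R M \<tau> (\<iota> s) (\<iota> s)) = 0"
          by simp
        then have "2 *\<^sub>R (\<Sum>s\<le>n. M \<tau> (\<iota> s) (\<iota> s)) = 0"
          by (simp only: scaleR_sum_right)
        then show ?thesis by simp
      qed
      finally show ?thesis .
    qed
    define I where "I \<tau> = integral unit_cube (\<lambda>y. bump y *\<^sub>R G (x + \<tau> *\<^sub>R y))" for \<tau>
    have I': "(I has_vector_derivative integral unit_cube
        (\<lambda>y. bump y *\<^sub>R (\<Sum>i\<in>Basis. (y \<bullet> i) *\<^sub>R dderiv G i (x + \<tau> *\<^sub>R y)))) (at \<tau> within {0..\<epsilon>})"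
      if "\<tau> \<in> {0..\<epsilon>}" for \<tau>
      unfolding I_def[abs_def] unit_cube_def
    proof (rule leibniz_rule_vector_derivative, fold unit_cube_def)
      fix t :: real and y :: 'c assume ty: "t \<in> {0..\<epsilon>}" "y \<in> unit_cube"
      obtain G' where G': "(G has_derivative G') (at (x + t *\<^sub>R y))"
        using dG[OF in_U[OF ty]] by (auto simp: differentiable_def)
      interpret G': bounded_linear G' using G' by (rule has_derivative_bounded_linear)
      have "G' y = G' (\<Sum>i\<in>Basis. (y \<bullet> i) *\<^sub>R i)" by (simp add: euclidean_representation)
      also have "\<dots> = (\<Sum>i\<in>Basis. (y \<bullet> i) *\<^sub>R dderiv G i (x + t *\<^sub>R y))"
        by (simp add: G'.sum G'.scaleR dderiv_eq[OF G'])
      finally have "dderiv G y (x + t *\<^sub>R y) = (\<Sum>i\<in>Basis. (y \<bullet> i) *\<^sub>R dderiv G i (x + t *\<^sub>R y))"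
        by (simp add: dderiv_eq[OF G'])
      then have "((\<lambda>t. G (x + t *\<^sub>R y)) has_vector_derivative
          (\<Sum>i\<in>Basis. (y \<bullet> i) *\<^sub>R dderiv G i (x + t *\<^sub>R y))) (at t within {0..\<epsilon>})"
        using dderiv_line[OF dG[OF in_U[OF ty]]] by metis
      from has_vector_derivative_scaleR[OF DERIV_const this, of "bump y"]
      show "((\<lambda>t. bump y *\<^sub>R G (x + t *\<^sub>R y)) has_vector_derivative
          bump y *\<^sub>R (\<Sum>i\<in>Basis. (y \<bullet> i) *\<^sub>R dderiv G i (x + t *\<^sub>R y))) (at t within {0..\<epsilon>})"
        by simp
    next
      fix t :: real assume "t \<in> {0..\<epsilon>}"
      then show "(\<lambda>y. bump y *\<^sub>R G (x + t *\<^sub>R y)) integrable_on unit_cube"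
        unfolding unit_cube_def using in_U
        by (intro integrable_continuous continuous_intros continuous_on_compose2[OF contG])
           (auto simp: unit_cube_def)
    next
      have "continuous_on ({0..\<epsilon>} \<times> unit_cube)
          (\<lambda>z. bump (snd z) *\<^sub>R (\<Sum>i\<in>Basis. (snd z \<bullet> i) *\<^sub>R dderiv G i (x + fst z *\<^sub>R snd z)))"
        using in_U by (intro continuous_intros continuous_on_compose2[OF cont]) auto
      then show "continuous_on ({0..\<epsilon>} \<times> unit_cube)
          (\<lambda>(t, y). bump y *\<^sub>R (\<Sum>i\<in>Basis. (y \<bullet> i) *\<^sub>R dderiv G i (x + t *\<^sub>R y)))"
        by (simp add: case_prod_beta')
    qed (use that in auto)
    have "(I has_derivative (\<lambda>h. 0)) (at \<tau> within {0..\<epsilon>})" if "\<tau> \<in> {0..\<epsilon>} - {0}" for \<tau>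
    proof -
      have \<tau>: "\<tau> \<in> {0..\<epsilon>}" "\<tau> \<in> {0<..\<epsilon>}" using that by auto
      have "integral unit_cube (\<lambda>y. bump y *\<^sub>R (\<Sum>i\<in>Basis. (y \<bullet> i) *\<^sub>R dderiv G i (x + \<tau> *\<^sub>R y))) =
          integral unit_cube (\<lambda>y. \<Sum>i\<in>Basis. ((y \<bullet> i) * bump y) *\<^sub>R dderiv G i (x + \<tau> *\<^sub>R y))"
        by (simp add: scaleR_sum_right mult.commute)
      also have "\<dots> = (\<Sum>i\<in>Basis. M \<tau> i i)"
        unfolding M_def using int_M[OF \<tau>(1)] by (intro Henstock_Kurzweil_Integration.integral_sum) auto
      finally show ?thesis
        using I'[OF \<tau>(1)] M_trace[OF \<tau>(2)] by (simp add: has_vector_derivative_def)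
    qed
    moreover have "continuous_on {0..\<epsilon>} I"
      using I' by (meson continuous_on_eq_continuous_within has_vector_derivative_continuous)
    \<comment> \<open>The exceptional point \<tau> = 0, where the derivative of \<open>I\<close> has
      not been evaluated, is absorbed by continuity.\<close>
    ultimately have "I \<epsilon> = I 0"
      using has_derivative_zero_unique_strong_convex[of "{0..\<epsilon>}" "{0}" I 0 "I 0" \<epsilon>] \<epsilon> by auto
    moreover have "I 0 = bump_mass TYPE('c) *\<^sub>R G x"
    proof -
      have "(\<lambda>y::'c. bump y) integrable_on unit_cube"
        unfolding unit_cube_def by (intro integrable_continuous continuous_intros)
      from integral_linear[OF this bounded_linear_scaleR_left[of "G x"]]
      show ?thesis by (simp add: I_def bump_mass_def o_def)
    qed
    ultimately show ?thesis by (simp add: I_def)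
  qed
  with contG show ?thesis by (auto simp: mvp_def)
qed

section \<open>Cauchy estimates of factorial type\<close>

lemma power_self_le_exp_fact: "real k ^ k \<le> exp (real k) * fact k"
proof -
  have "(\<Sum>n\<in>{k}. real k ^ n /\<^sub>R fact n) \<le> (\<Sum>n. real k ^ n /\<^sub>R fact n)"
    by (intro sum_le_suminf summable_exp_generic) auto
  then have "real k ^ k / fact k \<le> exp (real k)"
    by (simp add: exp_def divide_inverse mult.commute)
  then show ?thesis by (simp add: field_simps)
qed

text \<open>Every derivative costs a distance d from the boundary, so k of them stay within radius k
  d.\<close>

lemma mvp_funpow_dderiv_bound:
  fixes G :: "'c::euclidean_space \<Rightarrow> 'b::euclidean_space"
  assumes U: "open U" and G: "mvp U G" and d: "d > 0" and sub: "cball x (k * d) \<subseteq> U"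
    and M: "\<And>y. y \<in> cball x (k * d) \<Longrightarrow> norm (G y) \<le> M"
  shows "norm (((\<lambda>H. dderiv H u) ^^ k) G x) \<le>
    (2 ^ DIM('c) * DIM('c) / bump_mass TYPE('c) * norm u / d) ^ k * M"
  using G sub M
proof (induction k arbitrary: G M)
  case 0
  then show ?case by simp
next
  case (Suc k)
  let ?C = "2 ^ DIM('c) * DIM('c) / bump_mass TYPE('c) * norm u / d"
  have near: "cball y d \<subseteq> cball x (Suc k * d)" if "y \<in> cball x (k * d)" for y
  proof
    fix z assume "z \<in> cball y d"
    then show "z \<in> cball x (Suc k * d)"
      using that dist_triangle[of x z y] by (auto simp: distrib_right)
  qed
  have "norm (((\<lambda>H. dderiv H u) ^^ k) (dderiv G u) x) \<le> ?C ^ k * (?C * M)"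
  proof (rule Suc.IH[OF mvp_dderiv_mvp[OF U Suc.prems(1)]])
    show "cball x (k * d) \<subseteq> U"
      using near Suc.prems(2) d by force
    fix y assume y: "y \<in> cball x (k * d)"
    show "norm (dderiv G u y) \<le> ?C * M"
      using near[OF y] Suc.prems by (intro mvp_dderiv_bound[OF U _ d]) blast+
  qed
  then show ?case by (simp add: funpow_Suc_right mult_ac del: funpow.simps)
qed

text \<open>The available radius e/2 is spent in k equal steps, which gives a bound of the form (C
  k)^k. Since k^k is at most \<open>exp k\<close> times k!, this is factorial growth with a
  geometric factor, that is, real analyticity in direction u uniformly on \<open>K\<close>.\<close>

lemma mvp_derivatives_factorial_bound:
  fixes G :: "'c::euclidean_space \<Rightarrow> 'b::euclidean_space"
  assumes U: "open U" and G: "mvp U G" and K: "compact K" "K \<subseteq> U"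
  obtains C L where "C \<ge> 0" "L \<ge> 0" "\<And>x k. x \<in> K \<Longrightarrow> norm (((\<lambda>H. dderiv H u) ^^ k) G x) \<le> C * L ^ k * fact k"
proof -
  obtain e where e: "e > 0" "(\<Union>x\<in>K. ball x e) \<subseteq> U"
    using compact_subset_open_imp_ball_epsilon_subset[OF K(1) U K(2)] by blast
  define K' where "K' = {x + y |x y. x \<in> K \<and> y \<in> cball 0 (e/2)}"
  have cball_K': "cball x (e/2) \<subseteq> K'" if "x \<in> K" for x
  proof
    fix z assume "z \<in> cball x (e/2)"
    then have "z = x + (z - x)" "z - x \<in> cball 0 (e/2)" by (auto simp: dist_norm norm_minus_commute)
    then show "z \<in> K'" unfolding K'_def using that by blast
  qed
  have K'_sub: "K' \<subseteq> U"
  proof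
    fix z assume "z \<in> K'"
    then obtain x y where "x \<in> K" "norm y \<le> e/2" "z = x + y" by (auto simp: K'_def)
    then have "z \<in> ball x e" using e by (auto simp: dist_norm)
    then show "z \<in> U" using e \<open>x \<in> K\<close> by blast
  qed
  have "compact (G ` K')"
    unfolding K'_def
    by (intro compact_continuous_image compact_sums K compact_cball
         continuous_on_subset[OF mvp_imp_continuous_on[OF G] K'_sub[unfolded K'_def]])
  then obtain M where M: "\<And>y. y \<in> K' \<Longrightarrow> norm (G y) \<le> M" "M > 0"
    using compact_imp_bounded bounded_pos by (metis imageI)
  define C0 where "C0 = 2 ^ DIM('c) * DIM('c) / bump_mass TYPE('c) * norm u"
  have C0: "C0 \<ge> 0" using bump_mass_pos[where ?'c='c] by (simp add: C0_def)
  show thesis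
  proof (rule that[of M "C0 * exp 1 / (e/2)"])
    fix x k assume x: "x \<in> K"
    show "norm (((\<lambda>H. dderiv H u) ^^ k) G x) \<le> M * (C0 * exp 1 / (e/2)) ^ k * fact k"
    proof (cases "k = 0")
      case True
      have "x \<in> K'" using cball_K'[OF x] e by (auto intro: subsetD)
      then show ?thesis using True M by simp
    next
      case False
      define d where "d = e / 2 / k"
      have d: "d > 0" "real k * d = e / 2" using e False by (auto simp: d_def)
      have "norm (((\<lambda>H. dderiv H u) ^^ k) G x) \<le> (C0 / d) ^ k * M"
        unfolding C0_def using cball_K'[OF x] K'_sub M d
        by (intro mvp_funpow_dderiv_bound[OF U G]) auto
      also have "\<dots> = (C0 / (e/2)) ^ k * M * real k ^ k"
        using False e by (simp add: d_def power_divide power_mult_distrib field_simps)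
      also have "\<dots> \<le> (C0 / (e/2)) ^ k * M * (exp (real k) * fact k)"
        using C0 e M by (intro mult_left_mono power_self_le_exp_fact) auto
      also have "\<dots> = M * (C0 * exp 1 / (e/2)) ^ k * fact k"
        by (simp add: power_divide power_mult_distrib exp_of_nat_mult[of k 1, simplified])
      finally show ?thesis .
    qed
  qed (use M C0 e in auto)
qed

subsection \<open>Analytic families on an interval and Abel sums\<close>

text \<open>Taylor's estimate for a function whose whole jet vanishes at a. In the induction step
  the monomial minus c \<open>h 0\<close> is increasing for c = 1 and c = -1, which needs
  derivatives in the open interval and continuity at its ends.\<close>

lemma iterated_derivative_bound:
  fixes h :: "nat \<Rightarrow> real \<Rightarrow> real"
  assumes "\<And>k. continuous_on {a..b} (h k)"
    and "\<And>k t. a < t \<Longrightarrow> t < b \<Longrightarrow> (h k has_real_derivative h (Suc k) t) (at t)"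
    and "\<And>k. h k a = 0" and "\<And>t. t \<in> {a..b} \<Longrightarrow> \<bar>h n t\<bar> \<le> B" and "t \<in> {a..b}"
  shows "\<bar>h 0 t\<bar> \<le> B * (t - a) ^ n / fact n"
  using assms
proof (induction n arbitrary: h t)
  case 0
  then show ?case by simp
next
  case (Suc n)
  have bd: "\<bar>h 1 s\<bar> \<le> B * (s - a) ^ n / fact n" if "s \<in> {a..b}" for s
  proof -
    have "\<bar>(\<lambda>k. h (Suc k)) 0 s\<bar> \<le> B * (s - a) ^ n / fact n"
      by (rule Suc.IH) (use Suc.prems that in auto)
    then show ?thesis by simp
  qed
  have *: "c * h 0 t \<le> B * (t - a) ^ Suc n / fact (Suc n)" if "\<bar>c\<bar> = 1" for c
  proof -
    have "B * (a - a) ^ Suc n / fact (Suc n) - c * h 0 a \<le> B * (t - a) ^ Suc n / fact (Suc n) - c * h 0 t"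
    proof (rule DERIV_nonneg_imp_increasing_open[of a t "\<lambda>s. B * (s - a) ^ Suc n / fact (Suc n) - c * h 0 s"])
      show "a \<le> t" using Suc.prems by simp
      show "continuous_on {a..t} (\<lambda>s. B * (s - a) ^ Suc n / fact (Suc n) - c * h 0 s)"
        using Suc.prems(5) by (intro continuous_intros continuous_on_subset[OF Suc.prems(1)]) auto
      fix s assume s: "a < s" "s < t"
      have "((\<lambda>s. s - a) has_real_derivative 1) (at s)"
        by (auto intro!: derivative_eq_intros)
      from DERIV_power_Suc[OF this, of n]
      have "((\<lambda>s. (s - a) ^ Suc n) has_real_derivative real (Suc n) * (s - a) ^ n) (at s)"
        by (simp only: of_nat_Suc mult_1)
      from DERIV_cdivide[OF DERIV_cmult[OF this, of B], of "fact (Suc n)"]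
      moreover have "B * (real (Suc n) * (s - a) ^ n) / fact (Suc n) = B * (s - a) ^ n / fact n"
        by (simp add: fact_Suc del: of_nat_Suc)
      ultimately have "((\<lambda>s. B * (s - a) ^ Suc n / fact (Suc n)) has_real_derivative B * (s - a) ^ n / fact n) (at s)"
        by (simp only:)
      moreover have "((\<lambda>s. c * h 0 s) has_real_derivative c * h 1 s) (at s)"
        using Suc.prems(2)[of s 0] s Suc.prems(5) by (intro DERIV_cmult) auto
      ultimately have "((\<lambda>s. B * (s - a) ^ Suc n / fact (Suc n) - c * h 0 s) has_real_derivative
          B * (s - a) ^ n / fact n - c * h 1 s) (at s)"
        by (rule DERIV_diff)
      moreover have "c * h 1 s \<le> B * (s - a) ^ n / fact n"
        using bd[of s] s Suc.prems(5) that abs_ge_self[of "c * h 1 s"] by (simp add: abs_mult)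
      ultimately show "\<exists>y. ((\<lambda>s. B * (s - a) ^ Suc n / fact (Suc n) - c * h 0 s) has_real_derivative y) (at s) \<and> 0 \<le> y"
        by (intro exI conjI) auto
    qed
    then show ?thesis using Suc.prems(3) by simp
  qed
  from *[of 1] *[of "-1"] show ?case by (auto simp: abs_le_iff)
qed

lemma fact_add_le: "fact (k + n) \<le> (2 ^ (k + n) * fact k * fact n :: real)"
proof -
  have "(k + n) choose k \<le> 2 ^ (k + n)" by (rule binomial_le_pow2)
  then have "real ((k + n) choose k) * (fact k * fact n) \<le> 2 ^ (k + n) * (fact k * fact n)"
    by (intro mult_right_mono) (auto simp flip: of_nat_le_iff)
  moreover have "real ((k + n) choose k) * (fact k * fact n) = fact (k + n)"
    by (simp add: binomial_fact)
  ultimately show ?thesis by (simp add: mult.assoc)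
qed

text \<open>Taylor's estimate of order n, with (k + n)! split by \<open>fact_add_le\<close>, leaves
  the factor (2 L (t - a))^n. The step 1 / (4 (L + 1)) makes its base at most 1/2, also when L = 0,
  and n tends to infinity.\<close>

lemma analytic_family_zero_step:
  fixes h :: "nat \<Rightarrow> real \<Rightarrow> real"
  assumes cont: "\<And>k. continuous_on {a..b} (h k)"
    and der: "\<And>k t. a < t \<Longrightarrow> t < b \<Longrightarrow> (h k has_real_derivative h (Suc k) t) (at t)"
    and bd: "\<And>k t. t \<in> {a..b} \<Longrightarrow> \<bar>h k t\<bar> \<le> C * L ^ k * fact k" and L: "L \<ge> 0"
    and zero: "\<And>k. h k a = 0" and t: "t \<in> {a..b}" "t \<le> a + 1 / (4 * (L + 1))"
  shows "h k t = 0"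
proof -
  have C: "C \<ge> 0" using order_trans[OF abs_ge_zero bd[OF t(1), of 0]] by simp
  have *: "(C * L ^ (k + n) * (2 ^ (k + n) * F * N)) * u ^ n / N = C * (2 * L) ^ k * F * (2 * L * u) ^ n"
    if "N \<noteq> 0" for F N u :: real and n
    using that by (simp add: power_mult_distrib power_add)
  have "\<bar>h k t\<bar> \<le> C * (2 * L) ^ k * fact k * (1/2) ^ n" for n
  proof -
    have "\<bar>h (k + 0) t\<bar> \<le> (C * L ^ (k + n) * fact (k + n)) * (t - a) ^ n / fact n"
      by (rule iterated_derivative_bound[of a b "\<lambda>j. h (k + j)"]) (use cont der bd zero t in auto)
    also have "\<dots> \<le> (C * L ^ (k + n) * (2 ^ (k + n) * fact k * fact n)) * (t - a) ^ n / fact n"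
      using C L t by (intro divide_right_mono mult_right_mono mult_left_mono fact_add_le) auto
    also have "\<dots> = C * (2 * L) ^ k * fact k * (2 * L * (t - a)) ^ n"
      by (rule *) simp
    also have "\<dots> \<le> C * (2 * L) ^ k * fact k * (1/2) ^ n"
    proof (intro mult_left_mono power_mono)
      have "2 * L * (t - a) \<le> 2 * L * (1 / (4 * (L + 1)))"
        using L t by (intro mult_left_mono) auto
      also have "\<dots> \<le> 1/2" using L by (simp add: field_simps)
      finally show "2 * L * (t - a) \<le> 1/2" .
    qed (use C L t in auto)
    finally show ?thesis by simp
  qed
  moreover have "(\<lambda>n. C * (2 * L) ^ k * fact k * (1/2) ^ n) \<longlonglongrightarrow> C * (2 * L) ^ k * fact k * 0"
    by (intro tendsto_intros LIMSEQ_realpow_zero) auto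
  ultimately have "\<bar>h k t\<bar> \<le> C * (2 * L) ^ k * fact k * 0"
    by (intro LIMSEQ_le_const) auto
  then show ?thesis by simp
qed

text \<open>The step length depends on L alone, so finitely many steps cover the interval. All
  members of the family are treated together, because each step starts from the vanishing of all
  derivatives.\<close>

lemma analytic_family_zero:
  fixes h :: "nat \<Rightarrow> real \<Rightarrow> real"
  assumes cont: "\<And>k. continuous_on {a..b} (h k)"
    and der: "\<And>k t. a < t \<Longrightarrow> t < b \<Longrightarrow> (h k has_real_derivative h (Suc k) t) (at t)"
    and bd: "\<And>k t. t \<in> {a..b} \<Longrightarrow> \<bar>h k t\<bar> \<le> C * L ^ k * fact k" and L: "L \<ge> 0"
    and zero: "\<And>k. h k a = 0" and t: "t \<in> {a..b}"
  shows "h k t = 0"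
proof -
  define \<delta> where "\<delta> = 1 / (4 * (L + 1))"
  have \<delta>: "\<delta> > 0" using L by (simp add: \<delta>_def)
  have "\<forall>t\<in>{a..b}. t \<le> a + real N * \<delta> \<longrightarrow> (\<forall>k. h k t = 0)" for N
  proof (induction N)
    case 0
    then show ?case using zero by auto
  next
    case (Suc N)
    show ?case
    proof (intro ballI impI allI)
      fix t k assume t: "t \<in> {a..b}" "t \<le> a + real (Suc N) * \<delta>"
      show "h k t = 0"
      proof (cases "t \<le> a + real N * \<delta>")
        case True
        then show ?thesis using Suc t by blast
      next
        case False
        define c where "c = a + real N * \<delta>"
        have c: "a \<le> c" "c \<le> t" using False \<delta> by (auto simp: c_def)
        show ?thesis
        proof (rule analytic_family_zero_step[of c b h C L])
          show "continuous_on {c..b} (h k)" for k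
            using c by (intro continuous_on_subset[OF cont]) auto
          show "h k c = 0" for k using Suc c t by (auto simp: c_def)
          show "t \<le> c + 1 / (4 * (L + 1))"
            using t(2) unfolding c_def \<delta>_def[symmetric] by (simp add: distrib_right)
        qed (use c t der bd L in auto)
      qed
    qed
  qed
  moreover obtain N where "(t - a) / \<delta> < real N" using reals_Archimedean2 by blast
  then have "t \<le> a + real N * \<delta>" using \<delta> by (simp add: field_simps)
  ultimately show ?thesis using t by blast
qed

lemma analytic_family_zero_vector:
  fixes h :: "nat \<Rightarrow> real \<Rightarrow> 'b::euclidean_space"
  assumes cont: "\<And>k. continuous_on {a..b} (h k)"
    and der: "\<And>k t. a < t \<Longrightarrow> t < b \<Longrightarrow> (h k has_vector_derivative h (Suc k) t) (at t)"
    and bd: "\<And>k t. t \<in> {a..b} \<Longrightarrow> norm (h k t) \<le> C * L ^ k * fact k" and L: "L \<ge> 0"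
    and zero: "\<And>k. h k a = 0" and t: "t \<in> {a..b}"
  shows "h k t = 0"
proof (rule euclidean_eqI)
  fix i :: 'b assume i: "i \<in> Basis"
  have "h k t \<bullet> i = 0"
  proof (rule analytic_family_zero[where h = "\<lambda>k t. h k t \<bullet> i" and C = C and L = L])
    show "((\<lambda>t. h k t \<bullet> i) has_real_derivative h (Suc k) t \<bullet> i) (at t)" if "a < t" "t < b" for k t
      using bounded_linear.has_vector_derivative[OF bounded_linear_inner_left der[OF that]]
      by (simp add: has_real_derivative_iff_has_vector_derivative)
    show "\<bar>h k t \<bullet> i\<bar> \<le> C * L ^ k * fact k" if "t \<in> {a..b}" for k t
      using bd[OF that, of k] Basis_le_norm[OF i, of "h k t"] by linarith
  qed (use t zero L cont in \<open>auto intro!: continuous_intros\<close>)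
  then show "h k t \<bullet> i = 0 \<bullet> i" by simp
qed

text \<open>Summation by parts against the tails \<open>R\<close> shows that the difference is (1 -
  x) times a power series with coefficients tending to 0. That series is split at an index N beyond
  which the tails are below \<epsilon> / 2.\<close>

theorem abel_limit:
  fixes a :: "nat \<Rightarrow> real"
  assumes "summable a"
  shows "((\<lambda>x. \<Sum>n. a n * x ^ n) \<longlongrightarrow> suminf a) (at_left 1)"
proof -
  define R where "R n = (\<Sum>k. a (k + n))" for n
  have R_lim: "R \<longlonglongrightarrow> 0" unfolding R_def using suminf_exist_split2[OF assms] by simp
  have a_eq: "a n = R n - R (Suc n)" for n
    using suminf_split_head[of "\<lambda>k. a (k + n)"] assms by (simp add: R_def summable_iff_shift)
  obtain B where B: "B > 0" "\<And>n. \<bar>R n\<bar> \<le> B"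
    using R_lim convergent_imp_Bseq[of R] by (auto simp: convergent_def Bseq_def)
  have eq: "(\<Sum>n. a n * x ^ n) - suminf a = - (1 - x) * (\<Sum>n. R (Suc n) * x ^ n)"
    and summ: "summable (\<lambda>n. \<bar>R (Suc n)\<bar> * x ^ n)" if x: "0 < x" "x < 1" for x
  proof -
    have geo: "summable (\<lambda>n. B * x ^ n)" using x by (intro summable_mult summable_geometric) auto
    have *: "summable (\<lambda>n. \<bar>R (n + m)\<bar> * x ^ n)" for m
      using x B(2) by (intro summable_comparison_test'[OF geo, of 0]) (auto simp: abs_mult intro!: mult_right_mono)
    then show "summable (\<lambda>n. \<bar>R (Suc n)\<bar> * x ^ n)" using *[of 1] by simp
    have **: "summable (\<lambda>n. R (n + m) * x ^ n)" for m
    proof (rule summable_rabs_cancel)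
      have "(\<lambda>n. \<bar>R (n + m) * x ^ n\<bar>) = (\<lambda>n. \<bar>R (n + m)\<bar> * x ^ n)"
        using x by (simp add: abs_mult fun_eq_iff)
      then show "summable (\<lambda>n. \<bar>R (n + m) * x ^ n\<bar>)" using *[of m] by (simp only:)
    qed
    have s0: "summable (\<lambda>n. R n * x ^ n)" and s1: "summable (\<lambda>n. R (Suc n) * x ^ n)"
      using **[of 0] **[of 1] by simp_all
    have "(\<Sum>n. a n * x ^ n) = (\<Sum>n. R n * x ^ n) - (\<Sum>n. R (Suc n) * x ^ n)"
      using s0 s1 by (simp add: a_eq left_diff_distrib suminf_diff)
    moreover have "(\<Sum>n. R n * x ^ n) = R 0 + x * (\<Sum>n. R (Suc n) * x ^ n)"
      using suminf_split_head[OF s0] suminf_mult[OF s1, of x] by (simp add: mult_ac)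
    ultimately show "(\<Sum>n. a n * x ^ n) - suminf a = - (1 - x) * (\<Sum>n. R (Suc n) * x ^ n)"
      by (simp add: R_def algebra_simps)
  qed
  show ?thesis
  proof (rule tendstoI)
    fix \<epsilon> :: real assume \<epsilon>: "\<epsilon> > 0"
    obtain N where N: "\<And>n. n \<ge> N \<Longrightarrow> \<bar>R n\<bar> < \<epsilon> / 2"
      using LIMSEQ_D[OF R_lim, of "\<epsilon> / 2"] \<epsilon> by auto
    \<comment> \<open>The terms before N contribute at most (1 - x) N B, which becomes less than
      \<epsilon> / 2 through 1 - x < \<epsilon> / (2 (N B + 1)); adding 1 covers N = 0.\<close>
    have NB: "real N * B + 1 > 0" using B by (simp add: add_nonneg_pos)
    have "\<forall>\<^sub>F x in at_left 1. x \<in> {max 0 (1 - \<epsilon> / (2 * (real N * B + 1)))<..<1::real}"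
      using \<epsilon> NB by (intro eventually_at_left_real) simp
    then show "\<forall>\<^sub>F x in at_left 1. dist (\<Sum>n. a n * x ^ n) (suminf a) < \<epsilon>"
    proof eventually_elim
      case (elim x)
      have x: "0 < x" "x < 1" "1 - x < \<epsilon> / (2 * (real N * B + 1))" using elim by auto
      have fin: "(\<lambda>n. if n < N then B else 0) sums (real N * B)"
        using sums_If_finite_set[of "{..<N}" "\<lambda>_. B"] by simp
      have geo: "(\<lambda>n. \<epsilon> / 2 * x ^ n) sums (\<epsilon> / 2 * (1 / (1 - x)))"
        using x by (intro sums_mult geometric_sums) auto
      have "\<bar>\<Sum>n. R (Suc n) * x ^ n\<bar> \<le> (\<Sum>n. \<bar>R (Suc n)\<bar> * x ^ n)"
        using summable_rabs[of "\<lambda>n. R (Suc n) * x ^ n"] summ[OF x(1,2)] x by (simp add: abs_mult)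
      also have "\<dots> \<le> (\<Sum>n. (if n < N then B else 0) + \<epsilon> / 2 * x ^ n)"
      proof (rule suminf_le[OF _ summ[OF x(1,2)]])
        show "summable (\<lambda>n. (if n < N then B else 0) + \<epsilon> / 2 * x ^ n)"
          using sums_add[OF fin geo] by (rule sums_summable)
        fix n
        show "\<bar>R (Suc n)\<bar> * x ^ n \<le> (if n < N then B else 0) + \<epsilon> / 2 * x ^ n"
        proof (cases "n < N")
          case True
          have "\<bar>R (Suc n)\<bar> * x ^ n \<le> B * 1"
            using B x by (intro mult_mono power_le_one) auto
          then show ?thesis using True \<epsilon> x by (simp add: add_increasing2)
        next
          case False
          then show ?thesis using N[of "Suc n"] x by (auto intro!: mult_right_mono)
        qed
      qed
      also have "\<dots> = real N * B + \<epsilon> / 2 * (1 / (1 - x))"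
        using sums_unique[OF sums_add[OF fin geo]] by simp
      finally have "(1 - x) * \<bar>\<Sum>n. R (Suc n) * x ^ n\<bar> \<le> (1 - x) * (real N * B + \<epsilon> / 2 * (1 / (1 - x)))"
        using x by (intro mult_left_mono) auto
      also have "\<dots> = (1 - x) * (real N * B) + \<epsilon> / 2" using x by (simp add: field_simps)
      also have "\<dots> < \<epsilon>"
      proof -
        have "(1 - x) * (real N * B) \<le> (1 - x) * (real N * B + 1)" using x by simp
        also have "\<dots> < \<epsilon> / 2" using x(3) NB by (simp add: field_simps)
        finally show ?thesis by simp
      qed
      finally show ?case using eq[OF x(1,2)] x by (simp add: dist_real_def abs_mult)
    qed
  qed
qed

text \<open>Read in the variable \<open>\<rho> = r\<^sup>2\<close>, the operator \<open>(1/r) d/dr\<close> is \<open>2 d/d\<rho>\<close>, so that \<open>g\<close> is a family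
of iterated derivatives of a function that is analytic in \<open>\<rho>\<close>. Within the disc of convergence its
Taylor series is compared with it by the identity theorem, at the boundary point by Abel's.\<close>
lemma radial_family_sum_real:
  fixes g :: "nat \<Rightarrow> real \<Rightarrow> real"
  assumes r0: "r0 \<ge> 0" and cont: "\<And>k. continuous_on {0..r0} (g k)"
    and der: "\<And>k r. 0 < r \<Longrightarrow> r < r0 \<Longrightarrow> (g k has_real_derivative r * g (Suc k) r) (at r)"
    and bd: "\<And>k r. r \<in> {0..r0} \<Longrightarrow> \<bar>g k r\<bar> \<le> C * L ^ k * fact k" and L: "L \<ge> 0"
    and sm: "summable (\<lambda>k. g k 0 / (2 ^ k * fact k) * r0 ^ (2 * k))"
  shows "(\<Sum>k. g k 0 / (2 ^ k * fact k) * r0 ^ (2 * k)) = g 0 r0"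
proof (cases "r0 = 0")
  \<comment> \<open>At radius 0 only the term k = 0 survives, as 0 ^ 0 = 1.\<close>
  case True
  then have "(\<lambda>k. g k 0 / (2 ^ k * fact k) * r0 ^ (2 * k)) = (\<lambda>k. if k = 0 then g 0 0 else 0)"
    by (auto simp: fun_eq_iff)
  then show ?thesis using True sums_unique[OF sums_single[of 0 "\<lambda>_. g 0 0"]] by simp
next
  case False
  define \<rho>0 where "\<rho>0 = r0\<^sup>2"
  have \<rho>0: "\<rho>0 > 0" using False by (simp add: \<rho>0_def)
  have sqrt_le: "sqrt \<rho> \<le> r0" if "\<rho> \<le> \<rho>0" for \<rho>
    using real_sqrt_le_mono[OF that] r0 by (simp add: \<rho>0_def)
  define d where "d k = g k 0 / (2 ^ k * fact k)" for k
  define \<psi> where "\<psi> k \<rho> = g k (sqrt \<rho>) / 2 ^ k" for k \<rho>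
  have \<psi>_cont: "continuous_on {0..\<rho>0} (\<psi> k)" for k
    unfolding \<psi>_def using sqrt_le
    by (intro continuous_intros continuous_on_compose2[OF cont]) auto
  have \<psi>_der: "(\<psi> k has_real_derivative \<psi> (Suc k) \<rho>) (at \<rho>)" if "0 < \<rho>" "\<rho> < \<rho>0" for k \<rho>
  proof -
    have "sqrt \<rho> < r0" using that r0 by (metis \<rho>0_def real_sqrt_abs abs_of_nonneg real_sqrt_less_mono)
    with that have "(g k has_real_derivative sqrt \<rho> * g (Suc k) (sqrt \<rho>)) (at (sqrt \<rho>))"
      by (intro der) auto
    from DERIV_cdivide[OF DERIV_chain2[OF this DERIV_real_sqrt[OF that(1)]], of "2 ^ k"]
    show ?thesis using that by (simp add: \<psi>_def[abs_def] field_simps)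
  qed
  \<comment> \<open>The series is viewed on a complex disc, where Cauchy's inequality gives the
    factorial bounds on its derivatives that \<open>analytic_family_zero\<close> asks for.\<close>
  define f where "f = eval_fps (Abs_fps (\<lambda>n. complex_of_real (d n)))"
  have sm_d: "summable (\<lambda>n. d n * \<rho>0 ^ n)"
    using sm by (simp add: d_def \<rho>0_def power_mult)
  then have "summable (\<lambda>n. complex_of_real (d n * \<rho>0 ^ n))"
    by (simp only: summable_of_real_iff)
  then have "summable (\<lambda>n. fps_nth (Abs_fps (\<lambda>n. complex_of_real (d n))) n * complex_of_real \<rho>0 ^ n)"
    by simp
  then have "norm (complex_of_real \<rho>0) \<le> conv_radius (fps_nth (Abs_fps (\<lambda>n. complex_of_real (d n))))"
    by (rule conv_radius_geI)
  then have radius: "ereal \<rho>0 \<le> fps_conv_radius (Abs_fps (\<lambda>n. complex_of_real (d n)))"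
    using \<rho>0 by (simp add: fps_conv_radius_def)
  have holf: "f holomorphic_on ball 0 \<rho>0"
    unfolding f_def by (intro holomorphic_on_eval_fps) (auto simp: in_eball_iff intro!: less_le_trans[OF _ radius])
  have f_real: "f (complex_of_real \<rho>) = complex_of_real (\<Sum>n. d n * \<rho> ^ n)" if "0 \<le> \<rho>" "\<rho> < \<rho>0" for \<rho>
  proof -
    have "summable (\<lambda>n. d n * \<rho> ^ n)"
      using powser_inside[OF sm_d, of \<rho>] that by simp
    then show ?thesis by (simp add: f_def eval_fps_def suminf_of_real)
  qed
  define h where "h k \<rho> = Re ((deriv ^^ k) f (complex_of_real \<rho>))" for k \<rho>
  have h_der: "(h k has_real_derivative h (Suc k) \<rho>) (at \<rho>)" if "0 \<le> \<rho>" "\<rho> < \<rho>0" for k \<rho>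
  proof -
    have "(deriv ^^ k) f holomorphic_on ball 0 \<rho>0"
      by (intro holomorphic_higher_deriv holf) auto
    then have "((deriv ^^ k) f has_field_derivative (deriv ^^ Suc k) f (of_real \<rho>)) (at (of_real \<rho>))"
      using that by (auto intro!: holomorphic_derivI)
    then have "((\<lambda>x. (deriv ^^ k) f (of_real x)) has_vector_derivative (deriv ^^ Suc k) f (of_real \<rho>)) (at \<rho>)"
      by (rule has_vector_derivative_real_field)
    from has_field_derivative_Re[OF this] show ?thesis by (simp add: h_def[abs_def])
  qed
  have h_0: "h k 0 = \<psi> k 0" for k
  proof -
    have "fps_conv_radius (Abs_fps (\<lambda>n. complex_of_real (d n))) > 0"
      using radius \<rho>0 by (metis ereal_less(2) less_le_trans zero_ereal_def)
    from fps_nth_conv_deriv[OF this, of k] have "(deriv ^^ k) f 0 = fact k * of_real (d k)"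
      by (simp add: f_def field_simps)
    then show ?thesis by (simp add: h_def \<psi>_def d_def)
  qed
  have eq: "(\<Sum>n. d n * \<rho> ^ n) = \<psi> 0 \<rho>" if \<rho>: "0 < \<rho>" "\<rho> < \<rho>0" for \<rho>
  proof -
    \<comment> \<open>With half of the distance to the boundary as radius, all discs centred on the
      segment from 0 to \<rho> lie in one closed disc inside the disc of convergence.\<close>
    define e where "e = (\<rho>0 - \<rho>) / 2"
    have e: "e > 0" using \<rho> by (simp add: e_def)
    have sub: "cball (complex_of_real s) e \<subseteq> cball 0 ((\<rho>0 + \<rho>) / 2)" if "s \<in> {0..\<rho>}" for s
    proof
      fix z assume "z \<in> cball (complex_of_real s) e"
      then have "norm z \<le> s + e"
        using norm_triangle_ineq[of "complex_of_real s" "z - complex_of_real s"] that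
        by (simp add: dist_norm norm_minus_commute)
      then show "z \<in> cball 0 ((\<rho>0 + \<rho>) / 2)" using that by (simp add: e_def field_simps)
    qed
    have sub2: "cball 0 ((\<rho>0 + \<rho>) / 2) \<subseteq> ball (0::complex) \<rho>0" using \<rho> by auto
    have "compact (f ` cball 0 ((\<rho>0 + \<rho>) / 2))"
      by (intro compact_continuous_image holomorphic_on_imp_continuous_on holomorphic_on_subset[OF holf sub2]) auto
    then obtain B where B: "B > 0" "\<And>z. z \<in> cball 0 ((\<rho>0 + \<rho>) / 2) \<Longrightarrow> norm (f z) \<le> B"
      using compact_imp_bounded bounded_pos by (metis imageI)
    have C: "C \<ge> 0" using bd[of 0 0] r0 by auto
    have "\<psi> 0 \<rho> - h 0 \<rho> = 0"
    proof (rule analytic_family_zero[where h = "\<lambda>k t. \<psi> k t - h k t" and a = 0 and b = \<rho>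
          and C = "C + B" and L = "max L (1 / e)"])
      fix k
      have "continuous_on {0..\<rho>} (h k)"
        using h_der \<rho> by (intro continuous_at_imp_continuous_on) (auto intro!: DERIV_isCont[OF h_der])
      then show "continuous_on {0..\<rho>} (\<lambda>t. \<psi> k t - h k t)"
        using \<rho> by (intro continuous_intros continuous_on_subset[OF \<psi>_cont]) auto
      fix t assume t: "t \<in> {0..\<rho>}"
      have "\<bar>g k (sqrt t)\<bar> / 2 ^ k \<le> \<bar>g k (sqrt t)\<bar> / 1"
        by (intro divide_left_mono) auto
      also have "\<dots> \<le> C * L ^ k * fact k"
        using bd[of "sqrt t" k] sqrt_le[of t] t \<rho> by simp
      also have "\<dots> \<le> C * max L (1 / e) ^ k * fact k"
        using L C by (intro mult_right_mono mult_left_mono power_mono) auto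
      finally have 1: "\<bar>\<psi> k t\<bar> \<le> C * max L (1 / e) ^ k * fact k"
        by (simp add: \<psi>_def)
      have "\<bar>h k t\<bar> \<le> norm ((deriv ^^ k) f (complex_of_real t))"
        by (simp add: h_def abs_Re_le_cmod)
      also have "\<dots> \<le> fact k * B / e ^ k"
      proof (rule Cauchy_inequality)
        show "continuous_on (cball (complex_of_real t) e) f"
          using sub[OF t] sub2 by (intro holomorphic_on_imp_continuous_on holomorphic_on_subset[OF holf]) auto
        show "f holomorphic_on ball (complex_of_real t) e"
          using sub[OF t] sub2 ball_subset_cball by (intro holomorphic_on_subset[OF holf]) blast
        fix z assume "norm (complex_of_real t - z) = e"
        then have "z \<in> cball (complex_of_real t) e" by (simp add: dist_norm)
        then show "norm (f z) \<le> B" using sub[OF t] B by blast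
      qed (rule e)
      also have "\<dots> = B * (1 / e) ^ k * fact k" by (simp add: field_simps power_one_over)
      also have "\<dots> \<le> B * max L (1 / e) ^ k * fact k"
        using e B by (intro mult_right_mono mult_left_mono power_mono) auto
      finally have 2: "\<bar>h k t\<bar> \<le> B * max L (1 / e) ^ k * fact k" .
      have "\<bar>\<psi> k t - h k t\<bar> \<le> \<bar>\<psi> k t\<bar> + \<bar>h k t\<bar>" by (rule abs_triangle_ineq4)
      also have "\<dots> \<le> (C + B) * max L (1 / e) ^ k * fact k"
        using 1 2 by (simp add: distrib_right)
      finally show "\<bar>\<psi> k t - h k t\<bar> \<le> (C + B) * max L (1 / e) ^ k * fact k" .
    next
      fix k t assume "0 < t" "t < \<rho>"
      then show "((\<lambda>t. \<psi> k t - h k t) has_real_derivative \<psi> (Suc k) t - h (Suc k) t) (at t)"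
        using \<rho> by (intro DERIV_diff \<psi>_der h_der) auto
    qed (use h_0 L \<rho> in auto)
    moreover have "h 0 \<rho> = (\<Sum>n. d n * \<rho> ^ n)"
      using f_real[of \<rho>] \<rho> by (simp add: h_def)
    ultimately show ?thesis by simp
  qed
  have "((\<lambda>x. \<Sum>n. d n * \<rho>0 ^ n * x ^ n) \<longlongrightarrow> (\<Sum>n. d n * \<rho>0 ^ n)) (at_left 1)"
    by (rule abel_limit[OF sm_d])
  moreover have "\<forall>\<^sub>F x in at_left 1. (\<Sum>n. d n * \<rho>0 ^ n * x ^ n) = \<psi> 0 (\<rho>0 * x)"
  proof -
    have "\<forall>\<^sub>F x in at_left 1. x \<in> {0<..<1::real}"
      by (rule eventually_at_left_real) simp
    then show ?thesis
    proof eventually_elim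
      case (elim x)
      then show ?case using eq[of "\<rho>0 * x"] \<rho>0 by (simp add: power_mult_distrib mult_ac)
    qed
  qed
  ultimately have lim1: "((\<lambda>x. \<psi> 0 (\<rho>0 * x)) \<longlongrightarrow> (\<Sum>n. d n * \<rho>0 ^ n)) (at_left 1)"
    by (rule Lim_transform_eventually)
  have "continuous_on {0..1} (\<lambda>x. \<psi> 0 (\<rho>0 * x))"
    using \<rho>0 by (intro continuous_on_compose2[OF \<psi>_cont] continuous_intros) (auto simp: mult_left_le)
  then have "((\<lambda>x. \<psi> 0 (\<rho>0 * x)) \<longlongrightarrow> \<psi> 0 (\<rho>0 * 1)) (at_left 1)"
    using continuous_on_Icc_at_leftD[of 0 1 "\<lambda>x. \<psi> 0 (\<rho>0 * x)"] by simp
  then have "(\<Sum>n. d n * \<rho>0 ^ n) = \<psi> 0 (\<rho>0 * 1)"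
    using tendsto_unique[OF _ lim1] by simp
  then show ?thesis using r0 by (simp add: d_def \<psi>_def \<rho>0_def power_mult)
qed

theorem radial_family_sum:
  fixes g :: "nat \<Rightarrow> real \<Rightarrow> 'b::euclidean_space"
  assumes r0: "r0 \<ge> 0" and cont: "\<And>k. continuous_on {0..r0} (g k)"
    and der: "\<And>k r. 0 < r \<Longrightarrow> r < r0 \<Longrightarrow> (g k has_vector_derivative r *\<^sub>R g (Suc k) r) (at r)"
    and bd: "\<And>k r. r \<in> {0..r0} \<Longrightarrow> norm (g k r) \<le> C * L ^ k * fact k" and L: "L \<ge> 0"
    and sm: "summable (\<lambda>k. (r0 ^ (2 * k) / (2 ^ k * fact k)) *\<^sub>R g k 0)"
  shows "(\<Sum>k. (r0 ^ (2 * k) / (2 ^ k * fact k)) *\<^sub>R g k 0) = g 0 r0"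
proof (rule euclidean_eqI)
  fix i :: 'b assume i: "i \<in> Basis"
  have *: "(\<lambda>k. g k 0 \<bullet> i / (2 ^ k * fact k) * r0 ^ (2 * k)) =
     (\<lambda>k. ((r0 ^ (2 * k) / (2 ^ k * fact k)) *\<^sub>R g k 0) \<bullet> i)"
    by (simp add: fun_eq_iff)
  have "(\<Sum>k. (r0 ^ (2 * k) / (2 ^ k * fact k)) *\<^sub>R g k 0) \<bullet> i =
      (\<Sum>k. ((r0 ^ (2 * k) / (2 ^ k * fact k)) *\<^sub>R g k 0) \<bullet> i)"
    using bounded_linear.suminf[OF bounded_linear_inner_left sm] by simp
  also have "\<dots> = (\<Sum>k. g k 0 \<bullet> i / (2 ^ k * fact k) * r0 ^ (2 * k))" by (simp only: *)
  also have "\<dots> = g 0 r0 \<bullet> i"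
  proof (rule radial_family_sum_real[where g = "\<lambda>k r. g k r \<bullet> i" and C = C and L = L])
    show "((\<lambda>r. g k r \<bullet> i) has_real_derivative r * (g (Suc k) r \<bullet> i)) (at r)" if "0 < r" "r < r0" for k r
      using bounded_linear.has_vector_derivative[OF bounded_linear_inner_left[of i] der[OF that]]
      by (simp add: has_real_derivative_iff_has_vector_derivative)
    show "\<bar>g k r \<bullet> i\<bar> \<le> C * L ^ k * fact k" if "r \<in> {0..r0}" for k r
      using bd[OF that, of k] Basis_le_norm[OF i, of "g k r"] by linarith
    show "summable (\<lambda>k. g k 0 \<bullet> i / (2 ^ k * fact k) * r0 ^ (2 * k))"
      unfolding * by (rule bounded_linear.summable[OF bounded_linear_inner_left sm])
  qed (use r0 L cont in \<open>auto intro!: continuous_intros\<close>)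
  finally show "(\<Sum>k. (r0 ^ (2 * k) / (2 ^ k * fact k)) *\<^sub>R g k 0) \<bullet> i = g 0 r0 \<bullet> i" .
qed

subsection \<open>Radial averages\<close>

lemma open_line:
  fixes S :: "'c::real_normed_vector set"
  assumes "open S"
  shows "open {t::real. x + t *\<^sub>R u \<in> S}"
proof -
  have "open ((\<lambda>t. x + t *\<^sub>R u) -` S)"
    by (intro open_vimage assms continuous_intros)
  then show ?thesis by (simp add: vimage_def)
qed

lemma dderiv_cong:
  assumes "open S" "x \<in> S" "\<And>y. y \<in> S \<Longrightarrow> F y = G y"
  shows "dderiv F u x = dderiv G u x"
proof -
  have "\<forall>\<^sub>F t in nhds (0 :: real). t \<in> {t. x + t *\<^sub>R u \<in> S}"
    using assms(2) by (intro eventually_nhds_in_open open_line assms(1)) simp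
  then have "\<forall>\<^sub>F t in nhds (0 :: real). F (x + t *\<^sub>R u) = G (x + t *\<^sub>R u)"
    by eventually_elim (simp add: assms)
  then show ?thesis
    unfolding dderiv_def by (intro vector_derivative_cong_eq) (auto elim: eventually_mono)
qed

text \<open>This is (2n - 1)!!. Its factors 2i + 1 are the reciprocals of the integrals of s^(2i)
  over [0, 1], the weights of the averages \<open>Jop\<close>.\<close>

definition odd_fact :: "nat \<Rightarrow> real" where
  "odd_fact n = (\<Prod>i<n. 2 * real i + 1)"

lemma odd_fact_0 [simp]: "odd_fact 0 = 1"
  and odd_fact_Suc: "odd_fact (Suc n) = (2 * real n + 1) * odd_fact n"
  by (simp_all add: odd_fact_def mult.commute)

lemma odd_fact_pos: "odd_fact n > 0"
  by (induction n) (simp_all add: odd_fact_Suc)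

lemma odd_fact_add_ge: "odd_fact k \<le> odd_fact (k + i)"
proof (induction i)
  case (Suc i)
  have "1 * odd_fact (k + i) \<le> (2 * real (k + i) + 1) * odd_fact (k + i)"
    using odd_fact_pos[of "k + i"] by (intro mult_right_mono) auto
  with Suc show ?case by (simp add: odd_fact_Suc)
qed simp

text \<open>(2k)! = (2k)!! (2k - 1)!!. Dividing by the second factor leaves only k!, which is how 2k
  radial derivatives come to be bounded like k derivatives in r^2.\<close>

lemma fact_double: "fact (2 * k) = (2 ^ k * fact k * odd_fact k :: real)"
proof (induction k)
  case (Suc k)
  have "fact (2 * Suc k) = ((2 * real k + 2) * (2 * real k + 1) * fact (2 * k) :: real)"
    by (simp add: algebra_simps)
  then show ?case using Suc by (simp add: odd_fact_Suc algebra_simps)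
qed simp

abbreviation Dr :: "('c::euclidean_space \<times> real \<Rightarrow> 'b::euclidean_space) \<Rightarrow> 'c \<times> real \<Rightarrow> 'b" where
  "Dr H \<equiv> dderiv H (0, 1)"

abbreviation Dz :: "'c::euclidean_space \<Rightarrow> ('c \<times> real \<Rightarrow> 'b::euclidean_space) \<Rightarrow> 'c \<times> real \<Rightarrow> 'b" where
  "Dz b H \<equiv> dderiv H (b, 0)"

definition Drr :: "nat \<Rightarrow> ('c::euclidean_space \<times> real \<Rightarrow> 'b::euclidean_space) \<Rightarrow> 'c \<times> real \<Rightarrow> 'b" where
  "Drr k H = ((\<lambda>H. Dr (Dr H)) ^^ k) H"

lemma Drr_0 [simp]: "Drr 0 H = H" and Drr_Suc: "Drr (Suc k) H = Dr (Dr (Drr k H))"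
  by (simp_all add: Drr_def)

lemma Drr_funpow: "Drr k H = ((\<lambda>H. Dr H) ^^ (2 * k)) H"
  by (induction k) (simp_all add: Drr_Suc)

text \<open>For even \<open>H\<close> these averages express iterates of \<open>(1/r) d/dr\<close> without division by \<open>r\<close>:
\<open>((1/r) d/dr)\<^sup>n H\<close> is \<open>Jop n\<close> of the derivative of \<open>H\<close> of order \<open>2n\<close>.\<close>
primrec Jop :: "nat \<Rightarrow> ('c::euclidean_space \<times> real \<Rightarrow> 'b::euclidean_space) \<Rightarrow> 'c \<times> real \<Rightarrow> 'b" where
  "Jop 0 H = H"
| "Jop (Suc n) H = (\<lambda>x. integral {0..1} (\<lambda>s. s ^ (2 * n) *\<^sub>R Jop n H (fst x, s * snd x)))"

text \<open>For even H this is ((1/r) d/dr)^k applied to \<open>Jop i H\<close>. The case i = 0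
  serves for \<alpha>, and i = 1 for the quotient \<beta> / r, which is \<open>Jop 1\<close> of
  \<open>Dp \<alpha>\<close>.\<close>

definition fam :: "nat \<Rightarrow> ('c::euclidean_space \<times> real \<Rightarrow> 'b::euclidean_space) \<Rightarrow> nat \<Rightarrow> 'c \<times> real \<Rightarrow> 'b" where
  "fam i H k = Jop (k + i) (Drr k H)"

section \<open>Radial averages on a cylinder symmetric in r\<close>

locale cylinder =
  fixes B :: "'c::euclidean_space set" and R :: real
  assumes open_B: "open B" and R_pos: "R > 0"
begin

definition U :: "('c \<times> real) set" where "U = B \<times> {-R<..<R}"

lemma open_U: "open U" by (simp add: U_def open_Times open_B)

lemma mem_U [simp]: "(z, r) \<in> U \<longleftrightarrow> z \<in> B \<and> \<bar>r\<bar> < R"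
  by (auto simp: U_def)

text \<open>The segment from (z, 0) to (z, r) stays in the cylinder, so \<open>Jop\<close> at a
  point of \<open>U\<close> reads values in \<open>U\<close> only.\<close>

lemma scale_lt: "\<bar>r\<bar> < R \<Longrightarrow> s \<in> {0..1} \<Longrightarrow> \<bar>s * r\<bar> < R"
  using mult_left_le_one_le[of "\<bar>r\<bar>" s] by (auto simp: abs_mult)

lemma mvp_Dr: "mvp U H \<Longrightarrow> mvp U (Dr H)" and mvp_Dz: "mvp U H \<Longrightarrow> mvp U (Dz b H)"
  by (simp_all add: mvp_dderiv_mvp open_U)

lemma mvp_Drr: "mvp U H \<Longrightarrow> mvp U (Drr k H)"
  by (induction k) (simp_all add: Drr_Suc mvp_Dr)

lemma line_z:
  assumes "mvp U H" "z + t *\<^sub>R b \<in> B" "\<bar>r\<bar> < R"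
  shows "((\<lambda>t. H (z + t *\<^sub>R b, r)) has_vector_derivative Dz b H (z + t *\<^sub>R b, r)) (at t within S)"
  using dderiv_line[OF mvp_differentiable[OF open_U assms(1)], of "(z, r)" t "(b, 0)" S] assms(2,3) by simp

lemma line_r:
  assumes "mvp U H" "z \<in> B" "\<bar>r\<bar> < R"
  shows "((\<lambda>r. H (z, r)) has_vector_derivative Dr H (z, r)) (at r within S)"
  using dderiv_line[OF mvp_differentiable[OF open_U assms(1)], of "(z, 0)" r "(0, 1)" S] assms(2,3) by simp

lemma continuous_on_Jop:
  assumes "continuous_on U H"
  shows "continuous_on U (Jop n H)"
proof (induction n)
  case (Suc n)
  have "continuous_on (U \<times> cbox 0 1) (\<lambda>x. snd x ^ (2 * n) *\<^sub>R Jop n H (fst (fst x), snd x * snd (fst x)))"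
    using scale_lt by (intro continuous_intros continuous_on_compose2[OF Suc]) auto
  then have "continuous_on U (\<lambda>x. integral (cbox 0 1) (\<lambda>s. s ^ (2 * n) *\<^sub>R Jop n H (fst x, s * snd x)))"
    by (intro integral_continuous_on_param) (simp add: case_prod_beta')
  then show ?case by simp
qed (simp add: assms)

lemma continuous_on_Jop_segment:
  assumes "continuous_on U H" "z \<in> B" "\<bar>r\<bar> < R"
  shows "continuous_on {0..1} (\<lambda>s. Jop n H (z, s * r))"
  using assms(2,3) scale_lt
  by (intro continuous_on_compose2[OF continuous_on_Jop[OF assms(1)]] continuous_intros) auto

lemma integrable_Jop:
  assumes "continuous_on U H" "z \<in> B" "\<bar>r\<bar> < R"
  shows "(\<lambda>s. s ^ m *\<^sub>R Jop n H (z, s * r)) integrable_on {0..1}"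
  by (intro integrable_continuous_real continuous_intros continuous_on_Jop_segment assms)

lemma Jop_cong:
  assumes "\<And>x. x \<in> U \<Longrightarrow> F x = G x" "x \<in> U"
  shows "Jop n F x = Jop n G x"
  using assms(2)
proof (induction n arbitrary: x)
  case (Suc n)
  obtain z r where x: "x = (z, r)" by fastforce
  show ?case
    unfolding x Jop.simps fst_conv snd_conv
    using Suc scale_lt by (intro Henstock_Kurzweil_Integration.integral_cong) (auto simp: x)
qed (simp add: assms)

lemma Jop_linear:
  assumes "continuous_on U F" "linear L" "x \<in> U"
  shows "Jop n (\<lambda>x. L (F x)) x = L (Jop n F x)"
  using assms(3)
proof (induction n arbitrary: x)
  case (Suc n)
  interpret L: bounded_linear L using assms(2) by (simp add: linear_linear)
  obtain z r where x: "x = (z, r)" by fastforce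
  have "integral {0..1} (\<lambda>s. s ^ (2 * n) *\<^sub>R Jop n (\<lambda>x. L (F x)) (z, s * r)) =
      integral {0..1} (\<lambda>s. L (s ^ (2 * n) *\<^sub>R Jop n F (z, s * r)))"
    using Suc scale_lt by (intro Henstock_Kurzweil_Integration.integral_cong) (auto simp: x L.scaleR)
  also have "\<dots> = L (integral {0..1} (\<lambda>s. s ^ (2 * n) *\<^sub>R Jop n F (z, s * r)))"
    using integral_linear[OF integrable_Jop[OF assms(1), of z r "2 * n" n] L.bounded_linear_axioms] Suc.prems
    by (simp add: x o_def)
  finally show ?case by (simp add: x)
qed simp

lemma Jop_sum:
  assumes "finite I" "\<And>i. i \<in> I \<Longrightarrow> continuous_on U (F i)" "x \<in> U"
  shows "Jop n (\<lambda>x. \<Sum>i\<in>I. F i x) x = (\<Sum>i\<in>I. Jop n (F i) x)"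
  using assms(3)
proof (induction n arbitrary: x)
  case (Suc n)
  obtain z r where x: "x = (z, r)" by fastforce
  have "integral {0..1} (\<lambda>s. s ^ (2 * n) *\<^sub>R Jop n (\<lambda>x. \<Sum>i\<in>I. F i x) (z, s * r)) =
      integral {0..1} (\<lambda>s. \<Sum>i\<in>I. s ^ (2 * n) *\<^sub>R Jop n (F i) (z, s * r))"
    using Suc scale_lt by (intro Henstock_Kurzweil_Integration.integral_cong) (auto simp: x scaleR_sum_right)
  also have "\<dots> = (\<Sum>i\<in>I. integral {0..1} (\<lambda>s. s ^ (2 * n) *\<^sub>R Jop n (F i) (z, s * r)))"
    using assms(1,2) Suc.prems by (intro Henstock_Kurzweil_Integration.integral_sum integrable_Jop) (auto simp: x)
  finally show ?case by (simp add: x)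
qed simp

lemma Jop_line_z:
  assumes H: "mvp U H" and "z + t *\<^sub>R b \<in> B" "\<bar>r\<bar> < R"
  shows "((\<lambda>t. Jop n H (z + t *\<^sub>R b, r)) has_vector_derivative Jop n (Dz b H) (z + t *\<^sub>R b, r)) (at t within S)"
  using assms(2,3)
proof (induction n arbitrary: t r S)
  case 0
  then show ?case by (simp add: line_z[OF H])
next
  case (Suc n)
  obtain d where d: "d > 0" "\<And>t'. t' \<in> ball t d \<Longrightarrow> z + t' *\<^sub>R b \<in> B"
    using open_line[OF open_B, of z b] Suc.prems(1) unfolding open_contains_ball by blast
  have "((\<lambda>t. integral (cbox 0 1) (\<lambda>s. s ^ (2 * n) *\<^sub>R Jop n H (z + t *\<^sub>R b, s * r))) has_vector_derivative
     integral (cbox 0 1) (\<lambda>s. s ^ (2 * n) *\<^sub>R Jop n (Dz b H) (z + t *\<^sub>R b, s * r))) (at t within ball t d)"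
  proof (rule leibniz_rule_vector_derivative)
    fix t' s :: real assume *: "t' \<in> ball t d" "s \<in> cbox 0 1"
    have "((\<lambda>t. Jop n H (z + t *\<^sub>R b, s * r)) has_vector_derivative
        Jop n (Dz b H) (z + t' *\<^sub>R b, s * r)) (at t' within ball t d)"
      using * d Suc.prems scale_lt by (intro Suc.IH) auto
    from has_vector_derivative_scaleR[OF DERIV_const this, of "s ^ (2 * n)"]
    show "((\<lambda>t. s ^ (2 * n) *\<^sub>R Jop n H (z + t *\<^sub>R b, s * r)) has_vector_derivative
        s ^ (2 * n) *\<^sub>R Jop n (Dz b H) (z + t' *\<^sub>R b, s * r)) (at t' within ball t d)" by simp
  next
    fix t' assume "t' \<in> ball t d"
    then show "(\<lambda>s. s ^ (2 * n) *\<^sub>R Jop n H (z + t' *\<^sub>R b, s * r)) integrable_on cbox 0 1"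
      using integrable_Jop[OF mvp_imp_continuous_on[OF H]] d Suc.prems by simp
  next
    have "continuous_on (ball t d \<times> cbox 0 1)
       (\<lambda>x. snd x ^ (2 * n) *\<^sub>R Jop n (Dz b H) (z + fst x *\<^sub>R b, snd x * r))"
      using d Suc.prems scale_lt
      by (intro continuous_intros continuous_on_compose2[OF continuous_on_Jop[OF mvp_imp_continuous_on[OF mvp_Dz[OF H]]]])
         auto
    then show "continuous_on (ball t d \<times> cbox 0 1)
       (\<lambda>(t, s). s ^ (2 * n) *\<^sub>R Jop n (Dz b H) (z + t *\<^sub>R b, s * r))"
      by (simp add: case_prod_beta')
  qed (use d in auto)
  then have "((\<lambda>t. Jop (Suc n) H (z + t *\<^sub>R b, r)) has_vector_derivative Jop (Suc n) (Dz b H) (z + t *\<^sub>R b, r)) (at t)"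
    using d by (simp add: at_within_open[of t "ball t d"])
  then show ?case by (rule has_vector_derivative_at_within)
qed

text \<open>Applied with c = 1 and then c = -1: the radial derivative of an even function is odd,
  and that of an odd one is even.\<close>

lemma Dr_reflect:
  assumes H: "mvp U H" and ref: "\<And>z r. (z, r) \<in> U \<Longrightarrow> H (z, - r) = c *\<^sub>R H (z, r)" and zr: "(z, r) \<in> U"
  shows "Dr H (z, - r) = (- c) *\<^sub>R Dr H (z, r)"
proof -
  have "((\<lambda>r. H (z, r)) has_vector_derivative Dr H (z, - r)) (at (- r))"
    using zr by (intro line_r H) auto
  moreover have "((\<lambda>r. c *\<^sub>R H (z, - r)) has_vector_derivative (- c) *\<^sub>R Dr H (z, r)) (at (- r))"
  proof -
    have "((\<lambda>r. H (z, r)) has_vector_derivative Dr H (z, r)) (at (- (- r)))"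
      using line_r[OF H, of z r UNIV] zr by simp
    moreover have "((\<lambda>r::real. - r) has_real_derivative - 1) (at (- r))"
      by (auto intro!: derivative_eq_intros)
    ultimately have "((\<lambda>r. H (z, - r)) has_vector_derivative - 1 *\<^sub>R Dr H (z, r)) (at (- r))"
      using vector_diff_chain_at[of uminus "- 1" "- r" "\<lambda>r. H (z, r)"]
      by (simp add: has_real_derivative_iff_has_vector_derivative o_def)
    from has_vector_derivative_scaleR[OF DERIV_const this, of c] show ?thesis by simp
  qed
  then have "((\<lambda>r. H (z, r)) has_vector_derivative (- c) *\<^sub>R Dr H (z, r)) (at (- r))"
  proof (rule has_vector_derivative_transform_within_open)
    fix r' assume "r' \<in> {-R<..<R}"
    then show "c *\<^sub>R H (z, - r') = H (z, r')" using ref[of z "- r'"] zr by (auto simp: abs_less_iff)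
  qed (use zr in auto)
  ultimately show ?thesis by (rule vector_derivative_unique_at)
qed

definition even_r :: "('c \<times> real \<Rightarrow> 'b::euclidean_space) \<Rightarrow> bool" where
  "even_r H \<longleftrightarrow> (\<forall>z r. (z, r) \<in> U \<longrightarrow> H (z, - r) = H (z, r))"

lemma Dr_even_0:
  assumes "mvp U H" "even_r H" "z \<in> B"
  shows "Dr H (z, 0) = 0"
proof -
  have "Dr H (z, - 0) = (- 1) *\<^sub>R Dr H (z, 0)"
    by (rule Dr_reflect[OF assms(1)]) (use assms R_pos in \<open>auto simp: even_r_def\<close>)
  then show ?thesis by (simp add: eq_neg_iff_add_eq_0 flip: scaleR_2)
qed

lemma even_r_DrDr:
  assumes "mvp U H" "even_r H"
  shows "even_r (Dr (Dr H))"
proof -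
  have "Dr H (z, - r) = (- 1) *\<^sub>R Dr H (z, r)" if "(z, r) \<in> U" for z r
    by (rule Dr_reflect[OF assms(1) _ that]) (use assms in \<open>auto simp: even_r_def\<close>)
  from Dr_reflect[OF mvp_Dr[OF assms(1)] this] show ?thesis
    by (simp add: even_r_def)
qed

lemma even_r_Drr: "mvp U H \<Longrightarrow> even_r H \<Longrightarrow> even_r (Drr k H)"
  by (induction k) (simp_all add: Drr_Suc even_r_DrDr mvp_Drr)

lemma even_r_Dz:
  assumes "mvp U H" "even_r H"
  shows "even_r (Dz b H)"
  unfolding even_r_def
proof (intro allI impI)
  fix z r assume zr: "(z, r) \<in> U"
  have "((\<lambda>t. H (z + t *\<^sub>R b, r)) has_vector_derivative Dz b H (z, r)) (at 0)"
    using line_z[OF assms(1), of z 0 b r UNIV] zr by simp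
  then have "((\<lambda>t. H (z + t *\<^sub>R b, - r)) has_vector_derivative Dz b H (z, r)) (at 0)"
    by (rule has_vector_derivative_transform_within_open[of _ _ _ "{t. z + t *\<^sub>R b \<in> B}"])
      (use assms zr open_line[OF open_B] in \<open>auto simp: even_r_def\<close>)
  moreover have "((\<lambda>t. H (z + t *\<^sub>R b, - r)) has_vector_derivative Dz b H (z, - r)) (at 0)"
    using line_z[OF assms(1), of z 0 b "- r" UNIV] zr by simp
  ultimately show "Dz b H (z, - r) = Dz b H (z, r)" by (rule vector_derivative_unique_at[symmetric])
qed

text \<open>For n = 0, \<open>Dr H\<close> vanishes at r = 0 by evenness, so it is r times the mean
  of \<open>Dr (Dr H)\<close> over the segment. For the next n, the chain rule brings a factor s and
  the induction hypothesis a factor s r; the resulting s^2 raises the weight s^(2n) to the weight of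
  the following average. This dictates the weights in \<open>Jop\<close>.\<close>

lemma Jop_line_r:
  assumes H: "mvp U H" "even_r H" and "z \<in> B" "\<bar>r\<bar> < R"
  shows "((\<lambda>r. Jop n H (z, r)) has_vector_derivative r *\<^sub>R Jop (Suc n) (Dr (Dr H)) (z, r)) (at r within S)"
  using assms(4)
proof (induction n arbitrary: r S)
  case 0
  have "((\<lambda>s. r *\<^sub>R Dr (Dr H) (z, s * r)) has_integral (Dr H (z, 1 * r) - Dr H (z, 0 * r))) {0..1}"
  proof (rule fundamental_theorem_of_calculus)
    fix s :: real assume s: "s \<in> {0..1}"
    have "((\<lambda>s. s * r) has_vector_derivative r) (at s within {0..1})"
      by (auto intro!: derivative_eq_intros simp flip: has_real_derivative_iff_has_vector_derivative)
    moreover have "((\<lambda>r. Dr H (z, r)) has_vector_derivative Dr (Dr H) (z, s * r)) (at (s * r) within (\<lambda>s. s * r) ` {0..1})"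
      using assms(3) scale_lt[OF 0 s] by (intro line_r mvp_Dr H)
    ultimately show "((\<lambda>s. Dr H (z, s * r)) has_vector_derivative r *\<^sub>R Dr (Dr H) (z, s * r)) (at s within {0..1})"
      using vector_diff_chain_within[of "\<lambda>s. s * r" r s "{0..1}" "\<lambda>r. Dr H (z, r)"] by (simp add: o_def)
  qed simp
  then have "integral {0..1} (\<lambda>s. r *\<^sub>R Dr (Dr H) (z, s * r)) = Dr H (z, 1 * r) - Dr H (z, 0 * r)"
    by (rule integral_unique)
  then have "r *\<^sub>R Jop 1 (Dr (Dr H)) (z, r) = Dr H (z, r)"
    using Dr_even_0[OF H assms(3)] by simp
  then show ?case using line_r[OF H(1) assms(3) 0] by simp
next
  case (Suc n)
  define d where "d = R - \<bar>r\<bar>"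
  have d: "d > 0" "\<And>r'. r' \<in> ball r d \<Longrightarrow> \<bar>r'\<bar> < R"
    using Suc.prems by (auto simp: d_def dist_real_def)
  have 2: "mvp U (Dr (Dr H))" by (intro mvp_Dr H)
  have "((\<lambda>r. integral (cbox 0 1) (\<lambda>s. s ^ (2 * n) *\<^sub>R Jop n H (z, s * r))) has_vector_derivative
     integral (cbox 0 1) (\<lambda>s. (r * s ^ (2 * Suc n)) *\<^sub>R Jop (Suc n) (Dr (Dr H)) (z, s * r))) (at r within ball r d)"
  proof (rule leibniz_rule_vector_derivative)
    fix r' s :: real assume *: "r' \<in> ball r d" "s \<in> cbox 0 1"
    then have s: "s \<in> {0..1}" by simp
    have "((\<lambda>r. s * r) has_vector_derivative s) (at r' within ball r d)"
      by (auto intro!: derivative_eq_intros simp flip: has_real_derivative_iff_has_vector_derivative)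
    moreover have "((\<lambda>r. Jop n H (z, r)) has_vector_derivative (s * r') *\<^sub>R Jop (Suc n) (Dr (Dr H)) (z, s * r')) (at (s * r') within (\<lambda>r. s * r) ` ball r d)"
      using scale_lt[OF d(2)[OF *(1)] s] by (rule Suc.IH)
    ultimately have "((\<lambda>r. Jop n H (z, s * r)) has_vector_derivative
        s *\<^sub>R (s * r') *\<^sub>R Jop (Suc n) (Dr (Dr H)) (z, s * r')) (at r' within ball r d)"
      using vector_diff_chain_within[of "\<lambda>r. s * r" s r' "ball r d" "\<lambda>r. Jop n H (z, r)"]
      by (simp only: o_def)
    from has_vector_derivative_scaleR[OF DERIV_const this, of "s ^ (2 * n)"]
    show "((\<lambda>r. s ^ (2 * n) *\<^sub>R Jop n H (z, s * r)) has_vector_derivative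
        (r' * s ^ (2 * Suc n)) *\<^sub>R Jop (Suc n) (Dr (Dr H)) (z, s * r')) (at r' within ball r d)"
      by (simp add: power2_eq_square mult_ac del: Jop.simps)
  next
    fix r' assume "r' \<in> ball r d"
    then show "(\<lambda>s. s ^ (2 * n) *\<^sub>R Jop n H (z, s * r')) integrable_on cbox 0 1"
      using integrable_Jop[OF mvp_imp_continuous_on[OF H(1)] assms(3) d(2)] by simp
  next
    have "continuous_on (ball r d \<times> cbox 0 1)
       (\<lambda>x. (fst x * snd x ^ (2 * Suc n)) *\<^sub>R Jop (Suc n) (Dr (Dr H)) (z, snd x * fst x))"
      using d assms(3) scale_lt
      by (intro continuous_intros continuous_on_compose2[OF continuous_on_Jop[OF mvp_imp_continuous_on[OF 2]]])
         auto
    then show "continuous_on (ball r d \<times> cbox 0 1)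
       (\<lambda>(r, s). (r * s ^ (2 * Suc n)) *\<^sub>R Jop (Suc n) (Dr (Dr H)) (z, s * r))"
      by (simp add: case_prod_beta' del: Jop.simps)
  qed (use d in auto)
  then have *: "((\<lambda>r. Jop (Suc n) H (z, r)) has_vector_derivative
     integral {0..1} (\<lambda>s. r *\<^sub>R s ^ (2 * Suc n) *\<^sub>R Jop (Suc n) (Dr (Dr H)) (z, s * r))) (at r)"
    using d by (simp add: at_within_open[of r "ball r d"])
  have "integral {0..1} (\<lambda>s. r *\<^sub>R s ^ (2 * Suc n) *\<^sub>R Jop (Suc n) (Dr (Dr H)) (z, s * r)) =
      r *\<^sub>R Jop (Suc (Suc n)) (Dr (Dr H)) (z, r)"
    unfolding Jop.simps(2)[of "Suc n"] fst_conv snd_conv by (rule integral_cmul)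
  from *[unfolded this] show ?case by (rule has_vector_derivative_at_within)
qed

text \<open>The s-derivative of s^(2n + 1) \<open>Jop n H (z, s * r)\<close> is integrated over
  [0, 1]; the boundary term at 0 vanishes. With J = \<open>Jop (Suc n) H\<close> and E = (1/r) d/dr
  this reads r^2 E J + (2n + 1) J = \<open>Jop n H\<close>.\<close>

lemma Jop_recurrence:
  assumes H: "mvp U H" "even_r H" and zr: "(z, r) \<in> U"
  shows "r\<^sup>2 *\<^sub>R Jop (Suc (Suc n)) (Dr (Dr H)) (z, r) + (2 * real n + 1) *\<^sub>R Jop (Suc n) H (z, r) = Jop n H (z, r)"
proof -
  let ?f = "\<lambda>s. s ^ (2 * n) *\<^sub>R Jop n H (z, s * r)"
  let ?g = "\<lambda>s. s ^ (2 * Suc n) *\<^sub>R Jop (Suc n) (Dr (Dr H)) (z, s * r)"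
  have zr': "z \<in> B" "\<bar>r\<bar> < R" using zr by auto
  have "((\<lambda>s. r\<^sup>2 *\<^sub>R ?g s + (2 * real n + 1) *\<^sub>R ?f s) has_integral
      (1 ^ (2 * n + 1) *\<^sub>R Jop n H (z, 1 * r) - 0 ^ (2 * n + 1) *\<^sub>R Jop n H (z, 0 * r))) {0..1}"
  proof (rule fundamental_theorem_of_calculus)
    fix s :: real assume s: "s \<in> {0..1}"
    have "((\<lambda>s. s * r) has_vector_derivative r) (at s within {0..1})"
      by (auto intro!: derivative_eq_intros simp flip: has_real_derivative_iff_has_vector_derivative)
    moreover have "((\<lambda>r. Jop n H (z, r)) has_vector_derivative (s * r) *\<^sub>R Jop (Suc n) (Dr (Dr H)) (z, s * r)) (at (s * r) within (\<lambda>s. s * r) ` {0..1})"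
      using zr' scale_lt[OF zr'(2) s] by (intro Jop_line_r H)
    ultimately have "((\<lambda>s. Jop n H (z, s * r)) has_vector_derivative r *\<^sub>R (s * r) *\<^sub>R Jop (Suc n) (Dr (Dr H)) (z, s * r)) (at s within {0..1})"
      using vector_diff_chain_within[of "\<lambda>s. s * r" r s "{0..1}" "\<lambda>r. Jop n H (z, r)"] by (simp only: o_def)
    moreover have "((\<lambda>s. s ^ (2 * n + 1)) has_real_derivative (2 * real n + 1) * s ^ (2 * n)) (at s within {0..1})"
      using DERIV_power_Suc[OF DERIV_ident, where n = "2 * n"] by (simp add: add.commute)
    ultimately have "((\<lambda>s. s ^ (2 * n + 1) *\<^sub>R Jop n H (z, s * r)) has_vector_derivative
       s ^ (2 * n + 1) *\<^sub>R r *\<^sub>R (s * r) *\<^sub>R Jop (Suc n) (Dr (Dr H)) (z, s * r) +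
       ((2 * real n + 1) * s ^ (2 * n)) *\<^sub>R Jop n H (z, s * r)) (at s within {0..1})"
      by (intro has_vector_derivative_scaleR)
    then show "((\<lambda>s. s ^ (2 * n + 1) *\<^sub>R Jop n H (z, s * r)) has_vector_derivative
       r\<^sup>2 *\<^sub>R ?g s + (2 * real n + 1) *\<^sub>R ?f s) (at s within {0..1})"
      by (simp add: power2_eq_square mult_ac del: Jop.simps)
  qed simp
  then have "Jop n H (z, r) = integral {0..1} (\<lambda>s. r\<^sup>2 *\<^sub>R ?g s + (2 * real n + 1) *\<^sub>R ?f s)"
    by (simp add: integral_unique del: Jop.simps)
  also have "\<dots> = integral {0..1} (\<lambda>s. r\<^sup>2 *\<^sub>R ?g s) + integral {0..1} (\<lambda>s. (2 * real n + 1) *\<^sub>R ?f s)"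
    by (intro Henstock_Kurzweil_Integration.integral_add integrable_cmul integrable_Jop zr' mvp_imp_continuous_on mvp_Dr H)
  also have "\<dots> = r\<^sup>2 *\<^sub>R integral {0..1} ?g + (2 * real n + 1) *\<^sub>R integral {0..1} ?f"
    by (simp only: integral_cmul)
  also have "integral {0..1} ?g = Jop (Suc (Suc n)) (Dr (Dr H)) (z, r)"
    unfolding Jop.simps(2)[of "Suc n"] by simp
  also have "integral {0..1} ?f = Jop (Suc n) H (z, r)"
    by simp
  finally show ?thesis by (rule sym)
qed

text \<open>At r = 0 the first term of the recurrence disappears, so each average divides by 2n + 1.
  The odd double factorials of the series originate here.\<close>

lemma Jop_at_0:
  assumes H: "mvp U H" "even_r H" and z: "z \<in> B"
  shows "odd_fact n *\<^sub>R Jop n H (z, 0) = H (z, 0)"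
proof (induction n)
  case (Suc n)
  have "(2 * real n + 1) *\<^sub>R Jop (Suc n) H (z, 0) = Jop n H (z, 0)"
    using Jop_recurrence[OF H, of z 0 n] z R_pos by (simp del: Jop.simps)
  then have "odd_fact (Suc n) *\<^sub>R Jop (Suc n) H (z, 0) = odd_fact n *\<^sub>R Jop n H (z, 0)"
    by (metis odd_fact_Suc mult.commute scaleR_scaleR)
  with Suc show ?case by simp
qed simp

lemma norm_Jop_le:
  assumes H: "continuous_on U H" and zr: "z \<in> B" "\<bar>r\<bar> < R" and M: "\<And>r'. \<bar>r'\<bar> \<le> \<bar>r\<bar> \<Longrightarrow> norm (H (z, r')) \<le> M"
  shows "norm (Jop n H (z, r)) \<le> M / odd_fact n"
  using zr(2) M
proof (induction n arbitrary: r)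
  case (Suc n)
  have "norm (integral {0..1} (\<lambda>s. s ^ (2 * n) *\<^sub>R Jop n H (z, s * r))) \<le> integral {0..1} (\<lambda>s. s ^ (2 * n) * (M / odd_fact n))"
  proof (rule integral_norm_bound_integral)
    show "(\<lambda>s. s ^ (2 * n) *\<^sub>R Jop n H (z, s * r)) integrable_on {0..1}"
      by (intro integrable_Jop H zr(1) Suc.prems(1))
    show "(\<lambda>s. s ^ (2 * n) * (M / odd_fact n)) integrable_on {0..1}"
      by (intro integrable_continuous_real continuous_intros)
    fix s :: real assume s: "s \<in> {0..1}"
    have "norm (Jop n H (z, s * r)) \<le> M / odd_fact n"
    proof (rule Suc.IH[OF scale_lt[OF Suc.prems(1) s]])
      fix r' assume "\<bar>r'\<bar> \<le> \<bar>s * r\<bar>"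
      also have "\<dots> \<le> \<bar>r\<bar>" using s mult_left_le_one_le[of "\<bar>r\<bar>" s] by (auto simp: abs_mult)
      finally show "norm (H (z, r')) \<le> M" by (rule Suc.prems(2))
    qed
    then show "norm (s ^ (2 * n) *\<^sub>R Jop n H (z, s * r)) \<le> s ^ (2 * n) * (M / odd_fact n)"
      using s by (simp add: mult_left_mono del: times_divide_eq_right)
  qed
  also have "integral {0..1} (\<lambda>s. s ^ (2 * n) * (M / odd_fact n)) = M / odd_fact (Suc n)"
  proof -
    have "((\<lambda>s. s ^ (2 * n) * (M / odd_fact n)) has_integral
        (1 ^ (2 * n + 1) * (M / odd_fact (Suc n)) - 0 ^ (2 * n + 1) * (M / odd_fact (Suc n)))) {0..1::real}"
    proof (rule fundamental_theorem_of_calculus)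
      fix s :: real assume "s \<in> {0..1}"
      have "((\<lambda>s. s ^ (2 * n + 1)) has_real_derivative (2 * real n + 1) * s ^ (2 * n)) (at s within {0..1})"
        using DERIV_power_Suc[OF DERIV_ident, where n = "2 * n"] by (simp add: add.commute)
      from DERIV_cmult_right[OF this, of "M / odd_fact (Suc n)"]
      show "((\<lambda>s. s ^ (2 * n + 1) * (M / odd_fact (Suc n))) has_vector_derivative s ^ (2 * n) * (M / odd_fact n)) (at s within {0..1})"
        using odd_fact_pos[of n]
        by (simp add: odd_fact_Suc add_nonneg_eq_0_iff flip: has_real_derivative_iff_has_vector_derivative)
    qed simp
    from integral_unique[OF this] show ?thesis by (simp only: power_one) simp
  qed
  finally show ?case by simp
qed simp

lemma Drr_Dz:
  assumes H: "mvp U H" and "x \<in> U"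
  shows "Drr k (Dz b H) x = Dz b (Drr k H) x"
  using assms(2)
proof (induction k arbitrary: x)
  case (Suc k)
  have 1: "mvp U (Drr k H)" by (rule mvp_Drr[OF H])
  have "Dr (Drr k (Dz b H)) x = Dz b (Dr (Drr k H)) x" if "x \<in> U" for x
  proof -
    have "Dr (Drr k (Dz b H)) x = Dr (Dz b (Drr k H)) x"
      using that Suc.IH by (rule dderiv_cong[OF open_U])
    then show ?thesis using mvp_dderiv_commute[OF open_U 1 that] by simp
  qed
  with Suc.prems have "Dr (Dr (Drr k (Dz b H))) x = Dr (Dz b (Dr (Drr k H))) x"
    by (rule dderiv_cong[OF open_U])
  then show ?case
    using mvp_dderiv_commute[OF open_U mvp_Dr[OF 1] Suc.prems] by (simp add: Drr_Suc)
qed simp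

lemma continuous_on_fam: "mvp U H \<Longrightarrow> continuous_on U (fam i H k)"
  unfolding fam_def by (intro continuous_on_Jop mvp_imp_continuous_on mvp_Drr)

lemma fam_line_z:
  assumes H: "mvp U H" and "z + t *\<^sub>R b \<in> B" "\<bar>r\<bar> < R"
  shows "((\<lambda>t. fam i H k (z + t *\<^sub>R b, r)) has_vector_derivative fam i (Dz b H) k (z + t *\<^sub>R b, r)) (at t within S)"
proof -
  have "fam i (Dz b H) k (z + t *\<^sub>R b, r) = Jop (k + i) (Dz b (Drr k H)) (z + t *\<^sub>R b, r)"
    unfolding fam_def using assms by (intro Jop_cong Drr_Dz) auto
  then show ?thesis
    using Jop_line_z[OF mvp_Drr[OF H] assms(2,3)] by (simp add: fam_def)
qed

lemma fam_line_r:
  assumes "mvp U H" "even_r H" "z \<in> B" "\<bar>r\<bar> < R"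
  shows "((\<lambda>r. fam i H k (z, r)) has_vector_derivative r *\<^sub>R fam i H (Suc k) (z, r)) (at r within S)"
  using Jop_line_r[OF mvp_Drr even_r_Drr, OF assms(1,1,2,3,4)] by (simp add: fam_def Drr_Suc del: Jop.simps)

lemma fam_recurrence:
  assumes "mvp U H" "even_r H" "(z, r) \<in> U"
  shows "r\<^sup>2 *\<^sub>R fam i H (Suc (Suc k)) (z, r) + (2 * real (k + i) + 1) *\<^sub>R fam i H (Suc k) (z, r) =
    Jop (k + i) (Drr (Suc k) H) (z, r)"
  using Jop_recurrence[OF mvp_Drr even_r_Drr, OF assms(1,1,2,3), of "k + i" "Suc k"]
  unfolding fam_def Drr_Suc[of "Suc k"] by (simp del: Jop.simps)

lemma fam_at_0:
  assumes "mvp U H" "even_r H" "z \<in> B"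
  shows "odd_fact (k + i) *\<^sub>R fam i H k (z, 0) = Drr k H (z, 0)"
  unfolding fam_def by (intro Jop_at_0 mvp_Drr even_r_Drr assms)

text \<open>The 2k radial derivatives grow like (2k)!, but the nested averages divide by at least
  \<open>odd_fact k\<close>; by \<open>fact_double\<close> growth of order k! remains, as
  analyticity in r^2 requires.\<close>

lemma fam_bound:
  assumes H: "mvp U H" and z: "z \<in> B" and r0: "\<bar>r0\<bar> < R"
  obtains C L where "C \<ge> 0" "L \<ge> 0" "\<And>k r. \<bar>r\<bar> \<le> \<bar>r0\<bar> \<Longrightarrow> norm (fam i H k (z, r)) \<le> C * L ^ k * fact k"
proof -
  have "compact ({z} \<times> {- \<bar>r0\<bar>..\<bar>r0\<bar>})" "{z} \<times> {- \<bar>r0\<bar>..\<bar>r0\<bar>} \<subseteq> U"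
    using z r0 by (auto intro!: compact_Times)
  then obtain C L where CL: "C \<ge> 0" "L \<ge> 0"
    "\<And>x k. x \<in> {z} \<times> {- \<bar>r0\<bar>..\<bar>r0\<bar>} \<Longrightarrow> norm (((\<lambda>H. Dr H) ^^ k) H x) \<le> C * L ^ k * fact k"
    using mvp_derivatives_factorial_bound[OF open_U H] by metis
  show thesis
  proof (rule that[of C "2 * L\<^sup>2"])
    fix k r assume r: "\<bar>r\<bar> \<le> \<bar>r0\<bar>"
    have "norm (fam i H k (z, r)) \<le> (C * L ^ (2 * k) * fact (2 * k)) / odd_fact (k + i)"
      unfolding fam_def
    proof (rule norm_Jop_le)
      fix r' assume "\<bar>r'\<bar> \<le> \<bar>r\<bar>"
      then show "norm (Drr k H (z, r')) \<le> C * L ^ (2 * k) * fact (2 * k)"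
        unfolding Drr_funpow using r by (intro CL(3)) auto
    qed (use z r r0 in \<open>auto intro!: mvp_imp_continuous_on mvp_Drr H\<close>)
    also have "\<dots> \<le> (C * L ^ (2 * k) * fact (2 * k)) / odd_fact k"
      using CL odd_fact_pos[of k] odd_fact_pos[of "k + i"] odd_fact_add_ge[of k i]
      by (intro divide_left_mono) auto
    also have "\<dots> = C * (2 * L\<^sup>2) ^ k * fact k"
      using odd_fact_pos[of k] by (simp add: fact_double power_mult power_mult_distrib)
    finally show "norm (fam i H k (z, r)) \<le> C * (2 * L\<^sup>2) ^ k * fact k" .
  qed (use CL in auto)
qed

end

subsection \<open>Monogenic functions on slices\<close>

lemma dderiv_add:
  assumes "F differentiable (at x)" "G differentiable (at x)"
  shows "dderiv (\<lambda>x. F x + G x) u x = dderiv F u x + dderiv G u x"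
proof -
  obtain F' G' where "(F has_derivative F') (at x)" "(G has_derivative G') (at x)"
    using assms unfolding differentiable_def by blast
  note d = this
  show ?thesis
    using dderiv_eq[OF d(1), of u] dderiv_eq[OF d(2), of u] dderiv_eq[OF has_derivative_add[OF d], of u] by simp
qed

lemma dderiv_linear:
  assumes "F differentiable (at x)" "linear (L :: 'b::euclidean_space \<Rightarrow> 'd::real_normed_vector)"
  shows "dderiv (\<lambda>x. L (F x)) u x = L (dderiv F u x)"
proof -
  obtain F' where F': "(F has_derivative F') (at x)"
    using assms(1) unfolding differentiable_def by blast
  have "bounded_linear L" using assms(2) by (simp add: linear_conv_bounded_linear)
  from dderiv_eq[OF bounded_linear.has_derivative[OF this F'], of u] dderiv_eq[OF F', of u]
  show ?thesis by simp
qed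

lemma dderiv_const [simp]: "dderiv (\<lambda>x. c) u x = 0"
  by (intro dderiv_eqI) simp

lemma dderiv_sum:
  assumes "finite I" "\<And>i. i \<in> I \<Longrightarrow> F i differentiable (at x)"
  shows "dderiv (\<lambda>x. \<Sum>i\<in>I. F i x) u x = (\<Sum>i\<in>I. dderiv (F i) u x)"
  using assms
proof (induction I rule: finite_induct)
  case (insert i I)
  have "dderiv (\<lambda>x. F i x + (\<Sum>i\<in>I. F i x)) u x = dderiv (F i) u x + dderiv (\<lambda>x. \<Sum>i\<in>I. F i x) u x"
    using insert by (intro dderiv_add differentiable_sum) auto
  then show ?case using insert by simp
qed simp

section \<open>Left multiplications in an alternative algebra\<close>

locale alt_algebra =
  fixes mul :: "'a::euclidean_space \<Rightarrow> 'a \<Rightarrow> 'a" and e :: 'a and cj :: "'a \<Rightarrow> 'a"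
    and v :: "nat \<Rightarrow> 'a" and m p :: nat
  assumes alg: "real_alt_algebra mul e cj" and basis: "adapted_basis mul e cj v m" and pm: "p < m"
begin

lemma bilinear_mul: "bilinear mul" using alg by (simp add: real_alt_algebra_def)

lemma linear_mul: "linear (mul x)" using bilinear_mul by (simp add: bilinear_def)

lemma linear_mul_left: "linear (\<lambda>x. mul x y)" using bilinear_mul by (simp add: bilinear_def)

lemmas mul_add = linear_add[OF linear_mul] and mul_scaleR = linear_scale[OF linear_mul]
  and mul_minus = linear_neg[OF linear_mul] and mul_sum = linear_sum[OF linear_mul]
  and mul_diff = linear_diff[OF linear_mul] and mul_0 = linear_0[OF linear_mul]
  and mul_add_left = linear_add[OF linear_mul_left] and mul_scaleR_left = linear_scale[OF linear_mul_left]
  and mul_minus_left = linear_neg[OF linear_mul_left] and mul_sum_left = linear_sum[OF linear_mul_left]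
  and mul_0_left = linear_0[OF linear_mul_left]

lemma mul_e: "mul e a = a" using alg by (simp add: real_alt_algebra_def)

lemma mul_v0: "mul (v 0) a = a" using basis mul_e by (simp add: adapted_basis_def)

lemma alt_left: "mul a (mul a b) = mul (mul a a) b"
  using alg by (simp add: real_alt_algebra_def assoc3_def)

text \<open>Linearization of the left alternative law in its repeated argument. If a and b
  anticommute, the right-hand side is 0, so the operators \<open>mul a\<close> and
  \<open>mul b\<close> anticommute as well; this replaces associativity.\<close>

lemma alt_left_polarized: "mul a (mul b c) + mul b (mul a c) = mul (mul a b + mul b a) c"
  using alt_left[of "a + b" c] alt_left[of a c] alt_left[of b c]
  by (simp add: mul_add mul_add_left add_ac)

lemma mul_v_v: "s \<in> {1..m} \<Longrightarrow> mul (v s) (v s) = - e"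
proof -
  assume "s \<in> {1..m}"
  then have "v s \<in> sphereA mul e cj" using basis by (simp add: adapted_basis_def)
  then have "cj (v s) = - v s" "mul (v s) (cj (v s)) = e"
    by (auto simp: sphereA_def trA_def nA_def add_eq_0_iff)
  then show ?thesis by (metis mul_minus minus_minus)
qed

lemma mul_v_v_mul: "s \<in> {1..m} \<Longrightarrow> mul (v s) (mul (v s) a) = - a"
  by (simp add: alt_left mul_v_v mul_minus_left mul_e)

lemma mul_v_anti:
  assumes "s \<in> {1..m}" "t \<in> {1..m}" "s \<noteq> t"
  shows "mul (v s) (mul (v t) a) = - mul (v t) (mul (v s) a)"
proof -
  have "mul (v s) (v t) = - mul (v t) (v s)"
    using basis assms unfolding adapted_basis_def by blast
  then have 0: "mul (v s) (v t) + mul (v t) (v s) = 0" by simp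
  from alt_left_polarized[of "v s" "v t" a, unfolded 0 mul_0_left]
  show ?thesis by (simp only: eq_neg_iff_add_eq_0)
qed

text \<open>A double sum sees only the symmetric part of its terms; this turns Clifford relations
  into sums of squares.\<close>

lemma sum_symmetrize:
  fixes F :: "nat \<Rightarrow> nat \<Rightarrow> 'a"
  assumes "\<And>s t. s \<in> I \<Longrightarrow> t \<in> I \<Longrightarrow> F s t + F t s = (if s = t then 2 *\<^sub>R d s else 0)" "finite I"
  shows "(\<Sum>s\<in>I. \<Sum>t\<in>I. F s t) = (\<Sum>s\<in>I. d s)"
proof -
  have "2 *\<^sub>R (\<Sum>s\<in>I. \<Sum>t\<in>I. F s t) = (\<Sum>s\<in>I. \<Sum>t\<in>I. F s t) + (\<Sum>s\<in>I. \<Sum>t\<in>I. F t s)"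
    by (subst (2) sum.swap) (simp add: scaleR_2)
  also have "\<dots> = (\<Sum>s\<in>I. \<Sum>t\<in>I. if s = t then 2 *\<^sub>R d s else 0)"
    unfolding sum.distrib[symmetric] by (intro sum.cong refl assms)
  also have "\<dots> = 2 *\<^sub>R (\<Sum>s\<in>I. d s)"
    using assms(2) by (simp add: scaleR_sum_right)
  finally show ?thesis by simp
qed

lemma mul_vec_sq:
  assumes "I \<subseteq> {1..m}"
  shows "mul (\<Sum>s\<in>I. c s *\<^sub>R v s) (mul (\<Sum>s\<in>I. c s *\<^sub>R v s) a) = - (\<Sum>s\<in>I. (c s)\<^sup>2) *\<^sub>R a"
proof -
  have fin: "finite I" using assms finite_subset by blast
  have "mul (\<Sum>s\<in>I. c s *\<^sub>R v s) (mul (\<Sum>s\<in>I. c s *\<^sub>R v s) a) =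
      (\<Sum>s\<in>I. \<Sum>t\<in>I. c s *\<^sub>R c t *\<^sub>R mul (v s) (mul (v t) a))"
    by (subst sum.swap) (simp add: mul_sum_left mul_scaleR_left mul_sum mul_scaleR scaleR_sum_right mult.commute)
  also have "\<dots> = (\<Sum>s\<in>I. - ((c s)\<^sup>2 *\<^sub>R a))"
  proof (rule sum_symmetrize[OF _ fin])
    fix s t assume "s \<in> I" "t \<in> I"
    with assms have st: "s \<in> {1..m}" "t \<in> {1..m}" by auto
    show "c s *\<^sub>R c t *\<^sub>R mul (v s) (mul (v t) a) + c t *\<^sub>R c s *\<^sub>R mul (v t) (mul (v s) a) =
        (if s = t then 2 *\<^sub>R - ((c s)\<^sup>2 *\<^sub>R a) else 0)"
    proof (cases "s = t")
      case True
      then have "c s *\<^sub>R c t *\<^sub>R mul (v s) (mul (v t) a) = - ((c s)\<^sup>2 *\<^sub>R a)"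
        "c t *\<^sub>R c s *\<^sub>R mul (v t) (mul (v s) a) = - ((c s)\<^sup>2 *\<^sub>R a)"
        using mul_v_v_mul[OF st(1), of a] by (simp_all add: power2_eq_square)
      then show ?thesis using True by (simp only: if_True scaleR_2 refl)
    next
      case False
      then show ?thesis using mul_v_anti[OF st False, of a] by (simp add: mult.commute)
    qed
  qed
  also have "\<dots> = - (\<Sum>s\<in>I. (c s)\<^sup>2) *\<^sub>R a"
    by (simp add: scaleR_sum_left sum_negf)
  finally show ?thesis .
qed

lemma mul_vec_anti:
  assumes "s \<in> {1..p}"
  shows "mul (v s) (mul (\<Sum>t\<in>{Suc p..m}. c t *\<^sub>R v t) a) = - mul (\<Sum>t\<in>{Suc p..m}. c t *\<^sub>R v t) (mul (v s) a)"
proof -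
  have "mul (v s) (mul (v t) a) = - mul (v t) (mul (v s) a)" if "t \<in> {Suc p..m}" for t
    using that assms pm by (intro mul_v_anti) auto
  then show ?thesis
    by (simp add: mul_sum_left mul_scaleR_left mul_sum mul_scaleR flip: sum_negf)
qed

lemma sphS_sq: "\<omega> \<in> sphS v m p \<Longrightarrow> mul \<omega> (mul \<omega> a) = - a"
  using mul_vec_sq[of "{Suc p..m}"] by (auto simp: sphS_def)

lemma sphS_anti: "\<omega> \<in> sphS v m p \<Longrightarrow> s \<in> {1..p} \<Longrightarrow> mul (v s) (mul \<omega> a) = - mul \<omega> (mul (v s) a)"
  using mul_vec_anti by (auto simp: sphS_def)

lemma sphS_uminus: "\<omega> \<in> sphS v m p \<Longrightarrow> - \<omega> \<in> sphS v m p"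
proof -
  assume "\<omega> \<in> sphS v m p"
  then obtain c where "\<omega> = (\<Sum>s\<in>{Suc p..m}. c s *\<^sub>R v s)" "(\<Sum>s\<in>{Suc p..m}. (c s)\<^sup>2) = 1"
    by (auto simp: sphS_def)
  then show ?thesis
    unfolding sphS_def by (intro CollectI exI[of _ "\<lambda>s. - c s"]) (simp add: sum_negf)
qed

text \<open>Left multiplication by the conjugate of \<open>v s\<close>. \<open>Dbar\<close> is the
  sum of the partial derivatives with these weights (\<open>Dbar_eq\<close>).\<close>

definition vb :: "nat \<Rightarrow> 'a \<Rightarrow> 'a" where
  "vb s a = (if s = 0 then a else - mul (v s) a)"

lemma linear_vb: "linear (vb s)"
proof -
  have "linear (\<lambda>a. - mul (v s) a)" by (intro linear_compose_neg linear_mul)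
  then show ?thesis by (cases "s = 0") (simp_all add: vb_def[abs_def] linear_ident)
qed

lemma vb_clifford:
  assumes "s \<le> p" "t \<le> p"
  shows "vb s (mul (v t) a) + vb t (mul (v s) a) = (if s = t then 2 *\<^sub>R a else 0)"
    and "mul (v s) (vb t a) + mul (v t) (vb s a) = (if s = t then 2 *\<^sub>R a else 0)"
  using assms pm mul_v_v_mul[of s a] mul_v_anti[of s t a]
  by (auto simp: vb_def mul_v0 mul_minus scaleR_2)

text \<open>Moving \<omega> to the left of \<open>v s\<close> conjugates \<open>v s\<close>: the
  unit passes unchanged and the other \<open>v s\<close> with s \<le> p anticommute with \<omega>.
  This exchanges \<open>Dp\<close> and \<open>Dpb\<close> in the equations for the
  components.\<close>

lemma vb_mul_sphS: "\<omega> \<in> sphS v m p \<Longrightarrow> s \<le> p \<Longrightarrow> vb s (mul \<omega> a) = mul \<omega> (mul (v s) a)"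
  using sphS_anti[of \<omega> s a] by (cases "s = 0") (auto simp: vb_def mul_v0)

lemma mul_sphS_vb: "\<omega> \<in> sphS v m p \<Longrightarrow> s \<le> p \<Longrightarrow> mul (v s) (mul \<omega> a) = mul \<omega> (vb s a)"
  using sphS_anti[of \<omega> s a] by (cases "s = 0") (auto simp: vb_def mul_v0 mul_minus)

end

text \<open>The vectors \<open>b s\<close> are orthonormal stand-ins for the \<open>v s\<close>,
  which need not be orthonormal for the inner product of \<open>'a\<close>. The point z ranges over
  an open set of the whole of \<open>'a\<close>, so that the mean value property applies on an open
  subset of a Euclidean space.\<close>

locale slice_setup = alt_algebra mul e cj v m p + cylinder B R
  for mul :: "'a::euclidean_space \<Rightarrow> 'a \<Rightarrow> 'a" and e cj v m p and B :: "'a set" and R :: real +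
  fixes b :: "nat \<Rightarrow> 'a"
  assumes inj_b: "inj_on b {..p}" and b_Basis: "b ` {..p} \<subseteq> Basis"
begin

definition Dw :: "(nat \<Rightarrow> 'a \<Rightarrow> 'a) \<Rightarrow> ('a \<times> real \<Rightarrow> 'a) \<Rightarrow> 'a \<times> real \<Rightarrow> 'a" where
  "Dw w H x = (\<Sum>s\<le>p. w s (Dz (b s) H x))"

abbreviation Dp :: "('a \<times> real \<Rightarrow> 'a) \<Rightarrow> 'a \<times> real \<Rightarrow> 'a" where
  "Dp \<equiv> Dw (\<lambda>s. mul (v s))"

abbreviation Dpb :: "('a \<times> real \<Rightarrow> 'a) \<Rightarrow> 'a \<times> real \<Rightarrow> 'a" where
  "Dpb \<equiv> Dw vb"

definition Lz :: "('a \<times> real \<Rightarrow> 'a) \<Rightarrow> 'a \<times> real \<Rightarrow> 'a" where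
  "Lz H x = (\<Sum>s\<le>p. Dz (b s) (Dz (b s) H) x)"

text \<open>Sends \<open>b s\<close> to \<open>v s\<close> and annihilates the other basis vectors.
  A function pulled back along it is constant in those directions, which is the hypothesis
  \<open>zero\<close> of \<open>mvp_clifford_system\<close>.\<close>

definition T :: "'a \<Rightarrow> 'a" where
  "T z = (\<Sum>s\<le>p. (z \<bullet> b s) *\<^sub>R v s)"

lemma linear_T: "linear T"
  by (auto simp: T_def linear_iff inner_simps scaleR_add_left sum.distrib scaleR_sum_right)

lemma T_b: "s \<le> p \<Longrightarrow> T (b s) = v s"
proof -
  assume s: "s \<le> p"
  have "b s \<bullet> b t = (if s = t then 1 else 0)" if "t \<le> p" for t
    using b_Basis inj_b s that by (auto simp: inner_Basis inj_on_eq_iff[OF inj_b] image_subset_iff)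
  then have "T (b s) = (\<Sum>t\<le>p. if s = t then v t else 0)"
    unfolding T_def by (intro sum.cong) auto
  then show ?thesis using s by simp
qed

lemma T_Basis_0: "i \<in> Basis \<Longrightarrow> i \<notin> b ` {..p} \<Longrightarrow> T i = 0"
  unfolding T_def using b_Basis by (intro sum.neutral) (auto simp: inner_Basis image_subset_iff)

lemma mvp_Dw: "(\<And>s. linear (w s)) \<Longrightarrow> mvp U H \<Longrightarrow> mvp U (Dw w H)"
  unfolding Dw_def[abs_def] by (intro mvp_sum mvp_linear[OF mvp_Dz])

lemmas mvp_Dp = mvp_Dw[of "\<lambda>s. mul (v s)", OF linear_mul] and mvp_Dpb = mvp_Dw[of vb, OF linear_vb]

lemma mvp_Lz: "mvp U H \<Longrightarrow> mvp U (Lz H)"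
  unfolding Lz_def[abs_def] by (intro mvp_sum mvp_Dz)

lemma mvp_diffble: "mvp U H \<Longrightarrow> x \<in> U \<Longrightarrow> H differentiable (at x)"
  by (rule mvp_differentiable[OF open_U])

lemma dderiv_commute: "mvp U H \<Longrightarrow> x \<in> U \<Longrightarrow> dderiv (dderiv H u) w x = dderiv (dderiv H w) u x"
  by (rule mvp_dderiv_commute[OF open_U])

lemma dderiv_Dw:
  assumes w: "\<And>s. linear (w s)" and H: "mvp U H" and x: "x \<in> U"
  shows "dderiv (Dw w H) u x = Dw w (dderiv H u) x"
proof -
  have "dderiv (Dw w H) u x = (\<Sum>s\<le>p. dderiv (\<lambda>x. w s (Dz (b s) H x)) u x)"
    unfolding Dw_def[abs_def] using x
    by (intro dderiv_sum mvp_diffble mvp_linear[OF mvp_Dz[OF H] w]) auto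
  also have "\<dots> = Dw w (dderiv H u) x"
    unfolding Dw_def
    by (intro sum.cong refl) (simp add: dderiv_linear[OF mvp_diffble[OF mvp_Dz[OF H] x] w] dderiv_commute[OF H x])
  finally show ?thesis .
qed

lemmas dderiv_Dp = dderiv_Dw[of "\<lambda>s. mul (v s)", OF linear_mul] and dderiv_Dpb = dderiv_Dw[of vb, OF linear_vb]

lemma dderiv_Lz:
  assumes "mvp U H" "x \<in> U"
  shows "dderiv (Lz H) u x = Lz (dderiv H u) x"
proof -
  have "dderiv (Lz H) u x = (\<Sum>s\<le>p. dderiv (Dz (b s) (Dz (b s) H)) u x)"
    unfolding Lz_def[abs_def] using assms by (intro dderiv_sum mvp_diffble mvp_Dz) auto
  also have "\<dots> = Lz (dderiv H u) x"
    unfolding Lz_def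
  proof (intro sum.cong refl)
    fix s
    have "dderiv (Dz (b s) (Dz (b s) H)) u x = Dz (b s) (dderiv (Dz (b s) H) u) x"
      using assms by (intro dderiv_commute mvp_Dz)
    also have "\<dots> = Dz (b s) (Dz (b s) (dderiv H u)) x"
      using assms(2) dderiv_commute[OF assms(1)] by (intro dderiv_cong[OF open_U])
    finally show "dderiv (Dz (b s) (Dz (b s) H)) u x = Dz (b s) (Dz (b s) (dderiv H u)) x" .
  qed
  finally show ?thesis .
qed

lemma Dw_cong: "(\<And>y. y \<in> U \<Longrightarrow> F y = G y) \<Longrightarrow> x \<in> U \<Longrightarrow> Dw w F x = Dw w G x"
  and Lz_cong: "(\<And>y. y \<in> U \<Longrightarrow> F y = G y) \<Longrightarrow> x \<in> U \<Longrightarrow> Lz F x = Lz G x"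
  unfolding Dw_def Lz_def
  by (auto intro!: sum.cong arg_cong[where f = "w _"] dderiv_cong[OF open_U])

lemma Dw_Lz:
  assumes w: "\<And>s. linear (w s)" and H: "mvp U H" and x: "x \<in> U"
  shows "Dw w (Lz H) x = Lz (Dw w H) x"
proof -
  have "Dw w (Lz H) x = (\<Sum>s\<le>p. \<Sum>t\<le>p. w s (Dz (b t) (Dz (b t) (Dz (b s) H)) x))"
    unfolding Dw_def dderiv_Lz[OF H x] by (simp add: Lz_def linear_sum[OF w])
  also have "\<dots> = (\<Sum>t\<le>p. \<Sum>s\<le>p. w s (Dz (b t) (Dz (b t) (Dz (b s) H)) x))"
    by (rule sum.swap)
  also have "\<dots> = Lz (Dw w H) x"
    unfolding Lz_def
  proof (intro sum.cong refl)
    fix t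
    have "Dz (b t) (Dz (b t) (Dw w H)) x = Dz (b t) (Dw w (Dz (b t) H)) x"
      by (rule dderiv_cong[OF open_U x dderiv_Dw[OF w H]])
    also have "\<dots> = Dw w (Dz (b t) (Dz (b t) H)) x"
      by (rule dderiv_Dw[OF w mvp_Dz[OF H] x])
    also have "\<dots> = (\<Sum>s\<le>p. w s (Dz (b t) (Dz (b t) (Dz (b s) H)) x))"
      unfolding Dw_def
    proof (intro sum.cong refl arg_cong[where f = "w _"])
      fix s
      have "Dz (b s) (Dz (b t) (Dz (b t) H)) x = Dz (b t) (Dz (b s) (Dz (b t) H)) x"
        by (rule dderiv_commute[OF mvp_Dz[OF H] x])
      also have "\<dots> = Dz (b t) (Dz (b t) (Dz (b s) H)) x"
        by (rule dderiv_cong[OF open_U x dderiv_commute[OF H]])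
      finally show "Dz (b s) (Dz (b t) (Dz (b t) H)) x = Dz (b t) (Dz (b t) (Dz (b s) H)) x" .
    qed
    finally show "(\<Sum>s\<le>p. w s (Dz (b t) (Dz (b t) (Dz (b s) H)) x)) = Dz (b t) (Dz (b t) (Dw w H)) x" by simp
  qed
  finally show ?thesis .
qed

text \<open>Since second derivatives commute, the mixed terms cancel by the Clifford relations, and
  the Laplacian along the \<open>b s\<close> factors as in the associative case.\<close>

lemma Dpb_Dp:
  assumes "mvp U H" "x \<in> U"
  shows "Dpb (Dp H) x = Lz H x"
proof -
  have "Dpb (Dp H) x = (\<Sum>s\<le>p. \<Sum>t\<le>p. vb s (mul (v t) (Dz (b t) (Dz (b s) H) x)))"
    unfolding Dw_def dderiv_Dp[OF assms] by (simp add: Dw_def linear_sum[OF linear_vb])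
  also have "\<dots> = (\<Sum>s\<le>p. Dz (b s) (Dz (b s) H) x)"
  proof (rule sum_symmetrize)
    fix s t assume "s \<in> {..p}" "t \<in> {..p}"
    then show "vb s (mul (v t) (Dz (b t) (Dz (b s) H) x)) + vb t (mul (v s) (Dz (b s) (Dz (b t) H) x)) =
        (if s = t then 2 *\<^sub>R Dz (b s) (Dz (b s) H) x else 0)"
      using vb_clifford(1)[of s t "Dz (b t) (Dz (b s) H) x"] dderiv_commute[OF assms, of "(b t, 0)" "(b s, 0)"]
      by auto
  qed simp
  finally show ?thesis by (simp add: Lz_def)
qed

lemma Dp_Dpb:
  assumes "mvp U H" "x \<in> U"
  shows "Dp (Dpb H) x = Lz H x"
proof -
  have "Dp (Dpb H) x = (\<Sum>s\<le>p. \<Sum>t\<le>p. mul (v s) (vb t (Dz (b t) (Dz (b s) H) x)))"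
    unfolding Dw_def dderiv_Dpb[OF assms] by (simp add: Dw_def mul_sum)
  also have "\<dots> = (\<Sum>s\<le>p. Dz (b s) (Dz (b s) H) x)"
  proof (rule sum_symmetrize)
    fix s t assume "s \<in> {..p}" "t \<in> {..p}"
    then show "mul (v s) (vb t (Dz (b t) (Dz (b s) H) x)) + mul (v t) (vb s (Dz (b s) (Dz (b t) H) x)) =
        (if s = t then 2 *\<^sub>R Dz (b s) (Dz (b s) H) x else 0)"
      using vb_clifford(2)[of s t "Dz (b t) (Dz (b s) H) x"] dderiv_commute[OF assms, of "(b t, 0)" "(b s, 0)"]
      by auto
  qed simp
  finally show ?thesis by (simp add: Lz_def)
qed

lemma even_r_Dw: "mvp U H \<Longrightarrow> even_r H \<Longrightarrow> even_r (Dw w H)"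
  using even_r_Dz[of H] by (simp add: even_r_def Dw_def)

section \<open>The slice equation and its uniqueness theorem\<close>

definition monogenic :: "'a \<Rightarrow> ('a \<times> real \<Rightarrow> 'a) \<Rightarrow> bool" where
  "monogenic \<eta> H \<longleftrightarrow> mvp U H \<and> (\<forall>x\<in>U. Dp H x + mul \<eta> (Dr H x) = 0)"

lemma monogenic_Dr:
  assumes "monogenic \<eta> H"
  shows "monogenic \<eta> (Dr H)"
proof -
  have H: "mvp U H" using assms by (simp add: monogenic_def)
  have "Dp (Dr H) x + mul \<eta> (Dr (Dr H) x) = 0" if x: "x \<in> U" for x
  proof -
    have "Dp (Dr H) x + mul \<eta> (Dr (Dr H) x) = Dr (Dp H) x + Dr (\<lambda>x. mul \<eta> (Dr H x)) x"
      by (simp add: dderiv_Dp[OF H x] dderiv_linear[OF mvp_diffble[OF mvp_Dr[OF H] x] linear_mul])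
    also have "\<dots> = Dr (\<lambda>x. Dp H x + mul \<eta> (Dr H x)) x"
      using x by (intro dderiv_add[symmetric] mvp_diffble mvp_Dp mvp_linear[OF _ linear_mul] mvp_Dr H)
    also have "\<dots> = Dr (\<lambda>x. 0) x"
      using assms by (intro dderiv_cong[OF open_U x]) (simp add: monogenic_def)
    finally show ?thesis by simp
  qed
  then show ?thesis using mvp_Dr[OF H] by (simp add: monogenic_def)
qed

text \<open>Vanishing at r = 0 annihilates the derivatives along the \<open>b s\<close> there. The
  equation leaves \<eta> times the radial derivative equal to 0, and \<open>mul \<eta>\<close> is
  injective because its square is minus the identity.\<close>

lemma monogenic_Dr_0:
  assumes "monogenic \<eta> H" "\<eta> \<in> sphS v m p" "\<And>z. z \<in> B \<Longrightarrow> H (z, 0) = 0" "z \<in> B"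
  shows "Dr H (z, 0) = 0"
proof -
  have "Dz (b s) H (z, 0) = 0" for s
  proof -
    have "((\<lambda>t. 0) has_vector_derivative 0) (at 0)" by simp
    then have "((\<lambda>t. H ((z, 0) + t *\<^sub>R (b s, 0))) has_vector_derivative 0) (at 0)"
      by (rule has_vector_derivative_transform_within_open[of _ _ _ "{t. z + t *\<^sub>R b s \<in> B}"])
         (use assms(3,4) open_line[OF open_B] in auto)
    then show ?thesis by (rule dderiv_eqI)
  qed
  then have "mul \<eta> (Dr H (z, 0)) = 0"
  proof -
    have "Dp H (z, 0) + mul \<eta> (Dr H (z, 0)) = 0"
      using assms(1,4) R_pos unfolding monogenic_def by (metis abs_zero mem_U)
    with \<open>\<And>s. Dz (b s) H (z, 0) = 0\<close> show ?thesis by (simp add: Dw_def mul_0)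
  qed
  then have "mul \<eta> (mul \<eta> (Dr H (z, 0))) = 0" by (simp add: mul_0)
  then show ?thesis by (simp add: sphS_sq[OF assms(2)])
qed

text \<open>The equation expresses radial derivatives by derivatives along \<open>r = 0\<close>, so all of them vanish
there and the solution, being analytic in \<open>r\<close>, is zero.\<close>
lemma monogenic_unique:
  assumes u: "monogenic \<eta> u" and \<eta>: "\<eta> \<in> sphS v m p" and 0: "\<And>z. z \<in> B \<Longrightarrow> u (z, 0) = 0"
    and zr: "z \<in> B" "0 \<le> r" "r < R"
  shows "u (z, r) = 0"
proof -
  define h where "h k = ((\<lambda>H. Dr H) ^^ k) u" for k
  have h_Suc: "h (Suc k) = Dr (h k)" for k by (simp add: h_def)
  have h: "monogenic \<eta> (h k) \<and> (\<forall>z\<in>B. h k (z, 0) = 0)" for k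
  proof (induction k)
    case (Suc k)
    then show ?case unfolding h_Suc using monogenic_Dr monogenic_Dr_0[OF _ \<eta>] by blast
  qed (simp add: h_def u 0)
  have "compact ({z} \<times> {0..r})" "{z} \<times> {0..r} \<subseteq> U"
    using zr by (auto intro!: compact_Times)
  moreover have "mvp U u" using u by (simp add: monogenic_def)
  ultimately obtain C L where CL: "L \<ge> 0" "\<And>x k. x \<in> {z} \<times> {0..r} \<Longrightarrow> norm (h k x) \<le> C * L ^ k * fact k"
    unfolding h_def using mvp_derivatives_factorial_bound[OF open_U, of u "{z} \<times> {0..r}" "(0, 1)"] by metis
  have mvp_h: "mvp U (h k)" for k using h by (simp add: monogenic_def)
  have der: "((\<lambda>t. h k (z, t)) has_vector_derivative h (Suc k) (z, t)) (at t)" if "0 \<le> t" "t \<le> r" for k t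
    unfolding h_Suc using that zr by (intro line_r mvp_h) auto
  have "h 0 (z, r) = 0"
  proof (rule analytic_family_zero_vector[where h = "\<lambda>k t. h k (z, t)" and a = 0 and b = r and C = C and L = L])
    show "continuous_on {0..r} (\<lambda>t. h k (z, t))" for k
      by (intro continuous_at_imp_continuous_on ballI has_vector_derivative_continuous[OF der]) auto
  qed (use der CL h zr in auto)
  then show ?thesis by (simp add: h_def)
qed

end

text \<open>The regularity and the equation are assumed on the pullback to every slice; \<omega> is
  the one direction from which the components are extracted.\<close>

locale slice_function = slice_setup +
  fixes f :: "'a \<Rightarrow> 'a" and \<omega> :: 'a
  assumes \<omega>: "\<omega> \<in> sphS v m p"
    and f_diff: "\<And>\<eta> x. \<eta> \<in> sphS v m p \<Longrightarrow> x \<in> U \<Longrightarrow> (\<lambda>x. f (T (fst x) + snd x *\<^sub>R \<eta>)) differentiable (at x)"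
    and f_cont: "\<And>\<eta> u. \<eta> \<in> sphS v m p \<Longrightarrow> continuous_on U (dderiv (\<lambda>x. f (T (fst x) + snd x *\<^sub>R \<eta>)) u)"
    and f_eq: "\<And>\<eta> x. \<eta> \<in> sphS v m p \<Longrightarrow> x \<in> U \<Longrightarrow>
        Dp (\<lambda>x. f (T (fst x) + snd x *\<^sub>R \<eta>)) x + mul \<eta> (Dr (\<lambda>x. f (T (fst x) + snd x *\<^sub>R \<eta>)) x) = 0"
begin

definition G :: "'a \<Rightarrow> 'a \<times> real \<Rightarrow> 'a" where
  "G \<eta> x = f (T (fst x) + snd x *\<^sub>R \<eta>)"

lemma monogenic_G:
  assumes \<eta>: "\<eta> \<in> sphS v m p"
  shows "monogenic \<eta> (G \<eta>)"
proof -
  \<comment> \<open>The index \<open>Suc p\<close> stands for the radial direction, with weight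
    \<eta> and conjugate weight -\<eta>.\<close>
  define \<iota> where "\<iota> s = (if s \<le> p then (b s, 0) else (0, 1 :: real))" for s
  define w where "w s = (if s \<le> p then mul (v s) else mul \<eta>)" for s
  define w' where "w' s = (if s \<le> p then vb s else (\<lambda>a. - mul \<eta> a))" for s
  have G_def': "G \<eta> = (\<lambda>x. f (T (fst x) + snd x *\<^sub>R \<eta>))" by (simp add: G_def[abs_def])
  have eq: "Dp (G \<eta>) x + mul \<eta> (Dr (G \<eta>) x) = 0" if "x \<in> U" for x
    unfolding G_def' by (rule f_eq[OF \<eta> that])
  have "mvp U (G \<eta>)"
  proof (rule mvp_clifford_system[where \<iota> = \<iota> and w = w and w' = w' and n = "Suc p"])
    show "inj_on \<iota> {..Suc p}"
      using inj_b by (auto simp: \<iota>_def inj_on_def)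
    show "\<iota> ` {..Suc p} \<subseteq> Basis"
      using b_Basis by (auto simp: \<iota>_def Basis_prod_def image_subset_iff)
    fix x and i :: "'a \<times> real" assume x: "x \<in> U" and i: "i \<in> Basis - \<iota> ` {..Suc p}"
    show "dderiv (G \<eta>) i x = 0"
    proof -
      have "i \<noteq> (0, 1)" using i by (force simp: \<iota>_def)
      then obtain i' where i': "i = (i', 0)" "i' \<in> Basis" using i by (auto simp: Basis_prod_def)
      have "i' \<notin> b ` {..p}"
      proof
        assume "i' \<in> b ` {..p}"
        then obtain s where "s \<le> p" "i' = b s" by auto
        then have "i = \<iota> s" "s \<in> {..Suc p}" by (auto simp: \<iota>_def i')
        then show False using i by blast
      qed
      with i' have "T i' = 0" by (intro T_Basis_0)
      then have "G \<eta> (x + t *\<^sub>R i) = G \<eta> x" for t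
        by (simp add: G_def i' linear_add[OF linear_T] linear_scale[OF linear_T])
      then show ?thesis by (intro dderiv_eqI) simp
    qed
  next
    fix s assume "s \<le> Suc p"
    show "linear (w s)" by (simp add: w_def linear_mul)
    show "linear (w' s)" by (simp add: w'_def linear_vb linear_compose_neg linear_mul)
  next
    fix x assume x: "x \<in> U"
    have "(\<Sum>s\<le>p. w s (dderiv (G \<eta>) (\<iota> s) x)) = Dp (G \<eta>) x"
      unfolding Dw_def by (intro sum.cong) (auto simp: w_def \<iota>_def)
    then show "(\<Sum>s\<le>Suc p. w s (dderiv (G \<eta>) (\<iota> s) x)) = 0"
      using eq[OF x] by (simp add: w_def \<iota>_def)
  next
    fix s t a assume "s \<le> Suc p" "t \<le> Suc p"
    then consider "s \<le> p" "t \<le> p" | "s \<le> p" "t = Suc p" | "s = Suc p" "t \<le> p" | "s = Suc p" "t = Suc p"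
      by linarith
    then show "w' s (w t a) + w' t (w s a) = (if s = t then 2 else 0) *\<^sub>R a"
    proof cases
      case 1
      then show ?thesis using vb_clifford(1)[OF 1, of a] by (simp add: w_def w'_def)
    next
      case 2
      then show ?thesis using vb_mul_sphS[OF \<eta>, of s a] by (simp add: w_def w'_def)
    next
      case 3
      then show ?thesis using vb_mul_sphS[OF \<eta>, of t a] by (simp add: w_def w'_def)
    next
      case 4
      then show ?thesis using sphS_sq[OF \<eta>, of a] by (simp add: w_def w'_def scaleR_2)
    qed
  qed (use f_diff[OF \<eta>] f_cont[OF \<eta>] open_U in \<open>auto simp: G_def'\<close>)
  then show ?thesis using eq by (simp add: monogenic_def)
qed

section \<open>Even and odd components of a slice function\<close>

definition \<alpha> :: "'a \<times> real \<Rightarrow> 'a" where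
  "\<alpha> x = (1/2) *\<^sub>R (G \<omega> x + G (- \<omega>) x)"

text \<open>The components solve G(\<omega>) = \<alpha> + \<omega> \<beta> and G(-\<omega>) =
  \<alpha> - \<omega> \<beta>. The sign of the factor -1/2 comes from inverting
  \<open>mul \<omega>\<close>, whose inverse is \<open>mul (- \<omega>)\<close>.\<close>

definition \<beta> :: "'a \<times> real \<Rightarrow> 'a" where
  "\<beta> x = mul \<omega> ((- 1/2) *\<^sub>R (G \<omega> x - G (- \<omega>) x))"

lemma mvp_G: "\<eta> \<in> sphS v m p \<Longrightarrow> mvp U (G \<eta>)"
  using monogenic_G by (simp add: monogenic_def)

lemma mvp_\<alpha>: "mvp U \<alpha>"
  unfolding \<alpha>_def[abs_def] by (intro mvp_scaleR mvp_add mvp_G \<omega> sphS_uminus)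

lemma mvp_\<beta>: "mvp U \<beta>"
  unfolding \<beta>_def[abs_def] by (intro mvp_linear[OF _ linear_mul] mvp_scaleR mvp_diff mvp_G \<omega> sphS_uminus)

lemma even_r_\<alpha>: "even_r \<alpha>"
  by (simp add: even_r_def \<alpha>_def G_def add.commute)

lemma \<alpha>_0: "\<alpha> (z, 0) = f (T z)"
  by (simp add: \<alpha>_def G_def flip: scaleR_2)

lemma \<beta>_0: "\<beta> (z, 0) = 0"
  by (simp add: \<beta>_def G_def mul_0)

lemma dderiv_\<alpha>: "x \<in> U \<Longrightarrow> dderiv \<alpha> u x = (1/2) *\<^sub>R (dderiv (G \<omega>) u x + dderiv (G (- \<omega>)) u x)"
proof -
  assume x: "x \<in> U"
  have d: "G \<omega> differentiable (at x)" "G (- \<omega>) differentiable (at x)"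
    using x by (auto intro!: mvp_diffble mvp_G \<omega> sphS_uminus)
  have "dderiv \<alpha> u x = (1/2) *\<^sub>R dderiv (\<lambda>x. G \<omega> x + G (- \<omega>) x) u x"
    unfolding \<alpha>_def[abs_def] by (rule dderiv_linear[OF differentiable_add[OF d] linear_scale_self])
  then show ?thesis by (simp add: dderiv_add[OF d])
qed

lemma dderiv_\<beta>: "x \<in> U \<Longrightarrow> dderiv \<beta> u x = mul \<omega> ((- 1/2) *\<^sub>R (dderiv (G \<omega>) u x - dderiv (G (- \<omega>)) u x))"
proof -
  assume x: "x \<in> U"
  have d: "G \<omega> differentiable (at x)" "(\<lambda>x. - G (- \<omega>) x) differentiable (at x)" "G (- \<omega>) differentiable (at x)"
    using x by (auto intro!: mvp_diffble mvp_G mvp_minus \<omega> sphS_uminus)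
  have lin: "linear (\<lambda>a. mul \<omega> ((- 1/2) *\<^sub>R a))"
    using linear_compose[OF linear_scale_self[of "- 1/2"] linear_mul[of \<omega>]] by (simp add: o_def)
  have lin': "linear (\<lambda>a::'a. - a)" by (simp add: linear_iff)
  have "dderiv \<beta> u x = mul \<omega> ((- 1/2) *\<^sub>R dderiv (\<lambda>x. G \<omega> x + - G (- \<omega>) x) u x)"
    unfolding \<beta>_def[abs_def] using dderiv_linear[OF differentiable_add[OF d(1,2)] lin] by simp
  also have "dderiv (\<lambda>x. G \<omega> x + - G (- \<omega>) x) u x = dderiv (G \<omega>) u x - dderiv (G (- \<omega>)) u x"
    using dderiv_add[OF d(1,2), of u] dderiv_linear[OF d(3) lin', of u] by simp
  finally show ?thesis .
qed

lemma Dp_G: "x \<in> U \<Longrightarrow> \<eta> \<in> sphS v m p \<Longrightarrow> Dp (G \<eta>) x = - mul \<eta> (Dr (G \<eta>) x)"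
  using monogenic_G[of \<eta>] by (simp add: monogenic_def eq_neg_iff_add_eq_0)

text \<open>With \<open>Dr_\<alpha>\<close> this is a Cauchy-Riemann system, obtained by adding and
  subtracting the equations in the directions \<omega> and -\<omega>. It no longer mentions
  \<omega>, which is what lets the components serve every \<eta>.\<close>

lemma Dr_\<beta>:
  assumes x: "x \<in> U"
  shows "Dr \<beta> x = Dp \<alpha> x"
proof -
  have "Dp \<alpha> x = (1/2) *\<^sub>R (Dp (G \<omega>) x + Dp (G (- \<omega>)) x)"
    unfolding Dw_def by (simp add: dderiv_\<alpha>[OF x] mul_scaleR mul_add scaleR_sum_right sum.distrib scaleR_add_right)
  also have "\<dots> = Dr \<beta> x"
    using x \<omega> by (simp add: Dp_G sphS_uminus dderiv_\<beta> mul_scaleR mul_diff mul_minus_left scaleR_diff_right)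
  finally show ?thesis by simp
qed

lemma Dr_\<alpha>:
  assumes x: "x \<in> U"
  shows "Dr \<alpha> x = - Dpb \<beta> x"
proof -
  have "Dpb \<beta> x = mul \<omega> ((- 1/2) *\<^sub>R (Dp (G \<omega>) x - Dp (G (- \<omega>)) x))"
  proof -
    have "vb s (Dz (b s) \<beta> x) = mul \<omega> ((- 1/2) *\<^sub>R
        (mul (v s) (Dz (b s) (G \<omega>) x) - mul (v s) (Dz (b s) (G (- \<omega>)) x)))" if "s \<le> p" for s
      unfolding dderiv_\<beta>[OF x] vb_mul_sphS[OF \<omega> that] by (simp only: mul_scaleR mul_diff)
    then have "Dpb \<beta> x = (\<Sum>s\<le>p. mul \<omega> ((- 1/2) *\<^sub>R
        (mul (v s) (Dz (b s) (G \<omega>) x) - mul (v s) (Dz (b s) (G (- \<omega>)) x))))"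
      unfolding Dw_def by (intro sum.cong) auto
    then show ?thesis
      by (simp only: Dw_def mul_sum scaleR_sum_right sum_subtractf[symmetric])
  qed
  also have "\<dots> = - Dr \<alpha> x"
    using x \<omega> by (simp add: Dp_G sphS_uminus dderiv_\<alpha> mul_scaleR mul_add mul_diff mul_minus mul_minus_left sphS_sq scaleR_diff_right scaleR_add_right)
  finally show ?thesis by simp
qed

text \<open>By the Cauchy-Riemann system the right-hand side satisfies the equation in direction
  \<eta>, as the left-hand side does, and both equal f (T z) at r = 0;
  \<open>monogenic_unique\<close> applies to the difference \<open>u\<close>.\<close>

lemma representation:
  assumes \<eta>: "\<eta> \<in> sphS v m p" and zr: "z \<in> B" "0 \<le> r" "r < R"
  shows "f (T z + r *\<^sub>R \<eta>) = \<alpha> (z, r) + mul \<eta> (\<beta> (z, r))"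
proof -
  define u where "u x = G \<eta> x + - (\<alpha> x + mul \<eta> (\<beta> x))" for x
  have m\<beta>: "mvp U (\<lambda>x. mul \<eta> (\<beta> x))" by (intro mvp_linear[OF _ linear_mul] mvp_\<beta>)
  have mu: "mvp U u"
    unfolding u_def[abs_def] by (intro mvp_add mvp_minus mvp_G \<eta> mvp_\<alpha> m\<beta>)
  have du: "dderiv u w x = dderiv (G \<eta>) w x - (dderiv \<alpha> w x + mul \<eta> (dderiv \<beta> w x))" if x: "x \<in> U" for x w
  proof -
    have lin': "linear (\<lambda>a::'a. - a)" by (simp add: linear_iff)
    have "dderiv (\<lambda>x. \<alpha> x + mul \<eta> (\<beta> x)) w x = dderiv \<alpha> w x + mul \<eta> (dderiv \<beta> w x)"
      using x by (simp add: dderiv_add[OF mvp_diffble[OF mvp_\<alpha>] mvp_diffble[OF m\<beta>]] dderiv_linear[OF mvp_diffble[OF mvp_\<beta>] linear_mul])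
    moreover have "dderiv (\<lambda>x. - (\<alpha> x + mul \<eta> (\<beta> x))) w x = - dderiv (\<lambda>x. \<alpha> x + mul \<eta> (\<beta> x)) w x"
      using x by (intro dderiv_linear[OF _ lin'] mvp_diffble mvp_add mvp_\<alpha> m\<beta>)
    moreover have "dderiv u w x = dderiv (G \<eta>) w x + dderiv (\<lambda>x. - (\<alpha> x + mul \<eta> (\<beta> x))) w x"
      unfolding u_def[abs_def] using x by (intro dderiv_add mvp_diffble mvp_minus mvp_add mvp_\<alpha> m\<beta> mvp_G \<eta>)
    ultimately show ?thesis by simp
  qed
  have "Dp u x + mul \<eta> (Dr u x) = 0" if x: "x \<in> U" for x
  proof -
    have "(\<Sum>s\<le>p. mul (v s) (mul \<eta> (Dz (b s) \<beta> x))) = mul \<eta> (Dpb \<beta> x)"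
      unfolding Dw_def mul_sum by (intro sum.cong refl mul_sphS_vb[OF \<eta>]) simp
    then have "Dp u x = Dp (G \<eta>) x - (Dp \<alpha> x + mul \<eta> (Dpb \<beta> x))"
      unfolding Dw_def by (simp add: du[OF x] mul_add mul_diff sum.distrib sum_subtractf)
    then show ?thesis
      using x by (simp add: Dp_G[OF x \<eta>] du[OF x] Dr_\<alpha> Dr_\<beta> mul_add mul_diff mul_minus sphS_sq[OF \<eta>])
  qed
  with mu have "monogenic \<eta> u" by (simp add: monogenic_def)
  moreover have "u (z, 0) = 0" if "z \<in> B" for z
    by (simp add: u_def G_def \<alpha>_0 \<beta>_0 mul_0)
  ultimately have "u (z, r) = 0"
    by (rule monogenic_unique[OF _ \<eta> _ zr])
  then show ?thesis
    unfolding u_def G_def fst_conv snd_conv by (simp only: eq_neg_iff_add_eq_0[symmetric] minus_minus)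
qed

text \<open>Integrating \<open>Dr_\<beta>\<close> from r = 0, where \<beta> vanishes, exhibits
  \<beta> / r as a radial average, which makes sense on the axis too.\<close>

lemma \<beta>_eq_Jop:
  assumes "z \<in> B" "\<bar>r\<bar> < R"
  shows "\<beta> (z, r) = r *\<^sub>R Jop 1 (Dp \<alpha>) (z, r)"
proof -
  have "((\<lambda>s. r *\<^sub>R Dp \<alpha> (z, s * r)) has_integral (\<beta> (z, 1 * r) - \<beta> (z, 0 * r))) {0..1}"
  proof (rule fundamental_theorem_of_calculus)
    fix s :: real assume s: "s \<in> {0..1}"
    have "((\<lambda>s. s * r) has_vector_derivative r) (at s within {0..1})"
      by (auto intro!: derivative_eq_intros simp flip: has_real_derivative_iff_has_vector_derivative)
    moreover have "((\<lambda>r. \<beta> (z, r)) has_vector_derivative Dr \<beta> (z, s * r)) (at (s * r) within (\<lambda>s. s * r) ` {0..1})"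
      using assms scale_lt[OF assms(2) s] by (intro line_r mvp_\<beta>)
    ultimately show "((\<lambda>s. \<beta> (z, s * r)) has_vector_derivative r *\<^sub>R Dp \<alpha> (z, s * r)) (at s within {0..1})"
      using vector_diff_chain_within[of "\<lambda>s. s * r" r s "{0..1}" "\<lambda>r. \<beta> (z, r)"] Dr_\<beta>[of "(z, s * r)"]
        assms(1) scale_lt[OF assms(2) s] by (simp add: o_def)
  qed simp
  from integral_unique[OF this] show ?thesis by (simp add: \<beta>_0)
qed

lemma harmonic_\<alpha>: "x \<in> U \<Longrightarrow> Dr (Dr \<alpha>) x = - Lz \<alpha> x"
proof -
  assume x: "x \<in> U"
  have lin': "linear (\<lambda>a::'a. - a)" by (simp add: linear_iff)
  have "Dr (Dr \<alpha>) x = Dr (\<lambda>x. - Dpb \<beta> x) x"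
    by (rule dderiv_cong[OF open_U x Dr_\<alpha>])
  also have "\<dots> = - Dr (Dpb \<beta>) x"
    by (rule dderiv_linear[OF mvp_diffble[OF mvp_Dpb[OF mvp_\<beta>] x] lin'])
  also have "Dr (Dpb \<beta>) x = Dpb (Dr \<beta>) x" by (rule dderiv_Dpb[OF mvp_\<beta> x])
  also have "\<dots> = Dpb (Dp \<alpha>) x" by (rule Dw_cong[OF Dr_\<beta> x])
  also have "\<dots> = Lz \<alpha> x" by (rule Dpb_Dp[OF mvp_\<alpha> x])
  finally show ?thesis .
qed

end

subsection \<open>Calculus of axially symmetric functions\<close>

lemma pd_eqI: "((\<lambda>t. F (x + t *\<^sub>R v s)) has_vector_derivative D) (at 0) \<Longrightarrow> pd v s F x = D"
  unfolding pd_def by (rule dderiv_eqI)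

context cylinder
begin

lemma even_r_Jop: "even_r H \<Longrightarrow> even_r (Jop n H)"
proof (induction n)
  case (Suc n)
  show ?case unfolding even_r_def
  proof (intro allI impI)
    fix z r assume zr: "(z, r) \<in> U"
    have "Jop n H (z, s * - r) = Jop n H (z, s * r)" if "s \<in> {0..1}" for s
      using Suc zr scale_lt[of r s] that by (simp add: even_r_def)
    then show "Jop (Suc n) H (z, - r) = Jop (Suc n) H (z, r)"
      unfolding Jop.simps fst_conv snd_conv
      by (intro Henstock_Kurzweil_Integration.integral_cong) simp
  qed
qed simp

lemma even_r_fam: "mvp U H \<Longrightarrow> even_r H \<Longrightarrow> even_r (fam i H k)"
  unfolding fam_def by (intro even_r_Jop even_r_Drr)

end

section \<open>Coordinates, radius and reflection in M\<close>

context alt_algebra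
begin

abbreviation q :: nat where "q \<equiv> m - p"

lemma independent_v: "independent (v ` {0..m})" and inj_v: "inj_on v {0..m}"
  using basis by (simp_all add: adapted_basis_def)

lemma v_in_Msp: "s \<le> m \<Longrightarrow> v s \<in> Msp v m"
  unfolding Msp_def by (intro span_base) auto

lemma subspace_Msp: "subspace (Msp v m)" by (simp add: Msp_def)

lemma coord_v: "s \<le> m \<Longrightarrow> s' \<le> m \<Longrightarrow> coord v m (v s) s' = (if s' = s then 1 else 0)"
  using inj_v by (auto simp: coord_def representation_basis[OF independent_v] inj_on_eq_iff)

lemma coord_sum:
  assumes "s \<le> m"
  shows "coord v m (\<Sum>t\<in>{0..m}. c t *\<^sub>R v t) s = c s"
proof -
  have "coord v m (\<Sum>t\<in>{0..m}. c t *\<^sub>R v t) s = (\<Sum>t\<in>{0..m}. c t * coord v m (v t) s)"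
  proof -
    have "v t \<in> span (v ` {0..m})" if "t \<in> {0..m}" for t
      using that by (intro span_base imageI)
    then show ?thesis
      unfolding coord_def
      by (subst representation_sum[OF independent_v])
         (auto simp: representation_scale[OF independent_v] intro: span_scale)
  qed
  also have "\<dots> = (\<Sum>t\<in>{0..m}. if s = t then c t else 0)"
    using assms by (intro sum.cong) (auto simp: coord_v)
  finally show ?thesis using assms by simp
qed

lemma Msp_eq_sum:
  assumes "x \<in> Msp v m"
  shows "x = (\<Sum>t\<in>{0..m}. coord v m x t *\<^sub>R v t)"
proof -
  have "(\<Sum>w\<in>v ` {0..m}. representation (v ` {0..m}) x w *\<^sub>R w) = x"
    using assms by (intro sum_representation_eq[OF independent_v]) (auto simp: Msp_def)
  then show ?thesis by (simp add: sum.reindex[OF inj_v] coord_def)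
qed

lemma sum_split_p: "(\<Sum>s\<in>{0..m}. h s) = (\<Sum>s\<le>p. h s) + (\<Sum>s\<in>{Suc p..m}. h s)"
  for h :: "nat \<Rightarrow> 'b::comm_monoid_add"
proof -
  have "{0..m} = {..p} \<union> {Suc p..m}" "{..p} \<inter> {Suc p..m} = {}" using pm by auto
  then show ?thesis by (simp add: sum.union_disjoint)
qed

lemma Msp_eq_xp_xq:
  assumes "x \<in> Msp v m"
  shows "x = xp v m p x + xq v m p x"
  unfolding xp_def xq_def atLeast0AtMost[of p] by (rule Msp_eq_sum[OF assms, unfolded sum_split_p])

lemma coord_add_v:
  assumes "x \<in> Msp v m" "s \<le> m" "s' \<le> m"
  shows "coord v m (x + t *\<^sub>R v s) s' = coord v m x s' + (if s' = s then t else 0)"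
proof -
  have "coord v m (x + t *\<^sub>R v s) s' = coord v m x s' + t * coord v m (v s) s'"
    using assms v_in_Msp[OF assms(2)] unfolding coord_def Msp_def
    by (simp add: representation_add[OF independent_v] representation_scale[OF independent_v] span_scale)
  then show ?thesis using assms by (simp add: coord_v)
qed

lemma add_v_in_Msp: "x \<in> Msp v m \<Longrightarrow> s \<le> m \<Longrightarrow> x + t *\<^sub>R v s \<in> Msp v m"
  by (intro subspace_add subspace_scale subspace_Msp v_in_Msp)

lemma rad_sq: "(rad v m p x)\<^sup>2 = (\<Sum>s\<in>{Suc p..m}. (coord v m x s)\<^sup>2)"
  by (simp add: rad_def sum_nonneg)

lemma rad_nonneg: "rad v m p x \<ge> 0"
  by (simp add: rad_def sum_nonneg)

lemma shift_low:
  assumes x: "x \<in> Msp v m" and s: "s \<le> p"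
  shows "xq v m p (x + t *\<^sub>R v s) = xq v m p x" "rad v m p (x + t *\<^sub>R v s) = rad v m p x"
proof -
  have "coord v m (x + t *\<^sub>R v s) s' = coord v m x s'" if "s' \<in> {Suc p..m}" for s'
    using that s pm x by (simp add: coord_add_v)
  then show "xq v m p (x + t *\<^sub>R v s) = xq v m p x" "rad v m p (x + t *\<^sub>R v s) = rad v m p x"
    by (simp_all add: xq_def rad_def)
qed

lemma shift_high:
  assumes x: "x \<in> Msp v m" and s: "s \<in> {Suc p..m}"
  shows "xq v m p (x + t *\<^sub>R v s) = xq v m p x + t *\<^sub>R v s"
    "rad v m p (x + t *\<^sub>R v s) = sqrt ((rad v m p x)\<^sup>2 + 2 * t * coord v m x s + t\<^sup>2)"
proof -
  have c: "coord v m (x + t *\<^sub>R v s) s' = coord v m x s' + (if s' = s then t else 0)" if "s' \<in> {Suc p..m}" for s'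
    using that s x by (intro coord_add_v) auto
  have "xq v m p (x + t *\<^sub>R v s) = (\<Sum>s'\<in>{Suc p..m}. coord v m x s' *\<^sub>R v s' + (if s' = s then t *\<^sub>R v s' else 0))"
    unfolding xq_def using c by (intro sum.cong) (auto simp: scaleR_add_left)
  then show "xq v m p (x + t *\<^sub>R v s) = xq v m p x + t *\<^sub>R v s"
    using s by (simp add: sum.distrib xq_def)
  have "(rad v m p (x + t *\<^sub>R v s))\<^sup>2 =
      (\<Sum>s'\<in>{Suc p..m}. (coord v m x s')\<^sup>2 + (if s' = s then 2 * t * coord v m x s' + t\<^sup>2 else 0))"
    unfolding rad_sq using c by (intro sum.cong) (auto simp: power2_eq_square algebra_simps)
  then have "(rad v m p (x + t *\<^sub>R v s))\<^sup>2 = (rad v m p x)\<^sup>2 + 2 * t * coord v m x s + t\<^sup>2"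
    using s by (simp add: sum.distrib rad_sq add.assoc)
  then show "rad v m p (x + t *\<^sub>R v s) = sqrt ((rad v m p x)\<^sup>2 + 2 * t * coord v m x s + t\<^sup>2)"
    using rad_nonneg[of "x + t *\<^sub>R v s"] real_sqrt_unique by metis
qed

lemma v_m_sphS: "v m \<in> sphS v m p"
proof -
  have "(\<Sum>s\<in>{Suc p..m}. (if s = m then 1 else 0) *\<^sub>R v s) = v m"
    using pm by (simp add: if_distrib[where f = "\<lambda>c. c *\<^sub>R _"] cong: if_cong)
  moreover have "(\<Sum>s\<in>{Suc p..m}. (if s = m then 1 else 0 :: real)\<^sup>2) = 1"
    using pm by (simp add: if_distrib[where f = "\<lambda>c. c\<^sup>2"] cong: if_cong)
  ultimately show ?thesis
    unfolding sphS_def by (intro CollectI exI[of _ "\<lambda>s. if s = m then 1 else 0"]) simp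
qed

lemma xq_polar:
  obtains \<eta> where "\<eta> \<in> sphS v m p" "xq v m p x = rad v m p x *\<^sub>R \<eta>"
proof (cases "rad v m p x = 0")
  \<comment> \<open>On the axis every direction is admissible; \<open>v m\<close> is at
    hand.\<close>
  case True
  then have "(\<Sum>s\<in>{Suc p..m}. (coord v m x s)\<^sup>2) = 0"
    using rad_sq[of x] by simp
  then have "xq v m p x = 0"
    unfolding xq_def by (subst (asm) sum_nonneg_eq_0_iff) auto
  then show ?thesis using that[OF v_m_sphS] True by simp
next
  case False
  define r where "r = rad v m p x"
  define \<eta> where "\<eta> = (\<Sum>s\<in>{Suc p..m}. (coord v m x s / r) *\<^sub>R v s)"
  have "(\<Sum>s\<in>{Suc p..m}. (coord v m x s / r)\<^sup>2) = (\<Sum>s\<in>{Suc p..m}. (coord v m x s)\<^sup>2) / r\<^sup>2"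
    by (simp add: power_divide sum_divide_distrib)
  also have "\<dots> = 1" unfolding rad_sq[symmetric] using False by (simp add: r_def)
  finally have "\<eta> \<in> sphS v m p" by (auto simp: sphS_def \<eta>_def)
  moreover have "xq v m p x = rad v m p x *\<^sub>R \<eta>"
    using False by (simp add: xq_def \<eta>_def scaleR_sum_right r_def)
  ultimately show ?thesis by (rule that)
qed

lemma mul_xq_sq: "mul (xq v m p x) (mul (xq v m p x) a) = - ((rad v m p x)\<^sup>2 *\<^sub>R a)"
  unfolding xq_def rad_sq using mul_vec_sq[of "{Suc p..m}"] by simp

lemma vb_mul_xq: "s \<le> p \<Longrightarrow> vb s (mul (xq v m p x) a) = mul (xq v m p x) (mul (v s) a)"
  unfolding xq_def using mul_vec_anti[of s] by (cases "s = 0") (auto simp: vb_def mul_v0)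

lemma xdiam_facts:
  assumes x: "x \<in> Msp v m"
  shows "xdiam v m p x \<in> Msp v m" and "s \<le> p \<Longrightarrow> coord v m (xdiam v m p x) s = coord v m x s"
    and "xq v m p (xdiam v m p x) = - xq v m p x" and "rad v m p (xdiam v m p x) = rad v m p x"
proof -
  define c where "c s = (if s \<le> p then coord v m x s else - coord v m x s)" for s
  have eq: "xdiam v m p x = (\<Sum>s\<in>{0..m}. c s *\<^sub>R v s)"
    unfolding sum_split_p xdiam_def xp_def xq_def diff_conv_add_uminus sum_negf[symmetric]
    by (intro arg_cong2[where f = "(+)"] sum.cong) (auto simp: c_def)
  show "xdiam v m p x \<in> Msp v m"
    unfolding eq by (intro subspace_sum subspace_scale subspace_Msp v_in_Msp) auto
  have c: "coord v m (xdiam v m p x) s = c s" if "s \<le> m" for s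
    unfolding eq by (rule coord_sum[OF that])
  show "s \<le> p \<Longrightarrow> coord v m (xdiam v m p x) s = coord v m x s"
    using c[of s] pm by (simp add: c_def)
  show "xq v m p (xdiam v m p x) = - xq v m p x"
    unfolding xq_def sum_negf[symmetric] using c by (intro sum.cong) (auto simp: c_def)
  show "rad v m p (xdiam v m p x) = rad v m p x"
    unfolding rad_def using c by (intro arg_cong[where f = sqrt] sum.cong) (auto simp: c_def)
qed

end

section \<open>Lifting radial profiles from the cylinder to M\<close>

context slice_setup
begin

text \<open>The coordinates of x_p transported to the stand-ins \<open>b s\<close>, so that
  \<open>T\<close> returns x_p.\<close>

definition Zx :: "'a \<Rightarrow> 'a" where
  "Zx x = (\<Sum>s\<le>p. coord v m x s *\<^sub>R b s)"

text \<open>A tube in M invariant under the reflection \<open>xdiam\<close>. The openness that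
  partial derivatives ask for is openness along each \<open>v s\<close>, provided by
  \<open>N_line\<close>.\<close>

definition N :: "'a set" where
  "N = {x \<in> Msp v m. Zx x \<in> B \<and> rad v m p x < R}"

lemma T_Zx: "T (Zx x) = xp v m p x"
  unfolding Zx_def xp_def linear_sum[OF linear_T] linear_scale[OF linear_T]
  by (simp add: T_b atLeast0AtMost)

lemma N_D: "x \<in> N \<Longrightarrow> x \<in> Msp v m" "x \<in> N \<Longrightarrow> Zx x \<in> B" "x \<in> N \<Longrightarrow> \<bar>rad v m p x\<bar> < R"
  "x \<in> N \<Longrightarrow> (Zx x, rad v m p x) \<in> U" "x \<in> N \<Longrightarrow> rad v m p x < R"
  using rad_nonneg by (auto simp: N_def)

lemma Zx_low: "x \<in> Msp v m \<Longrightarrow> s \<le> p \<Longrightarrow> Zx (x + t *\<^sub>R v s) = Zx x + t *\<^sub>R b s"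
proof -
  assume x: "x \<in> Msp v m" and s: "s \<le> p"
  have "Zx (x + t *\<^sub>R v s) = (\<Sum>s'\<le>p. coord v m x s' *\<^sub>R b s' + (if s' = s then t *\<^sub>R b s' else 0))"
    unfolding Zx_def using x s pm by (intro sum.cong) (auto simp: coord_add_v scaleR_add_left)
  then show ?thesis using s by (simp add: sum.distrib Zx_def)
qed

lemma Zx_high: "x \<in> Msp v m \<Longrightarrow> s \<in> {Suc p..m} \<Longrightarrow> Zx (x + t *\<^sub>R v s) = Zx x"
  unfolding Zx_def by (intro sum.cong) (auto simp: coord_add_v)

lemma xdiam_N: "x \<in> N \<Longrightarrow> xdiam v m p x \<in> N" and Zx_xdiam: "x \<in> N \<Longrightarrow> Zx (xdiam v m p x) = Zx x"
  using xdiam_facts[of x] by (auto simp: N_def Zx_def)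

lemma N_line:
  assumes x: "x \<in> N" and s: "s \<le> m"
  obtains V where "open V" "0 \<in> V" "\<And>t. t \<in> V \<Longrightarrow> x + t *\<^sub>R v s \<in> N"
proof (cases "s \<le> p")
  case True
  show thesis
  proof (rule that[of "{t. Zx x + t *\<^sub>R b s \<in> B}"])
    show "open {t. Zx x + t *\<^sub>R b s \<in> B}" by (rule open_line[OF open_B])
  qed (use x True s in \<open>auto simp: N_def add_v_in_Msp Zx_low shift_low\<close>)
next
  case False
  then have s': "s \<in> {Suc p..m}" using s by auto
  have "open {t. sqrt ((rad v m p x)\<^sup>2 + 2 * t * coord v m x s + t\<^sup>2) < R}"
    by (intro open_Collect_less continuous_intros)
  then show thesis
    by (rule that) (use x s s' rad_nonneg[of x] in \<open>auto simp: N_def add_v_in_Msp Zx_high shift_high\<close>)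
qed

lemma pd_cong_N:
  assumes "x \<in> N" "s \<le> m" "\<And>y. y \<in> N \<Longrightarrow> F y = G y"
  shows "pd v s F x = pd v s G x"
proof -
  obtain V where V: "open V" "0 \<in> V" "\<And>t. t \<in> V \<Longrightarrow> x + t *\<^sub>R v s \<in> N"
    using N_line[OF assms(1,2)] by metis
  have "\<forall>\<^sub>F t in nhds 0. t \<in> V" using V by (intro eventually_nhds_in_open)
  then have "\<forall>\<^sub>F t in nhds 0. F (x + t *\<^sub>R v s) = G (x + t *\<^sub>R v s)"
    by eventually_elim (intro assms V)
  then show ?thesis
    unfolding pd_def dderiv_def by (intro vector_derivative_cong_eq) (auto elim: eventually_mono)
qed

lemma Lap_cong_N:
  assumes "x \<in> N" "\<And>y. y \<in> N \<Longrightarrow> F y = G y"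
  shows "Lap v m F x = Lap v m G x"
  unfolding Lap_def using assms by (intro sum.cong refl pd_cong_N) auto

definition lift :: "('a \<times> real \<Rightarrow> 'a) \<Rightarrow> 'a \<Rightarrow> 'a" where
  "lift h x = h (Zx x, rad v m p x)"

lemma lift_low:
  assumes "mvp U H" "x \<in> N" "s \<le> p"
  shows "((\<lambda>t. lift (fam i H k) (x + t *\<^sub>R v s)) has_vector_derivative lift (fam i (Dz (b s) H) k) x) (at 0)"
  using fam_line_z[OF assms(1), of "Zx x" 0 "b s" "rad v m p x" i k UNIV] assms(3) N_D[OF assms(2)]
  by (simp add: lift_def Zx_low shift_low)

text \<open>The derivative of r along \<open>v s\<close> is x_s / r, and the factor r in
  \<open>fam_line_r\<close> removes the denominator.\<close>

lemma lift_high: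
  assumes H: "mvp U H" "even_r H" and x: "x \<in> N" and s: "s \<in> {Suc p..m}"
  shows "((\<lambda>t. lift (fam i H k) (x + t *\<^sub>R v s)) has_vector_derivative
    coord v m x s *\<^sub>R lift (fam i H (Suc k)) x) (at 0)"
proof -
  define \<rho> where "\<rho> = rad v m p x"
  define c where "c = coord v m x s"
  define g where "g r = fam i H k (Zx x, r)" for r
  have \<rho>: "\<bar>\<rho>\<bar> < R" "\<rho> \<ge> 0" using N_D[OF x] rad_nonneg by (auto simp: \<rho>_def)
  have g': "(g has_vector_derivative r *\<^sub>R fam i H (Suc k) (Zx x, r)) (at r)" if "\<bar>r\<bar> < R" for r
    unfolding g_def[abs_def] using that N_D[OF x] by (intro fam_line_r H)
  have eq: "lift (fam i H k) (x + t *\<^sub>R v s) = g (sqrt (\<rho>\<^sup>2 + 2 * t * c + t\<^sup>2))" for t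
    using N_D[OF x] s by (simp add: lift_def Zx_high shift_high g_def \<rho>_def c_def)
  have "((\<lambda>t. g (sqrt (\<rho>\<^sup>2 + 2 * t * c + t\<^sup>2))) has_vector_derivative c *\<^sub>R fam i H (Suc k) (Zx x, \<rho>)) (at 0)"
  proof (cases "\<rho> = 0")
    \<comment> \<open>On the axis x_s = 0 and the radius of the shifted point is the absolute value
      of t, which is not differentiable at 0. Evenness of the profile replaces it by t, and the
      derivative there is 0.\<close>
    case True
    have "c\<^sup>2 \<le> (rad v m p x)\<^sup>2"
      unfolding rad_sq c_def using s member_le_sum[of s "{Suc p..m}" "\<lambda>s. (coord v m x s)\<^sup>2"] by simp
    then have c: "c = 0" using True by (simp add: \<rho>_def)
    have "(g has_vector_derivative 0) (at 0)" using g'[of 0] R_pos by simp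
    then have "((\<lambda>t. g (sqrt (t\<^sup>2))) has_vector_derivative 0) (at 0)"
    proof (rule has_vector_derivative_transform_within_open)
      fix t assume "t \<in> {- R<..<R}"
      then show "g t = g (sqrt (t\<^sup>2))"
        using even_r_fam[OF H, of i k] N_D(2)[OF x] by (cases "t \<ge> 0") (auto simp: even_r_def g_def)
    qed (use R_pos in auto)
    then show ?thesis by (simp add: c True)
  next
    case False
    then have pos: "\<rho> > 0" using \<rho> by simp
    have 1: "((\<lambda>t. \<rho>\<^sup>2 + 2 * t * c + t\<^sup>2) has_real_derivative 2 * c) (at 0)"
      by (auto intro!: derivative_eq_intros)
    have "(sqrt has_real_derivative inverse (sqrt (\<rho>\<^sup>2 + 2 * 0 * c + 0\<^sup>2)) / 2) (at (\<rho>\<^sup>2 + 2 * 0 * c + 0\<^sup>2))"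
      using pos by (intro DERIV_real_sqrt) simp
    from DERIV_chain2[OF this 1]
    have 2: "((\<lambda>t. sqrt (\<rho>\<^sup>2 + 2 * t * c + t\<^sup>2)) has_vector_derivative c / \<rho>) (at 0)"
      using pos by (simp add: field_simps flip: has_real_derivative_iff_has_vector_derivative)
    have 3: "(g has_vector_derivative \<rho> *\<^sub>R fam i H (Suc k) (Zx x, \<rho>)) (at (sqrt (\<rho>\<^sup>2 + 2 * 0 * c + 0\<^sup>2)))"
      using g'[OF \<rho>(1)] \<rho>(2) by simp
    from vector_diff_chain_at[OF 2 3] show ?thesis using pos by (simp add: o_def)
  qed
  then show ?thesis unfolding eq by (simp add: lift_def \<rho>_def c_def)
qed

lemma coord_hvd: "x \<in> Msp v m \<Longrightarrow> s \<le> m \<Longrightarrow> ((\<lambda>t. coord v m (x + t *\<^sub>R v s) s) has_real_derivative 1) (at 0)"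
  by (simp add: coord_add_v) (auto intro!: derivative_eq_intros)

text \<open>With H = \<alpha>, H' = \<open>Dp \<alpha>\<close> and c = c' = 1 this is the function
  a_k + x_q b_k. Separate constants let \<open>PE\<close> and \<open>PO\<close> be obtained by
  setting one of them to 0.\<close>

definition Psi :: "real \<Rightarrow> real \<Rightarrow> ('a \<times> real \<Rightarrow> 'a) \<Rightarrow> ('a \<times> real \<Rightarrow> 'a) \<Rightarrow> nat \<Rightarrow> 'a \<Rightarrow> 'a" where
  "Psi c c' H H' k x = c *\<^sub>R lift (fam 0 H k) x + c' *\<^sub>R mul (xq v m p x) (lift (fam 1 H' k) x)"

lemma bounded_bilinear_mul: "bounded_bilinear mul"
  using bilinear_mul by (simp add: bilinear_conv_bounded_bilinear)

lemma hvd_scaleR_const: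
  "(F has_vector_derivative D) (at x) \<Longrightarrow> ((\<lambda>t. c *\<^sub>R F t) has_vector_derivative c *\<^sub>R D) (at x)" for F :: "real \<Rightarrow> 'a"
  using has_vector_derivative_scaleR[OF DERIV_const, of F D x UNIV c] by simp

lemma hvd_mul:
  "(F has_vector_derivative D) (at x) \<Longrightarrow> ((\<lambda>t. mul a (F t)) has_vector_derivative mul a D) (at x)"
  using bounded_linear.has_vector_derivative[OF _ , of "mul a"] linear_mul[of a]
  by (simp add: linear_conv_bounded_linear)

lemma Psi_low:
  assumes H: "mvp U H" "mvp U H'" and x: "x \<in> N" and s: "s \<le> p"
  shows "((\<lambda>t. Psi c c' H H' k (x + t *\<^sub>R v s)) has_vector_derivative
    Psi c c' (Dz (b s) H) (Dz (b s) H') k x) (at 0)"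
  unfolding Psi_def shift_low(1)[OF N_D(1)[OF x] s]
  by (intro has_vector_derivative_add hvd_scaleR_const hvd_mul lift_low assms)

lemma Psi_high:
  assumes H: "mvp U H" "even_r H" "mvp U H'" "even_r H'" and x: "x \<in> N" and s: "s \<in> {Suc p..m}"
  shows "((\<lambda>t. Psi c c' H H' k (x + t *\<^sub>R v s)) has_vector_derivative
    coord v m x s *\<^sub>R Psi c c' H H' (Suc k) x + c' *\<^sub>R mul (v s) (lift (fam 1 H' k) x)) (at 0)"
proof -
  have "((\<lambda>t. xq v m p x + t *\<^sub>R v s) has_vector_derivative v s) (at 0)"
    by (auto intro!: derivative_eq_intros)
  from bounded_bilinear.has_vector_derivative[OF bounded_bilinear_mul this lift_high[OF H(3,4) x s]]
  have "((\<lambda>t. mul (xq v m p (x + t *\<^sub>R v s)) (lift (fam 1 H' k) (x + t *\<^sub>R v s))) has_vector_derivative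
     mul (xq v m p x) (coord v m x s *\<^sub>R lift (fam 1 H' (Suc k)) x) + mul (v s) (lift (fam 1 H' k) x)) (at 0)"
    using N_D[OF x] s by (simp add: shift_high)
  from has_vector_derivative_add[OF hvd_scaleR_const[OF lift_high[OF H(1,2) x s], of c] hvd_scaleR_const[OF this, of c']]
  have "((\<lambda>t. Psi c c' H H' k (x + t *\<^sub>R v s)) has_vector_derivative
     (c *\<^sub>R coord v m x s *\<^sub>R lift (fam 0 H (Suc k)) x + c' *\<^sub>R (mul (xq v m p x) (coord v m x s *\<^sub>R lift (fam 1 H' (Suc k)) x) +
       mul (v s) (lift (fam 1 H' k) x)))) (at 0)"
    by (simp add: Psi_def)
  then show ?thesis
    by (simp add: Psi_def mul_scaleR scaleR_add_right mult.commute add.assoc)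
qed

text \<open>Harmonicity in the p + 2 variables of a slice. Evenness is bundled in because the radial
  averages represent iterates of (1/r) d/dr for even functions.\<close>

definition harmonic :: "('a \<times> real \<Rightarrow> 'a) \<Rightarrow> bool" where
  "harmonic H \<longleftrightarrow> mvp U H \<and> even_r H \<and> (\<forall>x\<in>U. Dr (Dr H) x = - Lz H x)"

lemma harmonic_Drr: "harmonic H \<Longrightarrow> harmonic (Drr k H)"
proof (induction k)
  case (Suc k)
  define F where "F = Drr k H"
  have F: "mvp U F" "even_r F" "\<And>x. x \<in> U \<Longrightarrow> Dr (Dr F) x = - Lz F x"
    using Suc by (auto simp: harmonic_def F_def)
  have "Dr (Dr (Dr (Dr F))) x = - Lz (Dr (Dr F)) x" if x: "x \<in> U" for x
  proof -
    have 1: "Dr (Dr (Dr F)) y = - Lz (Dr F) y" if y: "y \<in> U" for y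
    proof -
      have lin: "linear (\<lambda>a::'a. - a)" by (simp add: linear_iff)
      have "Dr (Dr (Dr F)) y = Dr (\<lambda>x. - Lz F x) y"
        by (rule dderiv_cong[OF open_U y F(3)])
      also have "\<dots> = - Dr (Lz F) y"
        by (rule dderiv_linear[OF mvp_diffble[OF mvp_Lz[OF F(1)] y] lin])
      finally show ?thesis by (simp add: dderiv_Lz[OF F(1) y])
    qed
    have lin: "linear (\<lambda>a::'a. - a)" by (simp add: linear_iff)
    have "Dr (Dr (Dr (Dr F))) x = Dr (\<lambda>x. - Lz (Dr F) x) x"
      by (rule dderiv_cong[OF open_U x 1])
    also have "\<dots> = - Dr (Lz (Dr F)) x"
      by (rule dderiv_linear[OF mvp_diffble[OF mvp_Lz[OF mvp_Dr[OF F(1)]] x] lin])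
    finally show ?thesis by (simp add: dderiv_Lz[OF mvp_Dr[OF F(1)] x])
  qed
  then have "harmonic (Dr (Dr F))" using F(1,2) by (simp add: harmonic_def mvp_Dr even_r_DrDr)
  then show ?case by (simp only: Drr_Suc F_def)
qed simp

lemma fam_Lz:
  assumes H: "harmonic H" and x: "(z, r) \<in> U"
  shows "(\<Sum>s\<le>p. fam i (Dz (b s) (Dz (b s) H)) k (z, r)) = - Jop (k + i) (Drr (Suc k) H) (z, r)"
proof -
  have mH: "mvp U H" and mk: "mvp U (Drr k H)" using H by (auto simp: harmonic_def mvp_Drr)
  have "fam i (Dz (b s) (Dz (b s) H)) k (z, r) = Jop (k + i) (Dz (b s) (Dz (b s) (Drr k H))) (z, r)" for s
    unfolding fam_def
  proof (rule Jop_cong[OF _ x])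
    fix y assume y: "y \<in> U"
    have "Drr k (Dz (b s) (Dz (b s) H)) y = Dz (b s) (Drr k (Dz (b s) H)) y"
      by (rule Drr_Dz[OF mvp_Dz[OF mH] y])
    also have "\<dots> = Dz (b s) (Dz (b s) (Drr k H)) y"
      by (rule dderiv_cong[OF open_U y Drr_Dz[OF mH]])
    finally show "Drr k (Dz (b s) (Dz (b s) H)) y = Dz (b s) (Dz (b s) (Drr k H)) y" .
  qed
  then have "(\<Sum>s\<le>p. fam i (Dz (b s) (Dz (b s) H)) k (z, r)) =
      Jop (k + i) (\<lambda>y. \<Sum>s\<le>p. Dz (b s) (Dz (b s) (Drr k H)) y) (z, r)"
    using x mk by (simp add: Jop_sum mvp_imp_continuous_on mvp_Dz)
  also have "\<dots> = Jop (k + i) (\<lambda>y. - Drr (Suc k) H y) (z, r)"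
    using harmonic_Drr[OF H, of k] by (intro Jop_cong[OF _ x]) (simp add: harmonic_def Lz_def Drr_Suc)
  also have "\<dots> = - Jop (k + i) (Drr (Suc k) H) (z, r)"
    using x mH by (intro Jop_linear mvp_imp_continuous_on mvp_Drr) (auto simp: linear_iff)
  finally show ?thesis .
qed

text \<open>Put E = (1/r) d/dr. For k = i = 0 this is harmonicity itself, since the second radial
  derivative equals r^2 E^2 + E. Each further application of E, and each initial average, raises the
  coefficient of E by 2.\<close>

lemma fam_pde:
  assumes H: "harmonic H" and x: "(z, r) \<in> U"
  shows "(\<Sum>s\<le>p. fam i (Dz (b s) (Dz (b s) H)) k (z, r)) + r\<^sup>2 *\<^sub>R fam i H (Suc (Suc k)) (z, r) =
    - (2 * real (k + i) + 1) *\<^sub>R fam i H (Suc k) (z, r)"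
proof -
  have "mvp U H" "even_r H" using H by (auto simp: harmonic_def)
  from fam_recurrence[OF this x, of i k] fam_Lz[OF H x, of i k]
  show ?thesis by (simp add: algebra_simps)
qed

text \<open>On an even profile a, the q directions of x_q give r^2 E^2 a + q E a, and
  \<open>fam_pde\<close> reduces the coefficient to q - (2k + 1). On x_q b the product rule adds 2 E
  b, while i = 1 raises the subtracted number to 2k + 3. The two changes cancel, so both parts
  receive the same factor q - 1 - 2k.\<close>

lemma Lap_Psi:
  assumes H: "harmonic H" and H': "harmonic H'" and x: "x \<in> N"
  shows "Lap v m (Psi c c' H H' k) x = (real q - 1 - 2 * real k) *\<^sub>R Psi c c' H H' (Suc k) x"
proof -
  have m: "mvp U H" "even_r H" "mvp U H'" "even_r H'" using H H' by (auto simp: harmonic_def)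
  define X where "X = xq v m p x"
  define \<rho> where "\<rho> = rad v m p x"
  have xM: "x \<in> Msp v m" and xU: "(Zx x, \<rho>) \<in> U" using N_D[OF x] by (auto simp: \<rho>_def)
  have low: "pd v s (pd v s (Psi c c' H H' k)) x =
      Psi c c' (Dz (b s) (Dz (b s) H)) (Dz (b s) (Dz (b s) H')) k x" if s: "s \<le> p" for s
  proof -
    have "pd v s (pd v s (Psi c c' H H' k)) x = pd v s (Psi c c' (Dz (b s) H) (Dz (b s) H') k) x"
      using s pm by (intro pd_cong_N[OF x] pd_eqI Psi_low m) auto
    also have "\<dots> = Psi c c' (Dz (b s) (Dz (b s) H)) (Dz (b s) (Dz (b s) H')) k x"
      by (intro pd_eqI Psi_low mvp_Dz m x s)
    finally show ?thesis .
  qed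
  have high: "pd v s (pd v s (Psi c c' H H' k)) x = Psi c c' H H' (Suc k) x +
      (coord v m x s)\<^sup>2 *\<^sub>R Psi c c' H H' (Suc (Suc k)) x +
      (2 * c' * coord v m x s) *\<^sub>R mul (v s) (lift (fam 1 H' (Suc k)) x)" if s: "s \<in> {Suc p..m}" for s
  proof -
    have sm: "s \<le> m" using s by simp
    have "pd v s (pd v s (Psi c c' H H' k)) x =
        pd v s (\<lambda>y. coord v m y s *\<^sub>R Psi c c' H H' (Suc k) y + c' *\<^sub>R mul (v s) (lift (fam 1 H' k) y)) x"
      by (intro pd_cong_N[OF x sm] pd_eqI Psi_high m s)
    also have "\<dots> = (coord v m x s *\<^sub>R (coord v m x s *\<^sub>R Psi c c' H H' (Suc (Suc k)) x + c' *\<^sub>R mul (v s) (lift (fam 1 H' (Suc k)) x)) +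
        1 *\<^sub>R Psi c c' H H' (Suc k) x) + c' *\<^sub>R mul (v s) (coord v m x s *\<^sub>R lift (fam 1 H' (Suc k)) x)"
    proof (rule pd_eqI, rule has_vector_derivative_add)
      show "((\<lambda>t. coord v m (x + t *\<^sub>R v s) s *\<^sub>R Psi c c' H H' (Suc k) (x + t *\<^sub>R v s)) has_vector_derivative
        coord v m x s *\<^sub>R (coord v m x s *\<^sub>R Psi c c' H H' (Suc (Suc k)) x + c' *\<^sub>R mul (v s) (lift (fam 1 H' (Suc k)) x)) +
        1 *\<^sub>R Psi c c' H H' (Suc k) x) (at 0)"
        using has_vector_derivative_scaleR[OF coord_hvd[OF xM sm] Psi_high[OF m x s, of c c' "Suc k"]] by simp
      show "((\<lambda>t. c' *\<^sub>R mul (v s) (lift (fam 1 H' k) (x + t *\<^sub>R v s))) has_vector_derivative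
        c' *\<^sub>R mul (v s) (coord v m x s *\<^sub>R lift (fam 1 H' (Suc k)) x)) (at 0)"
        by (intro hvd_scaleR_const hvd_mul lift_high m x s)
    qed
    also have "\<dots> = Psi c c' H H' (Suc k) x +
      (coord v m x s)\<^sup>2 *\<^sub>R Psi c c' H H' (Suc (Suc k)) x +
      (2 * c' * coord v m x s) *\<^sub>R mul (v s) (lift (fam 1 H' (Suc k)) x)"
    proof -
      have "(2 * c' * coord v m x s) *\<^sub>R a = coord v m x s *\<^sub>R c' *\<^sub>R a + c' *\<^sub>R coord v m x s *\<^sub>R a" for a :: 'a
        by (simp add: mult_ac flip: scaleR_add_left)
      then show ?thesis by (simp add: mul_scaleR power2_eq_square scaleR_add_right)
    qed
    finally show ?thesis .
  qed
  have sumlow: "(\<Sum>s\<le>p. Psi c c' (Dz (b s) (Dz (b s) H)) (Dz (b s) (Dz (b s) H')) k x) =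
      c *\<^sub>R (\<Sum>s\<le>p. fam 0 (Dz (b s) (Dz (b s) H)) k (Zx x, \<rho>)) +
      c' *\<^sub>R mul X (\<Sum>s\<le>p. fam 1 (Dz (b s) (Dz (b s) H')) k (Zx x, \<rho>))"
    by (simp add: Psi_def lift_def sum.distrib scaleR_sum_right mul_sum X_def \<rho>_def)
  have sumhigh: "(\<Sum>s\<in>{Suc p..m}. Psi c c' H H' (Suc k) x +
      (coord v m x s)\<^sup>2 *\<^sub>R Psi c c' H H' (Suc (Suc k)) x +
      (2 * c' * coord v m x s) *\<^sub>R mul (v s) (lift (fam 1 H' (Suc k)) x)) =
      real q *\<^sub>R Psi c c' H H' (Suc k) x + \<rho>\<^sup>2 *\<^sub>R Psi c c' H H' (Suc (Suc k)) x +
      (2 * c') *\<^sub>R mul X (lift (fam 1 H' (Suc k)) x)"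
    using pm by (simp add: sum.distrib rad_sq \<rho>_def X_def xq_def scaleR_sum_left mul_sum_left mul_scaleR_left scaleR_sum_right sum_constant_scaleR)
  have "Lap v m (Psi c c' H H' k) x =
      c *\<^sub>R ((\<Sum>s\<le>p. fam 0 (Dz (b s) (Dz (b s) H)) k (Zx x, \<rho>)) + \<rho>\<^sup>2 *\<^sub>R fam 0 H (Suc (Suc k)) (Zx x, \<rho>)) +
      c' *\<^sub>R mul X ((\<Sum>s\<le>p. fam 1 (Dz (b s) (Dz (b s) H')) k (Zx x, \<rho>)) + \<rho>\<^sup>2 *\<^sub>R fam 1 H' (Suc (Suc k)) (Zx x, \<rho>)) +
      real q *\<^sub>R Psi c c' H H' (Suc k) x + (2 * c') *\<^sub>R mul X (fam 1 H' (Suc k) (Zx x, \<rho>))"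
  proof -
    have "Lap v m (Psi c c' H H' k) x =
        (\<Sum>s\<le>p. Psi c c' (Dz (b s) (Dz (b s) H)) (Dz (b s) (Dz (b s) H')) k x) +
        (\<Sum>s\<in>{Suc p..m}. Psi c c' H H' (Suc k) x + (coord v m x s)\<^sup>2 *\<^sub>R Psi c c' H H' (Suc (Suc k)) x +
          (2 * c' * coord v m x s) *\<^sub>R mul (v s) (lift (fam 1 H' (Suc k)) x))"
      unfolding Lap_def sum_split_p using low high by (intro arg_cong2[where f = "(+)"] sum.cong) auto
    moreover have "\<rho>\<^sup>2 *\<^sub>R Psi c c' H H' (Suc (Suc k)) x =
        c *\<^sub>R \<rho>\<^sup>2 *\<^sub>R fam 0 H (Suc (Suc k)) (Zx x, \<rho>) + c' *\<^sub>R mul X (\<rho>\<^sup>2 *\<^sub>R fam 1 H' (Suc (Suc k)) (Zx x, \<rho>))"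
      by (simp add: Psi_def lift_def X_def \<rho>_def scaleR_add_right mul_scaleR mult.commute)
    ultimately show ?thesis
      unfolding sumlow sumhigh by (simp add: lift_def \<rho>_def[symmetric] mul_add scaleR_add_right)
  qed
  also have "\<dots> = c *\<^sub>R (- (2 * real (k + 0) + 1) *\<^sub>R fam 0 H (Suc k) (Zx x, \<rho>)) +
      c' *\<^sub>R mul X (- (2 * real (k + 1) + 1) *\<^sub>R fam 1 H' (Suc k) (Zx x, \<rho>)) +
      real q *\<^sub>R Psi c c' H H' (Suc k) x + (2 * c') *\<^sub>R mul X (fam 1 H' (Suc k) (Zx x, \<rho>))"
    by (simp only: fam_pde[OF H xU] fam_pde[OF H' xU])
  also have "\<dots> = (real q - 1 - 2 * real k) *\<^sub>R Psi c c' H H' (Suc k) x"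
  proof -
    define a where "a = fam 0 H (Suc k) (Zx x, \<rho>)"
    define d where "d = mul X (fam 1 H' (Suc k) (Zx x, \<rho>))"
    have Psi: "Psi c c' H H' (Suc k) x = c *\<^sub>R a + c' *\<^sub>R d"
      by (simp add: Psi_def lift_def a_def d_def X_def \<rho>_def)
    show ?thesis
      unfolding Psi a_def[symmetric] mul_scaleR d_def[symmetric]
      by (simp add: algebra_simps) (simp flip: scaleR_add_left)
  qed
  finally show ?thesis .
qed

end

subsection \<open>The identities on a symmetric tube\<close>

lemma dfact_even: "dfact (2 * int l) = 2 ^ l * fact l"
proof -
  have "{j \<in> {1..2 * int l}. even (2 * int l - j)} = (\<lambda>i. 2 * int (Suc i)) ` {..<l}"
  proof (intro set_eqI iffI)
    fix j assume "j \<in> {j \<in> {1..2 * int l}. even (2 * int l - j)}"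
    then obtain i where i: "j = 2 * i" "1 \<le> j" "j \<le> 2 * int l" by (auto elim!: evenE)
    then have "j = 2 * int (Suc (nat (i - 1)))" "nat (i - 1) < l" by auto
    then show "j \<in> (\<lambda>i. 2 * int (Suc i)) ` {..<l}" by blast
  qed auto
  then have "dfact (2 * int l) = (\<Prod>i<l. 2 * real (Suc i))"
    unfolding dfact_def by (simp add: prod.reindex inj_on_def o_def)
  also have "\<dots> = 2 ^ l * fact l"
    by (induction l) (simp_all add: algebra_simps)
  finally show ?thesis .
qed

lemma dfact_odd: "dfact (2 * int l - 1) = odd_fact l"
proof -
  have "{j \<in> {1..2 * int l - 1}. even (2 * int l - 1 - j)} = (\<lambda>i. 2 * int i + 1) ` {..<l}"
  proof (intro set_eqI iffI)
    fix j assume j: "j \<in> {j \<in> {1..2 * int l - 1}. even (2 * int l - 1 - j)}"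
    then have "odd j" by auto
    then obtain i where "j = 2 * i + 1" by (rule oddE)
    with j have "j = 2 * int (nat i) + 1" "nat i < l" by auto
    then show "j \<in> (\<lambda>i. 2 * int i + 1) ` {..<l}" by blast
  qed auto
  then show ?thesis
    unfolding dfact_def odd_fact_def by (simp add: prod.reindex inj_on_def o_def)
qed

text \<open>Iterates the functional equation of Gamma: the j-th factor is l + 1/2 + j = (2 (l + j) +
  1) / 2.\<close>

lemma Gamma_half_add:
  "Gamma (real k + real (2 * l + 1) / 2) * odd_fact l * 2 ^ k = Gamma (real (2 * l + 1) / 2) * odd_fact (l + k)"
proof (induction k)
  case (Suc k)
  have "real (Suc k) + real (2 * l + 1) / 2 = (real k + real (2 * l + 1) / 2) + 1" by simp
  moreover have "real k + real (2 * l + 1) / 2 > 0" by (simp add: add_nonneg_pos)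
  then have "real k + real (2 * l + 1) / 2 \<notin> \<int>\<^sub>\<le>\<^sub>0" by (metis nonpos_Ints_nonpos not_less)
  note Gamma_plus1[OF this]
  ultimately have "Gamma (real (Suc k) + real (2 * l + 1) / 2) =
      (real k + real (2 * l + 1) / 2) * Gamma (real k + real (2 * l + 1) / 2)"
    by (simp only:)
  then have "Gamma (real (Suc k) + real (2 * l + 1) / 2) * odd_fact l * 2 ^ Suc k =
      (2 * real (l + k) + 1) * (Gamma (real k + real (2 * l + 1) / 2) * odd_fact l * 2 ^ k)"
  proof -
    assume eq: "Gamma (real (Suc k) + real (2 * l + 1) / 2) =
      (real k + real (2 * l + 1) / 2) * Gamma (real k + real (2 * l + 1) / 2)"
    have eq': "2 * real (l + k) + 1 = 2 * (real k + real (2 * l + 1) / 2)" by simp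
    show ?thesis unfolding eq eq' by (simp only: power_Suc mult_ac)
  qed
  also have "\<dots> = Gamma (real (2 * l + 1) / 2) * odd_fact (l + Suc k)"
    unfolding Suc by (simp add: odd_fact_Suc mult_ac)
  finally show ?case .
qed simp

lemma cancel_frac: "t \<noteq> 0 \<Longrightarrow> (a * t / d) * e / (t * t * F) = a * e / (t * F * d)" for a t d e F :: real
  by (simp add: divide_simps)

lemma cA_odd: "cA (2 * l + 1) k = odd_fact l * (- 1) ^ k / (2 ^ k * fact k * odd_fact (l + k))"
proof -
  let ?g = "Gamma (real (2 * l + 1) / 2)" and ?h = "Gamma (real k + real (2 * l + 1) / 2)"
  have pos: "?g > 0" "?h > 0" "odd_fact l > 0" "odd_fact (l + k) > 0"
    by (auto intro!: Gamma_real_pos odd_fact_pos add_nonneg_pos)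
  have "?g * odd_fact (l + k) = (odd_fact l * 2 ^ k) * ?h"
    using Gamma_half_add[of k l] by (simp only: mult_ac)
  then have "?g / ?h = odd_fact l * 2 ^ k / odd_fact (l + k)"
    by (rule frac_eq_eq[THEN iffD2, rotated 2]) (use pos in auto)
  moreover have "cA (2 * l + 1) k = (?g / ?h) * (- 1) ^ k / (2 ^ (2 * k) * fact k)"
    unfolding cA_def by (simp add: mult_ac)
  ultimately have "cA (2 * l + 1) k = (odd_fact l * 2 ^ k / odd_fact (l + k)) * (- 1) ^ k / (2 ^ (2 * k) * fact k)"
    by (simp only:)
  also have "\<dots> = odd_fact l * (- 1) ^ k / (2 ^ k * fact k * odd_fact (l + k))"
    unfolding mult_2[of k] power_add by (rule cancel_frac) simp
  finally show ?thesis .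
qed

text \<open>The additional 1 in the argument of Gamma moves the index to \<open>Suc (l + k)\<close>.
  It arises in \<open>fam_series\<close> in two ways, from n = l with i = 1 and from n =
  \<open>Suc l\<close> with i = 0, and both are used.\<close>

lemma cB_odd: "cB (2 * l + 1) k = odd_fact l * (- 1) ^ k / (2 ^ k * fact k * odd_fact (Suc (l + k)))"
proof -
  let ?g = "Gamma (real (2 * l + 1) / 2)" and ?h = "Gamma (real (Suc k) + real (2 * l + 1) / 2)"
  have pos: "?g > 0" "?h > 0" "odd_fact l > 0" "odd_fact (Suc (l + k)) > 0"
    by (auto intro!: Gamma_real_pos odd_fact_pos add_nonneg_pos)
  have "?g * odd_fact (Suc (l + k)) = (odd_fact l * 2 ^ Suc k) * ?h"
    using Gamma_half_add[of "Suc k" l] by (simp only: mult_ac add_Suc_right)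
  then have "?g / ?h = odd_fact l * 2 ^ Suc k / odd_fact (Suc (l + k))"
    by (rule frac_eq_eq[THEN iffD2, rotated 2]) (use pos in auto)
  moreover have "cB (2 * l + 1) k = (?g / ?h) * (- 1) ^ k / (2 ^ (2 * k + 1) * fact k)"
  proof -
    have "real k + real (2 * l + 1) / 2 + 1 = real (Suc k) + real (2 * l + 1) / 2" by simp
    then show ?thesis unfolding cB_def by (simp only:) (simp add: field_simps)
  qed
  ultimately have "cB (2 * l + 1) k = (odd_fact l * 2 ^ Suc k / odd_fact (Suc (l + k))) * (- 1) ^ k / (2 ^ (2 * k + 1) * fact k)"
    by (simp only:)
  also have "\<dots> = (odd_fact l * 2 ^ Suc k / odd_fact (Suc (l + k))) * (- 1) ^ k / (2 ^ Suc k * 2 ^ Suc k * (fact k / 2))"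
    unfolding mult_2[of k] power_add by simp
  also have "\<dots> = odd_fact l * (- 1) ^ k / (2 ^ Suc k * (fact k / 2) * odd_fact (Suc (l + k)))"
    by (rule cancel_frac) simp
  finally show ?thesis by simp
qed

text \<open>The source of the factor 1 / q in the identity for \<open>PO\<close>.\<close>

lemma cH_eq_cB: "q > 0 \<Longrightarrow> cH q k = real q * cB q k"
proof -
  assume q: "q > 0"
  then have "Gamma (real q / 2 + 1) = real q / 2 * Gamma (real q / 2)"
    by (intro Gamma_plus1) (metis divide_pos_pos nonpos_Ints_nonpos not_less of_nat_0_less_iff zero_less_numeral)
  then show ?thesis unfolding cH_def cB_def by (simp only:) (simp add: field_simps)
qed

section \<open>Series of radial families and restriction to the axis\<close>

context slice_setup
begin

lemma harmonic_Dw: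
  assumes w: "\<And>s. linear (w s)" and "harmonic H"
  shows "harmonic (Dw w H)"
proof -
  have H: "mvp U H" "even_r H" "\<And>x. x \<in> U \<Longrightarrow> Dr (Dr H) x = - Lz H x"
    using assms(2) by (auto simp: harmonic_def)
  have "Dr (Dr (Dw w H)) x = - Lz (Dw w H) x" if x: "x \<in> U" for x
  proof -
    have lin: "linear (\<lambda>a::'a. - a)" by (simp add: linear_iff)
    have "Dr (Dr (Dw w H)) x = Dr (Dw w (Dr H)) x"
      by (rule dderiv_cong[OF open_U x dderiv_Dw[OF w H(1)]])
    also have "\<dots> = Dw w (Dr (Dr H)) x" by (rule dderiv_Dw[OF w mvp_Dr[OF H(1)] x])
    also have "\<dots> = Dw w (\<lambda>x. - Lz H x) x" by (rule Dw_cong[OF H(3) x])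
    also have "\<dots> = - Dw w (Lz H) x"
      unfolding Dw_def
      by (simp add: dderiv_linear[OF mvp_diffble[OF mvp_Lz[OF H(1)] x] lin] linear_neg[OF w] sum_negf)
    finally show ?thesis by (simp add: Dw_Lz[OF w H(1) x])
  qed
  then show ?thesis using H by (simp add: harmonic_def mvp_Dw[OF w] even_r_Dw)
qed

lemmas harmonic_Dp = harmonic_Dw[of "\<lambda>s. mul (v s)", OF linear_mul] and harmonic_Dpb = harmonic_Dw[of vb, OF linear_vb]

lemma mvp_Lz_funpow: "mvp U H \<Longrightarrow> mvp U ((Lz ^^ k) H)"
  by (induction k) (simp_all add: mvp_Lz)

lemma Dw_Lz_funpow:
  assumes w: "\<And>s. linear (w s)"
  shows "mvp U H \<Longrightarrow> x \<in> U \<Longrightarrow> Dw w ((Lz ^^ k) H) x = (Lz ^^ k) (Dw w H) x"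
proof (induction k arbitrary: x)
  case (Suc k)
  have "Dw w (Lz ((Lz ^^ k) H)) x = Lz (Dw w ((Lz ^^ k) H)) x"
    by (intro Dw_Lz w mvp_Lz_funpow Suc.prems)
  also have "\<dots> = Lz ((Lz ^^ k) (Dw w H)) x"
    using Suc.prems by (intro Lz_cong Suc.IH)
  finally show ?case by simp
qed simp

lemmas Dp_Lz_funpow = Dw_Lz_funpow[of "\<lambda>s. mul (v s)", OF linear_mul]
  and Dpb_Lz_funpow = Dw_Lz_funpow[of vb, OF linear_vb]

lemma Lz_scaleR: "mvp U H \<Longrightarrow> x \<in> U \<Longrightarrow> Lz (\<lambda>x. c *\<^sub>R H x) x = c *\<^sub>R Lz H x"
proof -
  assume H: "mvp U H" and x: "x \<in> U"
  have 1: "Dz (b s) (\<lambda>x. c *\<^sub>R H x) y = c *\<^sub>R Dz (b s) H y" if "y \<in> U" for s y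
    by (rule dderiv_linear[OF mvp_diffble[OF H that] linear_scale_self])
  have "Dz (b s) (Dz (b s) (\<lambda>x. c *\<^sub>R H x)) x = c *\<^sub>R Dz (b s) (Dz (b s) H) x" for s
  proof -
    have "Dz (b s) (Dz (b s) (\<lambda>x. c *\<^sub>R H x)) x = Dz (b s) (\<lambda>x. c *\<^sub>R Dz (b s) H x) x"
      by (rule dderiv_cong[OF open_U x 1])
    also have "\<dots> = c *\<^sub>R Dz (b s) (Dz (b s) H) x"
      by (rule dderiv_linear[OF mvp_diffble[OF mvp_Dz[OF H] x] linear_scale_self])
    finally show ?thesis .
  qed
  then show ?thesis by (simp add: Lz_def scaleR_sum_right)
qed

lemma Drr_harmonic:
  assumes H: "harmonic H" and x: "x \<in> U"
  shows "Drr k H x = (- 1) ^ k *\<^sub>R (Lz ^^ k) H x"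
  using x
proof (induction k arbitrary: x)
  case (Suc k)
  have "Drr (Suc k) H x = - Lz (Drr k H) x"
    using harmonic_Drr[OF H, of k] Suc.prems by (simp add: harmonic_def Drr_Suc)
  also have "Lz (Drr k H) x = Lz (\<lambda>x. (- 1) ^ k *\<^sub>R (Lz ^^ k) H x) x"
    by (rule Lz_cong[OF Suc.IH Suc.prems])
  also have "\<dots> = (- 1) ^ k *\<^sub>R (Lz ^^ Suc k) H x"
    using H Suc.prems by (simp add: Lz_scaleR mvp_Lz_funpow harmonic_def)
  finally show ?case by simp
qed simp

text \<open>The value at r = 0 of the member n + k is its radial derivative of order 2 (n + k)
  divided by a double factorial, and harmonicity turns this derivative into a signed power of
  \<open>Lz\<close>. Hence the series is the Taylor series in r^2 of the n-th member, and
  \<open>radial_family_sum\<close> evaluates it.\<close>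

lemma fam_series:
  assumes H: "harmonic H" and z: "z \<in> B" and r: "0 \<le> r" "r < R"
    and sm: "summable (\<lambda>k. ((- 1) ^ (n + k) / (2 ^ k * fact k * odd_fact (n + k + i)) * r ^ (2 * k)) *\<^sub>R (Lz ^^ (n + k)) H (z, 0))"
  shows "fam i H n (z, r) =
    (\<Sum>k. ((- 1) ^ (n + k) / (2 ^ k * fact k * odd_fact (n + k + i)) * r ^ (2 * k)) *\<^sub>R (Lz ^^ (n + k)) H (z, 0))"
proof -
  have m: "mvp U H" "even_r H" using H by (auto simp: harmonic_def)
  obtain C L where CL: "C \<ge> 0" "L \<ge> 0" "\<And>k r'. \<bar>r'\<bar> \<le> \<bar>r\<bar> \<Longrightarrow> norm (fam i H k (z, r')) \<le> C * L ^ k * fact k"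
    using fam_bound[OF m(1) z, of r i] r by auto
  have eq: "((- 1) ^ (n + k) / (2 ^ k * fact k * odd_fact (n + k + i)) * r ^ (2 * k)) *\<^sub>R (Lz ^^ (n + k)) H (z, 0) =
      (r ^ (2 * k) / (2 ^ k * fact k)) *\<^sub>R fam i H (n + k) (z, 0)" for k
  proof -
    have "odd_fact (n + k + i) *\<^sub>R fam i H (n + k) (z, 0) = (- 1) ^ (n + k) *\<^sub>R (Lz ^^ (n + k)) H (z, 0)"
      using fam_at_0[OF m z, of "n + k" i] Drr_harmonic[OF H, of "(z, 0)" "n + k"] z R_pos by simp
    then have "fam i H (n + k) (z, 0) = ((- 1) ^ (n + k) / odd_fact (n + k + i)) *\<^sub>R (Lz ^^ (n + k)) H (z, 0)"
      using odd_fact_pos[of "n + k + i"] by (metis (no_types) divide_inverse_commute less_irrefl scaleR_scaleR left_inverse scaleR_one)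
    then show ?thesis by (simp add: mult_ac)
  qed
  have "(\<Sum>k. (r ^ (2 * k) / (2 ^ k * fact k)) *\<^sub>R fam i H (n + k) (z, 0)) = fam i H (n + 0) (z, r)"
  \<comment> \<open>The family is started at n; splitting (n + k)! absorbs this shift into the
    constants.\<close>
  proof (rule radial_family_sum[where g = "\<lambda>k r. fam i H (n + k) (z, r)" and C = "C * (2 * L) ^ n * fact n" and L = "2 * L"])
    show "((\<lambda>r. fam i H (n + k) (z, r)) has_vector_derivative r' *\<^sub>R fam i H (n + Suc k) (z, r')) (at r')"
      if "0 < r'" "r' < r" for k r'
      using fam_line_r[OF m z, of r' i "n + k" UNIV] that r by simp
    show "continuous_on {0..r} (\<lambda>r. fam i H (n + k) (z, r))" for k
      using r z by (intro continuous_on_compose2[OF continuous_on_fam[OF m(1)]] continuous_intros) auto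
    show "norm (fam i H (n + k) (z, r')) \<le> C * (2 * L) ^ n * fact n * (2 * L) ^ k * fact k" if "r' \<in> {0..r}" for k r'
    proof -
      have "norm (fam i H (n + k) (z, r')) \<le> C * L ^ (n + k) * fact (n + k)"
        using that r by (intro CL(3)) auto
      also have "\<dots> \<le> C * L ^ (n + k) * (2 ^ (n + k) * fact n * fact k)"
        using CL by (intro mult_left_mono fact_add_le) auto
      also have "\<dots> = C * (2 * L) ^ n * fact n * (2 * L) ^ k * fact k"
        by (simp add: power_mult_distrib power_add)
      finally show ?thesis .
    qed
    show "summable (\<lambda>k. (r ^ (2 * k) / (2 ^ k * fact k)) *\<^sub>R fam i H (n + k) (z, 0))"
      using sm unfolding eq .
  qed (use CL r in auto)
  then show ?thesis unfolding eq by simp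
qed

text \<open>The terms of the series are functions on R^(p+1), whereas the mean value property lives
  on the cylinder. The relation survives every operator along \<open>v 0\<close>, ...,
  \<open>v p\<close>, because these derivatives never leave R^(p+1).\<close>

definition restricts :: "('a \<Rightarrow> 'a) \<Rightarrow> ('a \<times> real \<Rightarrow> 'a) \<Rightarrow> bool" where
  "restricts g H \<longleftrightarrow> (\<forall>z\<in>B. g (T z) = H (z, 0))"

lemma restricts_pd:
  assumes "restricts g H" "s \<le> p"
  shows "restricts (pd v s g) (Dz (b s) H)"
  unfolding restricts_def
proof
  fix z assume z: "z \<in> B"
  have "\<forall>\<^sub>F t in nhds (0 :: real). t \<in> {t. z + t *\<^sub>R b s \<in> B}"
    using z by (intro eventually_nhds_in_open open_line open_B) simp
  then have "\<forall>\<^sub>F t in nhds 0. g (T z + t *\<^sub>R v s) = H ((z, 0) + t *\<^sub>R (b s, 0))"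
  proof eventually_elim
    case (elim t)
    have "g (T z + t *\<^sub>R v s) = g (T (z + t *\<^sub>R b s))"
      using assms(2) by (simp add: linear_add[OF linear_T] linear_scale[OF linear_T] T_b)
    then show ?case using elim assms(1) by (simp add: restricts_def)
  qed
  then show "pd v s g (T z) = Dz (b s) H (z, 0)"
    unfolding pd_def dderiv_def by (intro vector_derivative_cong_eq) (auto elim: eventually_mono)
qed

lemma restricts_Lap: "restricts g H \<Longrightarrow> restricts (Lap v p g) (Lz H)"
  using restricts_pd[OF restricts_pd, of g H] by (simp add: restricts_def Lap_def Lz_def atLeast0AtMost)

lemma restricts_Lap_funpow: "restricts g H \<Longrightarrow> restricts ((Lap v p ^^ k) g) ((Lz ^^ k) H)"
  by (induction k) (simp_all add: restricts_Lap)

lemma restricts_Dxp: "restricts g H \<Longrightarrow> restricts (Dxp mul v p g) (Dp H)"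
  using restricts_pd[of g H] by (simp add: restricts_def Dxp_def Dw_def atLeast0AtMost)

lemma Dbar_eq: "n \<le> m \<Longrightarrow> Dbar mul v n g y = (\<Sum>s\<le>n. vb s (pd v s g y))"
proof -
  have "{..n} = insert 0 {1..n}" by auto
  then show ?thesis by (simp add: Dbar_def vb_def sum_negf)
qed

lemma restricts_Dbar: "restricts g H \<Longrightarrow> restricts (Dbar mul v p g) (Dpb H)"
  using restricts_pd[of g H] pm by (simp add: restricts_def Dbar_eq Dw_def)

lemma Drr_Dw:
  assumes w: "\<And>s. linear (w s)"
  shows "mvp U H \<Longrightarrow> y \<in> U \<Longrightarrow> Drr k (Dw w H) y = Dw w (Drr k H) y"
proof (induction k arbitrary: y)
  case (Suc k)
  have mk: "mvp U (Drr k H)" by (rule mvp_Drr[OF Suc.prems(1)])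
  have "Dr (Drr k (Dw w H)) y = Dw w (Dr (Drr k H)) y" if "y \<in> U" for y
    using dderiv_cong[OF open_U that Suc.IH[OF Suc.prems(1)]] dderiv_Dw[OF w mk that] by simp
  from dderiv_cong[OF open_U Suc.prems(2) this] dderiv_Dw[OF w mvp_Dr[OF mk] Suc.prems(2)]
  show ?case by (simp add: Drr_Suc)
qed simp

lemma fam_Dw:
  assumes w: "\<And>s. linear (w s)" and H: "mvp U H" and x: "x \<in> U"
  shows "(\<Sum>s\<le>p. w s (fam i (Dz (b s) H) k x)) = fam i (Dw w H) k x"
proof -
  have mk: "mvp U (Drr k H)" by (rule mvp_Drr[OF H])
  have "fam i (Dw w H) k x = Jop (k + i) (Dw w (Drr k H)) x"
    unfolding fam_def by (rule Jop_cong[OF Drr_Dw[OF w H] x])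
  also have "\<dots> = (\<Sum>s\<le>p. Jop (k + i) (\<lambda>y. w s (Dz (b s) (Drr k H) y)) x)"
    unfolding Dw_def[abs_def]
    using x by (intro Jop_sum mvp_imp_continuous_on mvp_linear[OF mvp_Dz[OF mk]] w) auto
  also have "\<dots> = (\<Sum>s\<le>p. w s (Jop (k + i) (Dz (b s) (Drr k H)) x))"
    using x by (intro sum.cong refl Jop_linear mvp_imp_continuous_on mvp_Dz mk w) auto
  also have "\<dots> = (\<Sum>s\<le>p. w s (fam i (Dz (b s) H) k x))"
    unfolding fam_def using x Drr_Dz[OF H]
    by (intro sum.cong refl arg_cong[where f = "w _"] Jop_cong) auto
  finally show ?thesis by simp
qed

lemmas fam_Dp = fam_Dw[of "\<lambda>s. mul (v s)", OF linear_mul] and fam_Dpb = fam_Dw[of vb, OF linear_vb]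

text \<open>For s \<le> p, moving x_q to the left undoes the conjugation of the weight, so
  \<open>Dpb\<close> acts on the even profile and \<open>Dp\<close> on the odd one. The directions s
  > p add up to -x_q times the next \<open>Psi\<close>, where x_q^2 = -r^2, plus q copies of the odd
  profile, one for each -v_s^2 = 1.\<close>

lemma Dbar_Psi:
  assumes H: "harmonic H" and H': "harmonic H'" and x: "x \<in> N"
  shows "Dbar mul v m (Psi c c' H H' k) x =
    c *\<^sub>R (lift (fam 0 (Dpb H) k) x - mul (xq v m p x) (lift (fam 0 H (Suc k)) x)) +
    c' *\<^sub>R (mul (xq v m p x) (lift (fam 1 (Dp H') k) x) + (rad v m p x)\<^sup>2 *\<^sub>R lift (fam 1 H' (Suc k)) x + real q *\<^sub>R lift (fam 1 H' k) x)"
proof -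
  have m: "mvp U H" "even_r H" "mvp U H'" "even_r H'" using H H' by (auto simp: harmonic_def)
  define X where "X = xq v m p x"
  have xU: "(Zx x, rad v m p x) \<in> U" using N_D[OF x] by auto
  define P where "P = Psi c c' H H' (Suc k) x"
  define F where "F = lift (fam 1 H' k) x"
  have low: "vb s (pd v s (Psi c c' H H' k) x) = c *\<^sub>R vb s (lift (fam 0 (Dz (b s) H) k) x) +
      c' *\<^sub>R mul X (mul (v s) (lift (fam 1 (Dz (b s) H') k) x))" if "s \<le> p" for s
  proof -
    have "pd v s (Psi c c' H H' k) x = Psi c c' (Dz (b s) H) (Dz (b s) H') k x"
      by (intro pd_eqI Psi_low m x that)
    then show ?thesis
      using vb_mul_xq[OF that, of x]
      by (simp add: Psi_def linear_add[OF linear_vb] linear_scale[OF linear_vb] X_def)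
  qed
  have high: "vb s (pd v s (Psi c c' H H' k) x) = - (coord v m x s *\<^sub>R mul (v s) P) + c' *\<^sub>R F"
    if s: "s \<in> {Suc p..m}" for s
  proof -
    have "pd v s (Psi c c' H H' k) x = coord v m x s *\<^sub>R P + c' *\<^sub>R mul (v s) F"
      unfolding P_def F_def by (intro pd_eqI Psi_high m x s)
    moreover have "mul (v s) (mul (v s) F) = - F" using s by (intro mul_v_v_mul) auto
    ultimately show ?thesis using s by (simp add: vb_def mul_add mul_scaleR)
  qed
  have "Dbar mul v m (Psi c c' H H' k) x =
      (\<Sum>s\<le>p. vb s (pd v s (Psi c c' H H' k) x)) + (\<Sum>s\<in>{Suc p..m}. vb s (pd v s (Psi c c' H H' k) x))"
    using sum_split_p[of "\<lambda>s. vb s (pd v s (Psi c c' H H' k) x)"] by (simp add: Dbar_eq atLeast0AtMost)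
  also have "(\<Sum>s\<le>p. vb s (pd v s (Psi c c' H H' k) x)) =
      (\<Sum>s\<le>p. c *\<^sub>R vb s (lift (fam 0 (Dz (b s) H) k) x) + c' *\<^sub>R mul X (mul (v s) (lift (fam 1 (Dz (b s) H') k) x)))"
    using low by (intro sum.cong) auto
  also have "\<dots> = c *\<^sub>R lift (fam 0 (Dpb H) k) x + c' *\<^sub>R mul X (lift (fam 1 (Dp H') k) x)"
    unfolding lift_def fam_Dp[OF m(3) xU, symmetric] fam_Dpb[OF m(1) xU, symmetric]
    by (simp add: sum.distrib scaleR_sum_right mul_sum)
  also have "(\<Sum>s\<in>{Suc p..m}. vb s (pd v s (Psi c c' H H' k) x)) =
      (\<Sum>s\<in>{Suc p..m}. - (coord v m x s *\<^sub>R mul (v s) P) + c' *\<^sub>R F)"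
    using high by (intro sum.cong) auto
  also have "\<dots> = - mul X P + (real q * c') *\<^sub>R F"
    using pm by (simp add: sum.distrib sum_subtractf sum_negf X_def xq_def mul_sum_left mul_scaleR_left sum_constant_scaleR)
  also have "mul X P = c *\<^sub>R mul X (lift (fam 0 H (Suc k)) x) - (c' * (rad v m p x)\<^sup>2) *\<^sub>R lift (fam 1 H' (Suc k)) x"
    unfolding P_def Psi_def X_def by (simp add: mul_add mul_scaleR mul_xq_sq)
  finally show ?thesis by (simp add: F_def X_def algebra_simps)
qed

text \<open>The recurrence of the averages has coefficient 2k + 1, which at this level is exactly q.
  This is where the two radial terms produced by \<open>Dbar\<close> contract to a single family
  member.\<close>

lemma radial_euler:
  assumes H: "mvp U H" "even_r H" and x: "x \<in> N" and q: "q = 2 * k + 1"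
  shows "(rad v m p x)\<^sup>2 *\<^sub>R lift (fam 1 H (Suc k)) x + real q *\<^sub>R lift (fam 1 H k) x = lift (fam 0 H k) x"
proof -
  have "real q = 2 * real k + 1" using q by simp
  then show ?thesis
    using Jop_recurrence[OF mvp_Drr even_r_Drr, OF H(1,1,2) N_D(4)[OF x], of k k]
    unfolding lift_def fam_def Drr_Suc by (simp only: add_Suc_right add_0_right One_nat_def add_Suc)
qed

lemma PE_Psi:
  assumes "\<And>y. y \<in> N \<Longrightarrow> g y = Psi c c' H H' k y" "x \<in> N"
  shows "PE v m p g x = Psi c 0 H H' k x" "PO v m p g x = Psi 0 c' H H' k x"
proof -
  have "Psi c c' H H' k (xdiam v m p x) = c *\<^sub>R lift (fam 0 H k) x - c' *\<^sub>R mul (xq v m p x) (lift (fam 1 H' k) x)"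
    using xdiam_facts[OF N_D(1)[OF assms(2)]] Zx_xdiam[OF assms(2)]
    by (simp add: Psi_def lift_def mul_minus_left)
  then show "PE v m p g x = Psi c 0 H H' k x" "PO v m p g x = Psi 0 c' H H' k x"
    unfolding PE_def PO_def assms(1)[OF assms(2)] assms(1)[OF xdiam_N[OF assms(2)]]
    by (simp_all add: Psi_def flip: scaleR_2)
qed

end

lemma Lap_zero_funpow: "(Lap v n ^^ k) (\<lambda>_::'a::real_normed_vector. 0::'b::real_normed_vector) = (\<lambda>_. 0)"
proof -
  have "dderiv (\<lambda>_::'a. 0::'b) u = (\<lambda>_. 0)" for u :: 'a by (rule ext) simp
  then have "Lap v n (\<lambda>_::'a. 0::'b) = (\<lambda>_. 0)" by (simp add: Lap_def[abs_def] pd_def)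
  then show ?thesis by (induction k) simp_all
qed

section \<open>The identities for a slice function\<close>

context slice_function
begin

lemma harmonic_\<alpha>': "harmonic \<alpha>"
  by (simp add: harmonic_def mvp_\<alpha> even_r_\<alpha> harmonic_\<alpha>)

lemma f_eq_Psi:
  assumes x: "x \<in> N"
  shows "f x = Psi 1 1 \<alpha> (Dp \<alpha>) 0 x"
proof -
  define r where "r = rad v m p x"
  have r: "r \<ge> 0" "r < R" using N_D[OF x] rad_nonneg by (auto simp: r_def)
  obtain \<eta> where \<eta>: "\<eta> \<in> sphS v m p" "xq v m p x = r *\<^sub>R \<eta>"
    unfolding r_def by (rule xq_polar)
  have "x = T (Zx x) + r *\<^sub>R \<eta>"
    unfolding T_Zx \<eta>(2)[symmetric] by (rule Msp_eq_xp_xq[OF N_D(1)[OF x]])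
  then have "f x = \<alpha> (Zx x, r) + mul \<eta> (\<beta> (Zx x, r))"
    using representation[OF \<eta>(1) N_D(2)[OF x] r] by simp
  also have "\<beta> (Zx x, r) = r *\<^sub>R Jop 1 (Dp \<alpha>) (Zx x, r)"
    using N_D(2)[OF x] r by (intro \<beta>_eq_Jop) auto
  finally show ?thesis
    unfolding Psi_def \<eta>(2) lift_def fam_def r_def[symmetric]
    by (simp add: mul_scaleR mul_scaleR_left)
qed

lemma Lap_funpow_f:
  assumes "x \<in> N"
  shows "(Lap v m ^^ k) f x = Psi (\<Prod>j<k. real q - 1 - 2 * real j) (\<Prod>j<k. real q - 1 - 2 * real j) \<alpha> (Dp \<alpha>) k x"
  using assms
proof (induction k arbitrary: x)
  case (Suc k)
  let ?c = "\<Prod>j<k. real q - 1 - 2 * real j"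
  have "(Lap v m ^^ Suc k) f x = Lap v m ((Lap v m ^^ k) f) x" by simp
  also have "\<dots> = Lap v m (Psi ?c ?c \<alpha> (Dp \<alpha>) k) x"
    by (rule Lap_cong_N[OF Suc.prems Suc.IH])
  also have "\<dots> = (real q - 1 - 2 * real k) *\<^sub>R Psi ?c ?c \<alpha> (Dp \<alpha>) (Suc k) x"
    by (intro Lap_Psi harmonic_\<alpha>' harmonic_Dp Suc.prems)
  finally show ?case by (simp add: Psi_def scaleR_add_right mult.commute)
qed (simp add: f_eq_Psi)

lemma restricts_f: "restricts f \<alpha>"
  by (simp add: restricts_def \<alpha>_0)

text \<open>The datum already carries l powers of \<open>Lz\<close>, so the k-th term of its series
  is the coefficient of index l + k in \<open>fam_series\<close>. The numerator
  \<open>odd_fact l\<close> of \<open>cA_odd\<close> is what remains as the constant.\<close>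

lemma gck_ser1_sum:
  assumes H: "harmonic H" and g: "restricts g ((Lz ^^ l) H)" and x: "x \<in> N" and q: "q = 2 * l + 1"
    and sm: "summable (gck_ser1 v m p g x)"
  shows "lift (fam 0 H l) x = ((- 1) ^ l / odd_fact l) *\<^sub>R suminf (gck_ser1 v m p g x)"
proof -
  have eq: "((- 1) ^ (l + k) / (2 ^ k * fact k * odd_fact (l + k + 0)) * rad v m p x ^ (2 * k)) *\<^sub>R (Lz ^^ (l + k)) H (Zx x, 0) =
      ((- 1) ^ l / odd_fact l) *\<^sub>R gck_ser1 v m p g x k" for k
  proof -
    have "((Lap v p ^^ k) g) (xp v m p x) = (Lz ^^ (k + l)) H (Zx x, 0)"
      using restricts_Lap_funpow[OF g, of k] N_D[OF x] by (simp add: restricts_def T_Zx[symmetric] funpow_add)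
    moreover have "cA q k = odd_fact l * (- 1) ^ k / (2 ^ k * fact k * odd_fact (l + k))"
      by (simp only: q cA_odd)
    ultimately show ?thesis
      using odd_fact_pos[of l] by (simp add: gck_ser1_def power_add add.commute mult_ac)
  qed
  from fam_series[OF H N_D(2)[OF x] rad_nonneg N_D(5)[OF x], where i = 0 and n = l, unfolded eq, OF summable_scaleR_right[OF sm]]
  have "fam 0 H l (Zx x, rad v m p x) = (\<Sum>k. ((- 1) ^ l / odd_fact l) *\<^sub>R gck_ser1 v m p g x k)" .
  then show ?thesis by (simp add: lift_def suminf_scaleR_right[OF sm])
qed

lemma gck_ser2_sum:
  assumes H: "harmonic H" and g: "restricts (Dxp mul v p g) ((Lz ^^ l) H)" and x: "x \<in> N" and q: "q = 2 * l + 1"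
    and sm: "summable (gck_ser2 mul v m p g x)"
  shows "lift (fam 1 H l) x = ((- 1) ^ l / odd_fact l) *\<^sub>R suminf (gck_ser2 mul v m p g x)"
proof -
  have eq: "((- 1) ^ (l + k) / (2 ^ k * fact k * odd_fact (l + k + 1)) * rad v m p x ^ (2 * k)) *\<^sub>R (Lz ^^ (l + k)) H (Zx x, 0) =
      ((- 1) ^ l / odd_fact l) *\<^sub>R gck_ser2 mul v m p g x k" for k
  proof -
    have "((Lap v p ^^ k) (Dxp mul v p g)) (xp v m p x) = (Lz ^^ (k + l)) H (Zx x, 0)"
      using restricts_Lap_funpow[OF g, of k] N_D[OF x] by (simp add: restricts_def T_Zx[symmetric] funpow_add)
    moreover have "cB q k = odd_fact l * (- 1) ^ k / (2 ^ k * fact k * odd_fact (Suc (l + k)))"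
      by (simp only: q cB_odd)
    ultimately show ?thesis
      using odd_fact_pos[of l] by (simp add: gck_ser2_def power_add add.commute mult_ac)
  qed
  from fam_series[OF H N_D(2)[OF x] rad_nonneg N_D(5)[OF x], where i = 1 and n = l, unfolded eq, OF summable_scaleR_right[OF sm]]
  have "fam 1 H l (Zx x, rad v m p x) = (\<Sum>k. ((- 1) ^ l / odd_fact l) *\<^sub>R gck_ser2 mul v m p g x k)" .
  then show ?thesis by (simp add: lift_def suminf_scaleR_right[OF sm])
qed

text \<open>For data of the form \<open>Dpb (Lz^l H)\<close>, applying \<open>Dp\<close> completes
  one more Laplacian. The second GCK series then belongs to member \<open>Suc l\<close> of the even
  family, and the odd number of extra signs gives the minus.\<close>

lemma gck_ser2_sum_shift:
  assumes H: "harmonic H" and g: "restricts (Dxp mul v p g) ((Lz ^^ Suc l) H)" and x: "x \<in> N" and q: "q = 2 * l + 1"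
    and sm: "summable (gck_ser2 mul v m p g x)"
  shows "lift (fam 0 H (Suc l)) x = - ((- 1) ^ l / odd_fact l) *\<^sub>R suminf (gck_ser2 mul v m p g x)"
proof -
  have eq: "((- 1) ^ (Suc l + k) / (2 ^ k * fact k * odd_fact (Suc l + k + 0)) * rad v m p x ^ (2 * k)) *\<^sub>R (Lz ^^ (Suc l + k)) H (Zx x, 0) =
      (- ((- 1) ^ l / odd_fact l)) *\<^sub>R gck_ser2 mul v m p g x k" for k
  proof -
    have "((Lap v p ^^ k) (Dxp mul v p g)) (xp v m p x) = (Lz ^^ (k + Suc l)) H (Zx x, 0)"
      using restricts_Lap_funpow[OF g, of k] N_D[OF x]
      unfolding funpow_add by (simp add: restricts_def T_Zx[symmetric])
    moreover have "cB q k = odd_fact l * (- 1) ^ k / (2 ^ k * fact k * odd_fact (Suc (l + k)))"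
      by (simp only: q cB_odd)
    ultimately show ?thesis
      using odd_fact_pos[of l] by (simp add: gck_ser2_def power_add add.commute mult_ac del: funpow.simps)
  qed
  from fam_series[OF H N_D(2)[OF x] rad_nonneg N_D(5)[OF x], where i = 0 and n = "Suc l", unfolded eq, OF summable_scaleR_right[OF sm]]
  have "fam 0 H (Suc l) (Zx x, rad v m p x) = (\<Sum>k. (- ((- 1) ^ l / odd_fact l)) *\<^sub>R gck_ser2 mul v m p g x k)" .
  then show ?thesis by (simp only: lift_def suminf_scaleR_right[OF sm])
qed

lemma hgck_ser2_sum:
  assumes H: "harmonic H" and g: "restricts g ((Lz ^^ l) H)" and x: "x \<in> N" and q: "q = 2 * l + 1"
    and sm: "summable (hgck_ser2 v m p g x)"
  shows "lift (fam 1 H l) x = ((- 1) ^ l / odd_fact l / real q) *\<^sub>R suminf (hgck_ser2 v m p g x)"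
proof -
  have eq: "((- 1) ^ (l + k) / (2 ^ k * fact k * odd_fact (l + k + 1)) * rad v m p x ^ (2 * k)) *\<^sub>R (Lz ^^ (l + k)) H (Zx x, 0) =
      ((- 1) ^ l / odd_fact l / real q) *\<^sub>R hgck_ser2 v m p g x k" for k
  proof -
    have 1: "((Lap v p ^^ k) g) (xp v m p x) = (Lz ^^ (l + k)) H (Zx x, 0)"
      using restricts_Lap_funpow[OF g, of k] N_D[OF x] by (simp add: restricts_def T_Zx[symmetric] funpow_add add.commute[of l])
    have 2: "cH q k = real q * cB q k" using q by (intro cH_eq_cB) simp
    have "(- 1) ^ l / odd_fact l / real q * (cH q k * rad v m p x ^ (2 * k)) =
       (- 1) ^ (l + k) / (2 ^ k * fact k * odd_fact (l + k + 1)) * rad v m p x ^ (2 * k)"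
    proof -
      have "cB q k = odd_fact l * (- 1) ^ k / (2 ^ k * fact k * odd_fact (Suc (l + k)))"
        by (simp only: q cB_odd)
      moreover have "real q \<noteq> 0" using q by simp
      ultimately show ?thesis
        unfolding 2 using odd_fact_pos[of l] by (simp add: power_add mult_ac del: of_nat_diff)
    qed
    then show ?thesis by (simp add: hgck_ser2_def 1)
  qed
  from fam_series[OF H N_D(2)[OF x] rad_nonneg N_D(5)[OF x], where i = 1 and n = l, unfolded eq, OF summable_scaleR_right[OF sm]]
  have "fam 1 H l (Zx x, rad v m p x) = (\<Sum>k. ((- 1) ^ l / odd_fact l / real q) *\<^sub>R hgck_ser2 v m p g x k)" .
  then show ?thesis by (simp only: lift_def suminf_scaleR_right[OF sm])
qed

lemma gamma_q_eq:
  assumes "q = 2 * l + 1"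
  shows "(\<Prod>j<l. real q - 1 - 2 * real j) * ((- 1) ^ l / odd_fact l) = gamma_q q"
proof -
  have "(\<Prod>j<l. real q - 1 - 2 * real j) = (\<Prod>j<l. 2 * (real l - real j))"
    using assms by (simp add: algebra_simps)
  also have "\<dots> = 2 ^ l * (\<Prod>j<l. real l - real j)" by (simp only: prod.distrib prod_constant card_lessThan)
  also have "(\<Prod>j<l. real l - real j) = fact l"
  proof -
    have "(fact l :: real) = of_nat (\<Prod>{1..l})" by (simp add: fact_prod)
    also have "\<Prod>{1..l} = (\<Prod>j<l. l - j)"
      by (rule prod.reindex_bij_witness[of _ "\<lambda>j. l - j" "\<lambda>j. l - j"]) auto
    finally show ?thesis by (simp add: of_nat_diff)
  qed
  finally show ?thesis
    using assms dfact_even[of l] dfact_odd[of l] by (simp add: gamma_q_def)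
qed

theorem slice_identities:
  assumes q: "q = 2 * l + 1" and x: "x \<in> N"
  shows "HGCK_defined v m p (\<lambda>_. 0) ((Lap v p ^^ l) (Dxp mul v p f)) x \<Longrightarrow>
        PO v m p ((Lap v m ^^ l) f) x =
        (gamma_q q / real q) *\<^sub>R HGCK mul v m p (\<lambda>_. 0) ((Lap v p ^^ l) (Dxp mul v p f)) x" (is "?A \<Longrightarrow> ?A'")
    and "HGCK_defined v m p ((Lap v p ^^ l) f) (\<lambda>_. 0) x \<Longrightarrow>
        PE v m p ((Lap v m ^^ l) f) x = gamma_q q *\<^sub>R HGCK mul v m p ((Lap v p ^^ l) f) (\<lambda>_. 0) x" (is "?B \<Longrightarrow> ?B'")
    and "GCK_defined mul v m p ((Lap v p ^^ l) (Dxp mul v p f)) x \<Longrightarrow>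
        Dbar mul v m (PO v m p ((Lap v m ^^ l) f)) x =
        gamma_q q *\<^sub>R GCK mul v m p ((Lap v p ^^ l) (Dxp mul v p f)) x" (is "?C \<Longrightarrow> ?C'")
    and "GCK_defined mul v m p (Dbar mul v p ((Lap v p ^^ l) f)) x \<Longrightarrow>
        Dbar mul v m (PE v m p ((Lap v m ^^ l) f)) x =
        gamma_q q *\<^sub>R GCK mul v m p (Dbar mul v p ((Lap v p ^^ l) f)) x" (is "?D \<Longrightarrow> ?D'")
proof -
  define c where "c = (\<Prod>j<l. real q - 1 - 2 * real j)"
  define \<kappa> where "\<kappa> = (- 1) ^ l / odd_fact l"
  have c: "gamma_q q = c * \<kappa>" using gamma_q_eq[OF q] by (simp add: c_def \<kappa>_def)
  define g where "g = (Lap v m ^^ l) f"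
  have g: "g y = Psi c c \<alpha> (Dp \<alpha>) l y" if "y \<in> N" for y
    unfolding g_def c_def by (rule Lap_funpow_f[OF that])
  have h\<alpha>: "harmonic \<alpha>" and hD: "harmonic (Dp \<alpha>)" and mD: "mvp U (Dp \<alpha>)"
    by (simp_all add: harmonic_\<alpha>' harmonic_Dp mvp_Dp mvp_\<alpha>)
  have PE: "PE v m p g y = Psi c 0 \<alpha> (Dp \<alpha>) l y" and PO: "PO v m p g y = Psi 0 c \<alpha> (Dp \<alpha>) l y" if "y \<in> N" for y
    using PE_Psi[OF g that] by auto
  have U0: "(z, 0) \<in> U" if "z \<in> B" for z using that R_pos by simp
  have r1: "restricts ((Lap v p ^^ l) f) ((Lz ^^ l) \<alpha>)"
    by (rule restricts_Lap_funpow[OF restricts_f])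
  have r2: "restricts ((Lap v p ^^ l) (Dxp mul v p f)) ((Lz ^^ l) (Dp \<alpha>))"
    by (rule restricts_Lap_funpow[OF restricts_Dxp[OF restricts_f]])
  have zero1: "gck_ser1 v m p (\<lambda>_. 0) x = (\<lambda>_. 0)"
    by (simp add: gck_ser1_def[abs_def] Lap_zero_funpow)
  have zero2: "hgck_ser2 v m p (\<lambda>_. 0) x = (\<lambda>_. 0)"
    by (simp add: hgck_ser2_def[abs_def] Lap_zero_funpow)
  show ?A' if ?A
    using hgck_ser2_sum[OF hD r2 x q] that unfolding g_def[symmetric] PO[OF x] c
    by (simp add: HGCK_defined_def HGCK_def zero1 Psi_def \<kappa>_def mul_scaleR)
  show ?B' if ?B
    using gck_ser1_sum[OF h\<alpha> r1 x q] that unfolding g_def[symmetric] PE[OF x] c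
    by (simp add: HGCK_defined_def HGCK_def zero2 Psi_def \<kappa>_def mul_0)
  show ?C' if ?C
  proof -
    have "restricts (Dxp mul v p ((Lap v p ^^ l) (Dxp mul v p f))) (Dp ((Lz ^^ l) (Dp \<alpha>)))"
      by (rule restricts_Dxp[OF r2])
    then have r3: "restricts (Dxp mul v p ((Lap v p ^^ l) (Dxp mul v p f))) ((Lz ^^ l) (Dp (Dp \<alpha>)))"
      using U0 by (simp add: restricts_def Dp_Lz_funpow[OF mD])
    have "Dbar mul v m (PO v m p g) x = Dbar mul v m (Psi 0 c \<alpha> (Dp \<alpha>) l) x"
      unfolding Dbar_eq[OF order_refl] by (intro sum.cong refl arg_cong[where f = "vb _"] pd_cong_N[OF x] PO) auto
    \<comment> \<open>\<open>radial_euler\<close> merges the last two terms of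
      \<open>Dbar_Psi\<close> into a member of the even family, which carries the first GCK
      series.\<close>
    also have "\<dots> = c *\<^sub>R (mul (xq v m p x) (lift (fam 1 (Dp (Dp \<alpha>)) l) x) + lift (fam 0 (Dp \<alpha>) l) x)"
      using radial_euler[OF mD even_r_Dw[OF mvp_\<alpha> even_r_\<alpha>] x q] by (simp add: Dbar_Psi[OF h\<alpha> hD x] add.assoc)
    finally show ?thesis
      using gck_ser1_sum[OF hD r2 x q] gck_ser2_sum[OF harmonic_Dp[OF hD] r3 x q] that
      unfolding g_def[symmetric] c
      by (simp add: GCK_defined_def GCK_def \<kappa>_def[symmetric] mul_scaleR scaleR_add_right add.commute)
  qed
  show ?D' if ?D
  proof -
    have "restricts (Dbar mul v p ((Lap v p ^^ l) f)) (Dpb ((Lz ^^ l) \<alpha>))"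
      by (rule restricts_Dbar[OF r1])
    then have r4: "restricts (Dbar mul v p ((Lap v p ^^ l) f)) ((Lz ^^ l) (Dpb \<alpha>))"
      using U0 by (simp add: restricts_def Dpb_Lz_funpow[OF mvp_\<alpha>])
    have "restricts (Dxp mul v p (Dbar mul v p ((Lap v p ^^ l) f))) (Dp (Dpb ((Lz ^^ l) \<alpha>)))"
      by (intro restricts_Dxp restricts_Dbar r1)
    then have r5: "restricts (Dxp mul v p (Dbar mul v p ((Lap v p ^^ l) f))) ((Lz ^^ Suc l) \<alpha>)"
      using U0 by (simp add: restricts_def Dp_Dpb[OF mvp_Lz_funpow[OF mvp_\<alpha>]])
    have "Dbar mul v m (PE v m p g) x = Dbar mul v m (Psi c 0 \<alpha> (Dp \<alpha>) l) x"
      unfolding Dbar_eq[OF order_refl] by (intro sum.cong refl arg_cong[where f = "vb _"] pd_cong_N[OF x] PE) auto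
    \<comment> \<open>The minus sign cancels against the one in
      \<open>gck_ser2_sum_shift\<close>.\<close>
    also have "\<dots> = c *\<^sub>R (lift (fam 0 (Dpb \<alpha>) l) x - mul (xq v m p x) (lift (fam 0 \<alpha> (Suc l)) x))"
      by (simp add: Dbar_Psi[OF h\<alpha> hD x])
    finally show ?thesis
      using gck_ser1_sum[OF harmonic_Dpb[OF h\<alpha>] r4 x q] gck_ser2_sum_shift[OF h\<alpha> r5 x q] that
      unfolding g_def[symmetric] c
      by (simp add: GCK_defined_def GCK_def \<kappa>_def[symmetric] mul_scaleR mul_minus scaleR_add_right)
  qed
qed

end

section \<open>Construction of the tube\<close>

lemma dist_Pair_lt:
  assumes "dist z z' < d / 2" "\<bar>t - t'\<bar> < d / 2"
  shows "dist (z, t) (z', t' :: real) < d"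
proof -
  have "dist (z, t) (z', t') \<le> dist z z' + \<bar>t - t'\<bar>"
    using sqrt_sum_squares_le_sum[of "dist z z'" "\<bar>t - t'\<bar>"] by (simp add: dist_Pair_Pair dist_real_def)
  then show ?thesis using assms by linarith
qed

context slice_setup
begin

lemma T_in_Rp: "T z \<in> Rp v p"
  unfolding T_def Rp_def by (intro span_sum span_scale span_base) auto

lemma T_in_Msp: "T z \<in> Msp v m"
  unfolding T_def using pm by (intro subspace_sum subspace_scale subspace_Msp v_in_Msp) auto

lemma sphS_in_Msp: "\<eta> \<in> sphS v m p \<Longrightarrow> \<eta> \<in> Msp v m"
  by (auto simp: sphS_def intro!: subspace_sum subspace_scale subspace_Msp v_in_Msp)

text \<open>f is differentiable only within the plane of a slice. The linear parametrization
  \<open>L\<close> has its range in that plane, so the chain rule still yields a derivative of the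
  pullback in the full product space.\<close>

lemma slice_functionI:
  assumes f: "gpsm mul v m p \<Omega> f" and tube: "\<And>\<eta> z t. \<eta> \<in> sphS v m p \<Longrightarrow> z \<in> B \<Longrightarrow> \<bar>t\<bar> < R \<Longrightarrow> T z + t *\<^sub>R \<eta> \<in> \<Omega>"
    and \<omega>: "\<omega> \<in> sphS v m p"
  shows "slice_function mul e cj v m p B R b f \<omega>"
proof -
  have *: "(\<lambda>x. f (T (fst x) + snd x *\<^sub>R \<eta>)) differentiable (at x) \<and>
      continuous_on U (dderiv (\<lambda>x. f (T (fst x) + snd x *\<^sub>R \<eta>)) u) \<and>
      Dp (\<lambda>x. f (T (fst x) + snd x *\<^sub>R \<eta>)) x + mul \<eta> (Dr (\<lambda>x. f (T (fst x) + snd x *\<^sub>R \<eta>)) x) = 0"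
    if \<eta>: "\<eta> \<in> sphS v m p" and x: "x \<in> U" for \<eta> x u
  proof -
    define E where "E = span (insert \<eta> (v ` {0..p}))"
    define L where "L x = T (fst x) + snd x *\<^sub>R \<eta>" for x :: "'a \<times> real"
    have lin: "linear L"
      by (auto simp: L_def linear_iff linear_add[OF linear_T] linear_scale[OF linear_T] scaleR_add_left scaleR_add_right)
    then have bl: "bounded_linear L" by (simp add: linear_conv_bounded_linear)
    have L_E: "L y \<in> E" for y
    proof -
      have "T (fst y) \<in> E"
        using T_in_Rp[of "fst y"] span_mono[of "v ` {0..p}" "insert \<eta> (v ` {0..p})"] by (auto simp: Rp_def E_def)
      moreover have "snd y *\<^sub>R \<eta> \<in> E" unfolding E_def by (intro span_scale span_base) simp
      ultimately show ?thesis unfolding L_def E_def by (rule span_add)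
    qed
    have L_slice: "L y \<in> slice_set \<Omega> v p \<eta>" if "y \<in> U" for y
      using that tube[OF \<eta>, of "fst y" "snd y"] T_in_Rp[of "fst y"] by (cases y) (auto simp: slice_set_def L_def)
    obtain D where D: "\<And>y. y \<in> slice_set \<Omega> v p \<eta> \<Longrightarrow> (f has_derivative D y) (at y within E)"
      "\<And>u. u \<in> E \<Longrightarrow> continuous_on (slice_set \<Omega> v p \<eta>) (\<lambda>y. D y u)"
      using f \<eta> unfolding gpsm_def E_def by blast
    have der: "((\<lambda>x. f (L x)) has_derivative (\<lambda>h. D (L y) (L h))) (at y)" if "y \<in> U" for y
    proof -
      have 1: "(L has_derivative L) (at y)" by (rule bounded_linear_imp_has_derivative[OF bl])
      have 2: "(f has_derivative D (L y)) (at (L y) within range L)"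
        by (rule has_derivative_subset[OF D(1)[OF L_slice[OF that]]]) (use L_E in auto)
      from has_derivative_in_compose[OF 1 2] show ?thesis .
    qed
    have "continuous_on U (\<lambda>y. D (L y) (L u))"
      using L_slice bounded_linear.continuous_on[OF bl continuous_on_id]
      by (intro continuous_on_compose2[OF D(2)[OF L_E]]) auto
    then have 2: "continuous_on U (dderiv (\<lambda>x. f (L x)) u)"
      by (rule continuous_on_eq) (simp add: dderiv_eq[OF der])
    have 1: "(\<lambda>x. f (L x)) differentiable (at x)" using der[OF x] by (rule differentiableI)
    have "Dz (b s) (\<lambda>x. f (L x)) x = pd v s f (L x)" if "s \<le> p" for s
      unfolding pd_def dderiv_def L_def
      by (simp add: linear_add[OF linear_T] linear_scale[OF linear_T] T_b[OF that] add_ac)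
    then have "Dp (\<lambda>x. f (L x)) x = Dxp mul v p f (L x)"
      unfolding Dw_def Dxp_def atLeast0AtMost by (intro sum.cong) auto
    moreover have "Dr (\<lambda>x. f (L x)) x = dderiv f \<eta> (L x)"
      unfolding dderiv_def L_def by (simp add: scaleR_add_left add_ac)
    ultimately have 3: "Dp (\<lambda>x. f (L x)) x + mul \<eta> (Dr (\<lambda>x. f (L x)) x) = 0"
      using f \<eta> L_slice[OF x] unfolding gpsm_def by metis
    from 1 2 3 show ?thesis by (simp only: L_def)
  qed
  show ?thesis
  proof unfold_locales
    fix \<eta> x assume "\<eta> \<in> sphS v m p" "x \<in> U"
    from *[OF this] show "(\<lambda>x. f (T (fst x) + snd x *\<^sub>R \<eta>)) differentiable (at x)"
      and "Dp (\<lambda>x. f (T (fst x) + snd x *\<^sub>R \<eta>)) x + mul \<eta> (Dr (\<lambda>x. f (T (fst x) + snd x *\<^sub>R \<eta>)) x) = 0"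
      by blast+
  next
    fix \<eta> and u :: "'a \<times> real" assume \<eta>: "\<eta> \<in> sphS v m p"
    show "continuous_on U (dderiv (\<lambda>x. f (T (fst x) + snd x *\<^sub>R \<eta>)) u)"
    \<comment> \<open>The facts in \<open>*\<close> are stated at a point of \<open>U\<close>, which
      the empty set does not offer.\<close>
    proof (cases "U = {}")
      case False
      then show ?thesis using *[OF \<eta>] by blast
    qed simp
  qed (rule \<omega>)
qed

end

text \<open>In the slice of \<omega> the segment and its reflection form a compact set, so a uniform
  neighbourhood of it lies in \<Omega>; p-symmetry turns this neighbourhood into all directions
  \<eta>.\<close>

lemma (in alt_algebra) obtain_slice_function:
  assumes dom: "slice_domain v m p \<Omega>" and sym: "p_symmetric v m p \<Omega>" and f: "gpsm mul v m p \<Omega> f"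
    and x: "x \<in> \<Omega>" and segment: "\<And>t. t \<in> {0..1} \<Longrightarrow> xp v m p x + t *\<^sub>R xq v m p x \<in> \<Omega>"
  obtains B R b \<omega> where "slice_function mul e cj v m p B R b f \<omega>" "x \<in> slice_setup.N v m p B R b"
proof -
  have "card {..p} \<le> card (Basis :: 'a set)"
  proof -
    have "card (v ` {0..m}) \<le> DIM('a)" using independent_bound[OF independent_v] by simp
    then show ?thesis using pm by (simp add: card_image[OF inj_v])
  qed
  then obtain b :: "nat \<Rightarrow> 'a" where b: "b ` {..p} \<subseteq> Basis" "inj_on b {..p}"
    using card_le_inj[of "{..p}" "Basis :: 'a set"] by auto
  \<comment> \<open>A provisional instance: \<open>T\<close> and \<open>Zx\<close> depend on neither
    \<open>B\<close> nor \<open>R\<close>, so they are available before these two are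
    chosen.\<close>
  interpret S0: slice_setup mul e cj v m p UNIV 1 b
    by unfold_locales (use b in auto)
  obtain \<omega> where \<omega>: "\<omega> \<in> sphS v m p" "xq v m p x = rad v m p x *\<^sub>R \<omega>"
    by (rule xq_polar)
  obtain V where V: "open V" "\<Omega> = Msp v m \<inter> V"
    using dom unfolding slice_domain_def openin_open by blast
  have xM: "x \<in> Msp v m" using x V by simp
  define r0 where "r0 = rad v m p x"
  have r0: "r0 \<ge> 0" by (simp add: r0_def rad_nonneg)
  define z0 where "z0 = S0.Zx x"
  have pos: "S0.T z0 + t *\<^sub>R \<omega> \<in> \<Omega>" if t: "0 \<le> t" "t \<le> r0" for t
  proof -
    have "t *\<^sub>R \<omega> = (t / r0) *\<^sub>R xq v m p x"
      using t \<omega>(2) by (cases "r0 = 0") (auto simp: r0_def)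
    moreover have "t / r0 \<in> {0..1}" using t by (auto simp: divide_le_eq_1)
    ultimately show ?thesis using segment[of "t / r0"] by (simp add: z0_def S0.T_Zx)
  qed
  \<comment> \<open>Negative t is reduced to positive t by replacing \<eta> with -\<eta>. The case t
    = 0 stands apart because \<open>p_symmetric\<close> speaks of positive radii.\<close>
  have any: "S0.T z + t *\<^sub>R \<eta> \<in> \<Omega>" if "S0.T z + \<bar>t\<bar> *\<^sub>R \<omega> \<in> \<Omega>" "\<eta> \<in> sphS v m p" for z t \<eta>
  proof -
    define \<eta>' where "\<eta>' = (if t \<ge> 0 then \<eta> else - \<eta>)"
    have \<eta>': "\<eta>' \<in> sphS v m p" "t *\<^sub>R \<eta> = \<bar>t\<bar> *\<^sub>R \<eta>'"
      using that(2) sphS_uminus by (auto simp: \<eta>'_def)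
    show ?thesis
    proof (cases "t = 0")
      case False
      then show ?thesis
        using sym that(1) \<omega>(1) \<eta>' S0.T_in_Rp[of z] unfolding p_symmetric_def by (metis zero_less_abs_iff)
    qed (use that in simp)
  qed
  define W where "W = {y. S0.T (fst y) + snd y *\<^sub>R \<omega> \<in> V}"
  have "open W"
  proof -
    have "bounded_linear S0.T" using S0.linear_T by (simp add: linear_conv_bounded_linear)
    then have "continuous_on UNIV (\<lambda>y :: 'a \<times> real. S0.T (fst y))"
      by (rule bounded_linear.continuous_on) (intro continuous_intros)
    then have "continuous_on UNIV (\<lambda>y. S0.T (fst y) + snd y *\<^sub>R \<omega>)"
      by (rule continuous_on_add) (intro continuous_intros)
    with V(1) have "open ((\<lambda>y. S0.T (fst y) + snd y *\<^sub>R \<omega>) -` V)"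
      by (rule open_vimage)
    then show ?thesis by (simp add: W_def vimage_def)
  qed
  moreover have "{z0} \<times> {- r0..r0} \<subseteq> W"
    using any[OF pos \<omega>(1)] V by (auto simp: W_def abs_le_iff)
  moreover have "compact ({z0} \<times> {- r0..r0})" by (intro compact_Times) auto
  ultimately obtain d where d: "d > 0" "(\<Union>y\<in>{z0} \<times> {- r0..r0}. ball y d) \<subseteq> W"
    using compact_subset_open_imp_ball_epsilon_subset by metis
  define B where "B = ball z0 (d / 2)"
  define R where "R = r0 + d / 2"
  interpret S: slice_setup mul e cj v m p B R b
    by unfold_locales (use b d r0 in \<open>auto simp: B_def R_def\<close>)
  have tube: "S.T z + t *\<^sub>R \<eta> \<in> \<Omega>" if "\<eta> \<in> sphS v m p" "z \<in> B" "\<bar>t\<bar> < R" for \<eta> z t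
  proof (rule any[OF _ that(1)])
    \<comment> \<open>The point of the segment parameter range closest to the radius in question; it
      differs from that radius by less than d / 2.\<close>
    define t' where "t' = min r0 \<bar>t\<bar>"
    have "dist (z0, t') (z, \<bar>t\<bar>) < d"
      using that d by (intro dist_Pair_lt) (auto simp: B_def R_def t'_def)
    moreover have "(z0, t') \<in> {z0} \<times> {- r0..r0}" using r0 by (auto simp: t'_def)
    ultimately have "(z, \<bar>t\<bar>) \<in> W" using d(2) by (metis (no_types, lifting) UN_I mem_ball subset_iff)
    moreover have "S0.T z + \<bar>t\<bar> *\<^sub>R \<omega> \<in> Msp v m"
      by (intro subspace_add subspace_scale subspace_Msp S0.T_in_Msp S0.sphS_in_Msp \<omega>)
    ultimately show "S.T z + \<bar>t\<bar> *\<^sub>R \<omega> \<in> \<Omega>" by (simp add: W_def V)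
  qed
  have "slice_function mul e cj v m p B R b f \<omega>"
    by (rule S.slice_functionI[OF f tube \<omega>(1)])
  moreover have "z0 \<in> B" "r0 < R" using d(1) by (simp_all add: B_def R_def)
  then have "x \<in> S.N"
    using xM by (simp add: S.N_def z0_def r0_def)
  ultimately show thesis by (rule that)
qed

theorem theorem5p3:
  fixes mul :: "'a::euclidean_space \<Rightarrow> 'a \<Rightarrow> 'a" and e :: 'a and cj :: "'a \<Rightarrow> 'a"
    and v :: "nat \<Rightarrow> 'a" and m p :: nat and \<Omega> :: "'a set" and f :: "'a \<Rightarrow> 'a"
  assumes "DIM('a) > 1"
    and "real_alt_algebra mul e cj"
    and "sphereA mul e cj \<noteq> {}"
    and "adapted_basis mul e cj v m"
    and "p < m"
    and "slice_domain v m p \<Omega>"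
    and "p_symmetric v m p \<Omega>"
    and "gpsm mul v m p \<Omega> f"
    and "odd (m - p)"
  shows "\<forall>x\<in>\<Omega>. (\<forall>t\<in>{0..1::real}. xp v m p x + t *\<^sub>R xq v m p x \<in> \<Omega>) \<longrightarrow>
     (HGCK_defined v m p (\<lambda>_. 0) ((Lap v p ^^ ((m - p - 1) div 2)) (Dxp mul v p f)) x \<longrightarrow>
        PO v m p ((Lap v m ^^ ((m - p - 1) div 2)) f) x =
        (gamma_q (m - p) / real (m - p)) *\<^sub>R
          HGCK mul v m p (\<lambda>_. 0) ((Lap v p ^^ ((m - p - 1) div 2)) (Dxp mul v p f)) x) \<and>
     (HGCK_defined v m p ((Lap v p ^^ ((m - p - 1) div 2)) f) (\<lambda>_. 0) x \<longrightarrow>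
        PE v m p ((Lap v m ^^ ((m - p - 1) div 2)) f) x =
        gamma_q (m - p) *\<^sub>R HGCK mul v m p ((Lap v p ^^ ((m - p - 1) div 2)) f) (\<lambda>_. 0) x) \<and>
     (GCK_defined mul v m p ((Lap v p ^^ ((m - p - 1) div 2)) (Dxp mul v p f)) x \<longrightarrow>
        Dbar mul v m (PO v m p ((Lap v m ^^ ((m - p - 1) div 2)) f)) x =
        gamma_q (m - p) *\<^sub>R GCK mul v m p ((Lap v p ^^ ((m - p - 1) div 2)) (Dxp mul v p f)) x) \<and>
     (GCK_defined mul v m p (Dbar mul v p ((Lap v p ^^ ((m - p - 1) div 2)) f)) x \<longrightarrow>
        Dbar mul v m (PE v m p ((Lap v m ^^ ((m - p - 1) div 2)) f)) x =
        gamma_q (m - p) *\<^sub>R GCK mul v m p (Dbar mul v p ((Lap v p ^^ ((m - p - 1) div 2)) f)) x)"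
proof (intro ballI impI, goal_cases)
  case (1 x)
  interpret alt_algebra mul e cj v m p
    using assms by unfold_locales
  obtain B R b \<omega> where "slice_function mul e cj v m p B R b f \<omega>" and N: "x \<in> slice_setup.N v m p B R b"
    using obtain_slice_function[OF assms(6,7,8) 1(1)] 1(2) by blast
  then interpret slice_function mul e cj v m p B R b f \<omega> by simp
  have "m - p = 2 * ((m - p - 1) div 2) + 1"
    using assms(9) by presburger
  from slice_identities[OF this N] show ?case by blast
qed

end
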